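(* Assume that any one of the settings (S1), (S2), (S3) described in the context holds, let $\hat\phi_n$ be the convex least squares estimator computed from $(X_1,Y_1),\ldots,(X_n,Y_n)$, and suppose that $\phi$ is differentiable on $\mathfrak{X}^\circ$. Then $$\mathbf{P}_*\left(\sup_{x\in K,\ \xi\in\partial\hat\phi_n(x)}|\xi-\nabla\phi(x)|\to 0\ \text{ for every compact set } K\subset\mathfrak{X}^\circ\right)=1.$$
   Context: Fix $d\ge 1$. In all settings, $\mathfrak{X}\subset\mathbb{R}^d$ is a closed convex set with nonempty interior $\mathfrak{X}^\circ$, and $\phi:\mathbb{R}^d\to(-\infty,+\infty]$ is a proper (i.e. never $-\infty$) convex function with $\mathfrak{X}\subset\mathrm{Dom}(\phi)=\{x:\phi(x)<\infty\}$. For a Borel set $A$ write $N_n(A)=\#\{1\le j\le n:X_j\in A\}$. (S1) Fixed design, i.i.d. errors: $(X_n)_{n\ge1}$ is a non-random sequence in $\mathfrak{X}$; $Y_k=\phi(X_k)+\epsilon_k$ with $(\epsilon_k)$ i.i.d., $\mathbf{E}(\epsilon_k)=0$, $\mathbf{E}(\epsilon_k^2)=\sigma^2<\infty$; there is a Borel probability measure $\nu$ on $\mathfrak{X}$ having exactly the same Borel null sets as Lebesgue measure on $\mathfrak{X}$ and such that $\frac1nN_n(R)\to\nu(R)$ for every open rectangle $R\subset\mathfrak{X}^\circ$. (S2) Fixed design, heteroscedastic errors: $(X_n)$ and $\nu$ are as in (S1); $Y_k=\phi(X_k)+\epsilon_k$ with $(\epsilon_k)$ independent, $\mathbf{E}(\epsilon_k)=0$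 for all $k$, $\liminf_{n}\frac1n\sum_{k=1}^n\mathbf{E}(|\epsilon_k|)>0$, $\sum_{n\ge1}\mathrm{Var}(\epsilon_n^2)/n^2<\infty$, $\sup_n\mathbf{E}(\epsilon_n^2)<\infty$; here $\sigma^2:=\limsup_{n}\frac1n\sum_{j=1}^n\mathbf{E}(\epsilon_j^2)$. (S3) Stochastic design: $(X_n,Y_n)_{n\ge1}$ is i.i.d. from a Borel probability measure $\mu$ on $\mathbb{R}^{d+1}$ with $\mu(\mathfrak{X}\times\mathbb{R})=1$ and $\int y^2\,\mu(dx,dy)<\infty$; for $(X,Y)\sim\mu$, $\mathbf{E}(Y-\phi(X)\mid X)=0$ and $\mathbf{E}(|Y-\phi(X)|^2)=\sigma^2<\infty$; the marginal $\nu(\cdot)=\mu((\cdot)\times\mathbb{R})$ has exactly the same Borel null sets as Lebesgue measure on $\mathfrak{X}$. Estimator: let $Z_n=(Z_n^1,\ldots,Z_n^n)$ be the unique minimizer of $\sum_{k=1}^n|Y_k-z^k|^2$ over all $z\in\mathbb{R}^n$ for which there is a convex $\psi:\mathfrak{X}\to\mathbb{R}$ with $\psi(X_j)=z^j$ for all $j\le n$. Then $\hat\phi_n:\mathbb{R}^d\to(-\infty,+\infty]$ is $$\hat\phi_n(x)=\inf\Big\{\sum_{k=1}^n\theta^kZ_n^k:\ \sum_{k=1}^n\theta^k=1,\ \sum_{k=1}^n\theta^kX_k=x,\ \theta\in\mathbb{R}^n,\ \theta\ge0\Big\},\qquad \inf\emptyset=+\infty.$$ The subdifferential of a convex $f$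 at $x$ is $\partial f(x)=\{\xi\in\mathbb{R}^d:\langle\xi,h\rangle\le f(x+h)-f(x)\ \forall h\in\mathbb{R}^d\}$. $\mathbf{P}_*$ denotes inner probability. *)

theory Defs
  imports "HOL-Probability.Probability"
begin

text \<open>
  The space \<open>\<real>\<^sup>d\<close> with \<open>d \<ge> 1\<close> is an arbitrary type \<open>'a\<close> of class \<open>euclidean_space\<close>. Sequences
  are indexed from 0: \<open>X k\<close> stands for the usual $X_{k+1}$, so the first \<open>n\<close> observations are
  those with index \<open>k < n\<close>. Functions with values in $(-\infty,+\infty]$ are functions into
  \<open>ereal\<close> that do not take the value \<open>-\<infinity>\<close>.
\<close>


section \<open>Extended-real convex functions\<close>

definition convex_ereal :: "('a::real_vector \<Rightarrow> ereal) \<Rightarrow> bool" where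
  "convex_ereal f \<longleftrightarrow>
     (\<forall>x y. \<forall>t\<in>{0<..<1}. f ((1 - t) *\<^sub>R x + t *\<^sub>R y) \<le> ereal (1 - t) * f x + ereal t * f y)"

definition proper_convex :: "('a::real_vector \<Rightarrow> ereal) \<Rightarrow> bool" where
  "proper_convex f \<longleftrightarrow> (\<forall>x. f x \<noteq> - \<infinity>) \<and> convex_ereal f"

definition Dom :: "('a \<Rightarrow> ereal) \<Rightarrow> 'a set" where
  "Dom f = {x. f x < \<infinity>}"

text \<open>
  If \<open>f x = \<infinity>\<close> and \<open>f\<close> is finite somewhere, then \<open>subdifferential f x\<close> is empty, since
  \<open>r - \<infinity> = -\<infinity>\<close> in \<open>ereal\<close> for finite \<open>r\<close>.
\<close>

definition subdifferential :: "('a::real_inner \<Rightarrow> ereal) \<Rightarrow> 'a \<Rightarrow> 'a set" where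
  "subdifferential f x = {\<xi>. \<forall>h. ereal (\<xi> \<bullet> h) \<le> f (x + h) - f x}"

definition gradient :: "('a::real_inner \<Rightarrow> real) \<Rightarrow> 'a \<Rightarrow> 'a" where
  "gradient f x = (THE D. GDERIV f x :> D)"


section \<open>The convex least squares estimator\<close>

text \<open>
  Vectors \<open>z \<in> \<real>\<^sup>n\<close> are the functions in \<open>extensional {..<n}\<close>, i.e. those with value \<open>undefined\<close>
  outside \<open>{..<n}\<close>, so that the minimizer is unique as a function.
\<close>

definition cls_feasible :: "'a::real_vector set \<Rightarrow> (nat \<Rightarrow> 'a) \<Rightarrow> nat \<Rightarrow> (nat \<Rightarrow> real) set" where
  "cls_feasible S x n =
     {z \<in> extensional {..<n}. \<exists>\<psi>::'a \<Rightarrow> real. convex_on S \<psi> \<and> (\<forall>j<n. \<psi> (x j) = z j)}"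

definition cls_values ::
  "'a::real_vector set \<Rightarrow> (nat \<Rightarrow> 'a) \<Rightarrow> (nat \<Rightarrow> real) \<Rightarrow> nat \<Rightarrow> nat \<Rightarrow> real" where
  "cls_values S x y n =
     (THE z. is_arg_min (\<lambda>z. \<Sum>k<n. \<bar>y k - z k\<bar>\<^sup>2) (\<lambda>z. z \<in> cls_feasible S x n) z)"

definition cls_estimator ::
  "'a::real_vector set \<Rightarrow> (nat \<Rightarrow> 'a) \<Rightarrow> (nat \<Rightarrow> real) \<Rightarrow> nat \<Rightarrow> 'a \<Rightarrow> ereal" where
  "cls_estimator S x y n u =
     (INF \<theta> \<in> {\<theta>::nat \<Rightarrow> real. (\<Sum>k<n. \<theta> k) = 1 \<and> (\<Sum>k<n. \<theta> k *\<^sub>R x k) = u \<and> (\<forall>k<n. 0 \<le> \<theta> k)}.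
        ereal (\<Sum>k<n. \<theta> k * cls_values S x y n k))"


section \<open>The three regression settings\<close>

text \<open>Same Borel null subsets of \<open>S\<close> as Lebesgue measure; \<open>lborel\<close> suffices for Borel sets.\<close>

definition same_null_sets_on :: "'a::euclidean_space set \<Rightarrow> 'a measure \<Rightarrow> bool" where
  "same_null_sets_on S \<nu> \<longleftrightarrow>
     (\<forall>A\<in>sets borel. A \<subseteq> S \<longrightarrow> (emeasure \<nu> A = 0 \<longleftrightarrow> emeasure lborel A = 0))"

definition fixed_design :: "'a::euclidean_space set \<Rightarrow> (nat \<Rightarrow> 'a) \<Rightarrow> bool" where
  "fixed_design S x \<longleftrightarrow>
     (\<forall>k. x k \<in> S) \<and>
     (\<exists>\<nu>. sets \<nu> = sets borel \<and> prob_space \<nu> \<and> measure \<nu> S = 1 \<and> same_null_sets_on S \<nu> \<and>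
        (\<forall>a b. box a b \<subseteq> interior S \<longrightarrow>
           (\<lambda>n. real (card {j. j < n \<and> x j \<in> box a b}) / real n) \<longlonglongrightarrow> measure \<nu> (box a b)))"

text \<open>
  \<open>real_of_ereal\<close> is only applied to \<open>\<phi>\<close> at points where it is finite (up to null events). The
  design points are random variables on \<open>M\<close>, which are constant in the fixed design settings.
\<close>

definition fixed_design_model ::
  "'w measure \<Rightarrow> 'a::euclidean_space set \<Rightarrow> ('a \<Rightarrow> ereal) \<Rightarrow> (nat \<Rightarrow> 'w \<Rightarrow> 'a) \<Rightarrow> (nat \<Rightarrow> 'w \<Rightarrow> real) \<Rightarrow>
     (nat \<Rightarrow> 'w \<Rightarrow> real) \<Rightarrow> bool" where
  "fixed_design_model M S \<phi> X Y \<epsilon> \<longleftrightarrow>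
     (\<exists>x. fixed_design S x \<and>
        (\<forall>k. \<forall>\<omega>\<in>space M. X k \<omega> = x k \<and> Y k \<omega> = real_of_ereal (\<phi> (x k)) + \<epsilon> k \<omega>))"

definition setting_iid_errors ::
  "'w measure \<Rightarrow> 'a::euclidean_space set \<Rightarrow> ('a \<Rightarrow> ereal) \<Rightarrow> (nat \<Rightarrow> 'w \<Rightarrow> 'a) \<Rightarrow> (nat \<Rightarrow> 'w \<Rightarrow> real) \<Rightarrow>
     real \<Rightarrow> bool" where
  "setting_iid_errors M S \<phi> X Y \<sigma> \<longleftrightarrow>
     (\<exists>\<epsilon>. fixed_design_model M S \<phi> X Y \<epsilon> \<and>
        prob_space.indep_vars M (\<lambda>_. borel) \<epsilon> UNIV \<and>
        (\<forall>k. distr M borel (\<epsilon> k) = distr M borel (\<epsilon> 0)) \<and>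
        (\<forall>k. integrable M (\<epsilon> k) \<and> prob_space.expectation M (\<epsilon> k) = 0) \<and>
        (\<forall>k. integrable M (\<lambda>\<omega>. (\<epsilon> k \<omega>)\<^sup>2) \<and>
             prob_space.expectation M (\<lambda>\<omega>. (\<epsilon> k \<omega>)\<^sup>2) = \<sigma>\<^sup>2))"

text \<open>
  The summability of the variances of the squared errors includes that each is finite, i.e. that the
  fourth moments exist; this has to be said separately, as integrals default to 0.
\<close>

definition setting_heteroscedastic_errors ::
  "'w measure \<Rightarrow> 'a::euclidean_space set \<Rightarrow> ('a \<Rightarrow> ereal) \<Rightarrow> (nat \<Rightarrow> 'w \<Rightarrow> 'a) \<Rightarrow> (nat \<Rightarrow> 'w \<Rightarrow> real) \<Rightarrow>
     real \<Rightarrow> bool" where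
  "setting_heteroscedastic_errors M S \<phi> X Y \<sigma> \<longleftrightarrow>
     (\<exists>\<epsilon>. fixed_design_model M S \<phi> X Y \<epsilon> \<and>
        prob_space.indep_vars M (\<lambda>_. borel) \<epsilon> UNIV \<and>
        (\<forall>k. integrable M (\<epsilon> k) \<and> prob_space.expectation M (\<epsilon> k) = 0) \<and>
        liminf (\<lambda>n. ereal ((\<Sum>k<n. prob_space.expectation M (\<lambda>\<omega>. \<bar>\<epsilon> k \<omega>\<bar>)) / real n)) > 0 \<and>
        (\<forall>k. integrable M (\<lambda>\<omega>. (\<epsilon> k \<omega>)\<^sup>2) \<and> integrable M (\<lambda>\<omega>. ((\<epsilon> k \<omega>)\<^sup>2)\<^sup>2)) \<and>
        summable (\<lambda>k. prob_space.variance M (\<lambda>\<omega>. (\<epsilon> k \<omega>)\<^sup>2) / (real (Suc k))\<^sup>2) \<and>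
        bdd_above (range (\<lambda>k. prob_space.expectation M (\<lambda>\<omega>. (\<epsilon> k \<omega>)\<^sup>2))) \<and>
        ereal (\<sigma>\<^sup>2) =
          limsup (\<lambda>n. ereal ((\<Sum>k<n. prob_space.expectation M (\<lambda>\<omega>. (\<epsilon> k \<omega>)\<^sup>2)) / real n)))"

text \<open>
  A convex \<open>\<phi>\<close> need not be Borel on the boundary of \<open>S\<close> (a Lebesgue null set, hence a null set of the
  design distribution). Moments of the error \<open>y - \<phi> x\<close> are therefore taken with respect to
  \<open>completion \<mu>\<close>, so that requiring them to exist does not restrict \<open>\<phi>\<close>. The conditioning
  \<open>\<sigma>\<close>-algebra is the one generated by the first coordinate.
\<close>

definition setting_stochastic_design ::
  "'w measure \<Rightarrow> 'a::euclidean_space set \<Rightarrow> ('a \<Rightarrow> ereal) \<Rightarrow> (nat \<Rightarrow> 'w \<Rightarrow> 'a) \<Rightarrow> (nat \<Rightarrow> 'w \<Rightarrow> real) \<Rightarrow>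
     real \<Rightarrow> bool" where
  "setting_stochastic_design M S \<phi> X Y \<sigma> \<longleftrightarrow>
     (\<exists>\<mu> :: ('a \<times> real) measure.
        sets \<mu> = sets borel \<and> prob_space \<mu> \<and> measure \<mu> (S \<times> UNIV) = 1 \<and>
        prob_space.indep_vars M (\<lambda>_. borel) (\<lambda>k \<omega>. (X k \<omega>, Y k \<omega>)) UNIV \<and>
        (\<forall>k. distr M borel (\<lambda>\<omega>. (X k \<omega>, Y k \<omega>)) = \<mu>) \<and>
        integrable \<mu> (\<lambda>(x, y). y\<^sup>2) \<and>
        integrable (completion \<mu>) (\<lambda>(x, y). y - real_of_ereal (\<phi> x)) \<and>
        (AE p in completion \<mu>. real_cond_exp (completion \<mu>) (vimage_algebra UNIV fst borel)
           (\<lambda>(x, y). y - real_of_ereal (\<phi> x)) p = 0) \<and>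
        integrable (completion \<mu>) (\<lambda>(x, y). \<bar>y - real_of_ereal (\<phi> x)\<bar>\<^sup>2) \<and>
        (\<integral>(x, y). \<bar>y - real_of_ereal (\<phi> x)\<bar>\<^sup>2 \<partial>completion \<mu>) = \<sigma>\<^sup>2 \<and>
        same_null_sets_on S (distr \<mu> borel fst))"


section \<open>Inner probability\<close>

definition inner_prob :: "'w measure \<Rightarrow> 'w set \<Rightarrow> real" where
  "inner_prob M A = (SUP B \<in> {B \<in> sets M. B \<subseteq> A}. measure M B)"

end

theory Submission
  imports Defs "HOL-Library.Discrete_Functions"
begin

text \<open>
  The estimator is the projection of the responses onto a convex cone containing \<open>\<phi>\<close>, so the deviations
  \<open>r k\<close> of the estimator from \<open>\<phi>\<close> at the design points satisfy
  \<open>(\<Sum>k<n. (r k)\<^sup>2) \<le> (\<Sum>k<n. \<epsilon> k * r k)\<close>. Hence their mean square is bounded; since every open set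
  contains a positive proportion of the design, convexity makes the estimators bounded and Lipschitz on
  compact subsets of \<open>interior S\<close>, uniformly in \<open>n\<close>. Then the right-hand side is \<open>o(n)\<close>: on small
  cells \<open>r k\<close> is nearly constant and the errors average out, and outside a large compact set the errors
  have small mean square. So the estimators
  converge locally uniformly, and convergence of subgradients follows from differentiability of the
  convex limit.
\<close>

text \<open>The deviations \<open>r k\<close> depend on all the errors at once, so no law of large
  numbers applies to \<open>\<Sum>k<n. \<epsilon> k * r k\<close> itself. Probability therefore
  enters only through countably many sums that do not involve the fit: errors summed over finite
  unions of members of a countable base, and squared errors that are truncated or restricted to
  complements of compact sets. Off one null set the fit is then treated deterministically, for all
  compact sets at once. Only the centred sums need an exact limit. For sums of squares an upper
  bound with the right order suffices, so the laws for nonnegative variables may lose a factor 2.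
  Near the boundary and far away nothing is known about \<open>r k\<close> beyond the global mean
  square bound. This is why the errors there must have small mean square: a weighted Young
  inequality then makes their correlation with \<open>r k\<close> small. A Lipschitz bound is
  available only on compact subsets of the interior, and it is used twice: to freeze
  \<open>r k\<close> on small cells, and to turn a small mean square into a small supremum.\<close>

text \<open>The weights are indexed by observations instead of points, because design points may
  coincide and the infimum in \<open>cls_estimator\<close> runs over such weights.\<close>

lemma convex_hull_image_lessThan:
  fixes f :: "nat \<Rightarrow> 'b::real_vector"
  shows "convex hull (f ` {..<n}) =
    {u. \<exists>\<theta>. (\<Sum>k<n. \<theta> k) = 1 \<and> (\<Sum>k<n. \<theta> k *\<^sub>R f k) = u \<and> (\<forall>k<n. 0 \<le> \<theta> k)}" (is "_ = ?T")
proof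
  have "convex ?T"
  proof (rule convexI; clarsimp)
    fix s t :: real and \<theta> \<eta> :: "nat \<Rightarrow> real"
    assume st: "0 \<le> s" "0 \<le> t" "s + t = 1"
      and th: "sum \<theta> {..<n} = 1" "\<forall>k<n. 0 \<le> \<theta> k" "sum \<eta> {..<n} = 1" "\<forall>k<n. 0 \<le> \<eta> k"
    show "\<exists>\<zeta>. sum \<zeta> {..<n} = 1 \<and>
            (\<Sum>k<n. \<zeta> k *\<^sub>R f k) = s *\<^sub>R (\<Sum>k<n. \<theta> k *\<^sub>R f k) + t *\<^sub>R (\<Sum>k<n. \<eta> k *\<^sub>R f k) \<and>
            (\<forall>k<n. 0 \<le> \<zeta> k)"
      using st th
      by (intro exI[of _ "\<lambda>k. s * \<theta> k + t * \<eta> k"])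
        (auto simp: sum.distrib sum_distrib_left[symmetric] scaleR_add_left scaleR_sum_right)
  qed
  moreover have "f ` {..<n} \<subseteq> ?T"
  proof clarsimp
    fix j assume "j < n"
    have "(\<Sum>k<n. (if k = j then 1 else 0) *\<^sub>R f k) = (\<Sum>k<n. if k = j then f k else 0)"
      by (intro sum.cong) auto
    then show "\<exists>\<theta>. sum \<theta> {..<n} = 1 \<and> (\<Sum>k<n. \<theta> k *\<^sub>R f k) = f j \<and> (\<forall>k<n. 0 \<le> \<theta> k)"
      using \<open>j < n\<close> by (intro exI[of _ "\<lambda>k. if k = j then 1 else 0"]) (auto simp: sum.delta)
  qed
  ultimately show "convex hull (f ` {..<n}) \<subseteq> ?T" by (intro hull_minimal)
  show "?T \<subseteq> convex hull (f ` {..<n})"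
    by (auto intro!: convex_sum[OF _ convex_convex_hull] intro: hull_inc)
qed

section \<open>Convex functions on Euclidean space\<close>

text \<open>A point \<open>y\<close> outside the hull of \<open>T\<close> is strictly separated from
  it. Every \<open>v\<close> is \<rho>-close to \<open>T\<close>, so the half-space loosened by
  \<rho> times the norm of \<open>a\<close> contains the hull of \<open>V\<close>; moving
  \<open>y\<close> by \<rho> against \<open>a\<close> violates it. This lets design points replace
  the vertices of a fixed polytope.\<close>

lemma convex_hull_perturb_ball:
  fixes p :: "'a::euclidean_space"
  assumes fin: "finite T" and near: "\<And>v. v \<in> V \<Longrightarrow> \<exists>u\<in>T. dist v u < \<rho>"
    and sub: "ball p (2 * \<rho>) \<subseteq> convex hull V" and "0 < \<rho>"
  shows "ball p \<rho> \<subseteq> convex hull T"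
proof
  fix y assume y: "y \<in> ball p \<rho>"
  show "y \<in> convex hull T"
  proof (rule ccontr)
    assume "y \<notin> convex hull T"
    moreover have "closed (convex hull T)" "convex (convex hull T)"
      by (auto simp: fin finite_imp_compact_convex_hull compact_imp_closed)
    ultimately obtain a b where ab: "a \<bullet> y < b" "\<And>x. x \<in> convex hull T \<Longrightarrow> b < a \<bullet> x"
      using separating_hyperplane_closed_point by metis
    have "p \<in> convex hull V" using sub \<open>0 < \<rho>\<close> by (auto intro: subsetD)
    then have "V \<noteq> {}" by auto
    then have "T \<noteq> {}" using near by blast
    have "a \<noteq> 0" using ab(1) \<open>T \<noteq> {}\<close> ab(2)[OF hull_inc] by fastforce
    \<comment> \<open>The shift has length \<rho>, so \<open>z\<close> still lies in the doubled
      ball, where the hull of \<open>V\<close> is available.\<close>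
    define z where "z = y - (\<rho> / norm a) *\<^sub>R a"
    have "V \<subseteq> {x. a \<bullet> x \<ge> b - norm a * \<rho>}"
    proof
      fix v assume "v \<in> V"
      then obtain u where u: "u \<in> T" "dist v u < \<rho>" using near by blast
      have "a \<bullet> (u - v) \<le> norm a * norm (u - v)" by (rule norm_cauchy_schwarz)
      also have "\<dots> \<le> norm a * \<rho>" using u by (intro mult_left_mono) (auto simp: dist_norm norm_minus_commute)
      finally show "v \<in> {x. a \<bullet> x \<ge> b - norm a * \<rho>}" using ab(2)[OF hull_inc[OF u(1)]] by (simp add: inner_diff_right)
    qed
    then have *: "convex hull V \<subseteq> {x. a \<bullet> x \<ge> b - norm a * \<rho>}"
      by (intro hull_minimal) (auto simp: convex_halfspace_ge)
    have "dist p z \<le> dist p y + dist y z" by (rule dist_triangle)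
    also have "dist y z = \<rho>" using \<open>a \<noteq> 0\<close> \<open>0 < \<rho>\<close> by (simp add: z_def dist_norm)
    finally have "z \<in> ball p (2 * \<rho>)" using y by simp
    then have "a \<bullet> z \<ge> b - norm a * \<rho>" using sub * by auto
    moreover have "a \<bullet> z = a \<bullet> y - norm a * \<rho>"
      using \<open>a \<noteq> 0\<close> by (simp add: z_def inner_diff_right power2_norm_eq_inner[symmetric] power2_eq_square)
    ultimately show False using ab(1) by simp
  qed
qed

text \<open>\<open>V\<close> is the vertex set of a cube of half-side \<open>d\<close> around
  \<open>p\<close>. The norm is at most the sum of the absolute coordinates, so dividing by the
  dimension keeps the vertices inside the ball.\<close>

lemma ball_in_convex_hull_finite:
  fixes p :: "'a::euclidean_space"
  assumes "0 < r"
  obtains V \<rho> where "finite V" "0 < \<rho>" "V \<subseteq> ball p r" "ball p (2 * \<rho>) \<subseteq> convex hull V"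
proof -
  define d where "d = r / (2 * real DIM('a))"
  have d: "0 < d" using assms by (simp add: d_def)
  let ?u = "\<Sum>i\<in>Basis. d *\<^sub>R i :: 'a"
  obtain V where V: "finite V" "cbox (p - ?u) (p + ?u) = convex hull V"
    using cube_convex_hull[OF d] by blast
  have box: "y \<in> cbox (p - ?u) (p + ?u) \<longleftrightarrow> (\<forall>i\<in>Basis. \<bar>(y - p) \<bullet> i\<bar> \<le> d)" for y
    by (auto simp: mem_box algebra_simps abs_le_iff inner_sum_left inner_Basis if_distrib cong: if_cong)
  have "y \<in> ball p r" if "y \<in> V" for y
  proof -
    have "y \<in> cbox (p - ?u) (p + ?u)" using that V by (simp add: hull_inc)
    then have "norm (y - p) \<le> real DIM('a) * d"
      unfolding box using norm_le_l1[of "y - p"] sum_bounded_above[of Basis "\<lambda>i. \<bar>(y - p) \<bullet> i\<bar>" d] by auto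
    also have "\<dots> = r / 2" by (simp add: d_def)
    finally show ?thesis using assms by (simp add: dist_norm norm_minus_commute)
  qed
  moreover have "ball p (2 * (d / 2)) \<subseteq> convex hull V"
    unfolding V(2)[symmetric]
    by (auto simp: box dist_norm norm_minus_commute intro!: order_trans[OF Basis_le_norm])
  ultimately show ?thesis using that[of V "d / 2"] V(1) d by (simp add: subset_iff)
qed

text \<open>Prolong the segment from \<open>x\<close> to \<open>y\<close> by \<rho> beyond
  \<open>y\<close>. The endpoint \<open>z\<close> stays in the doubled ball and \<open>y\<close> is
  a convex combination of \<open>x\<close> and \<open>z\<close> with weight
  \<open>n / (n + \<rho>)\<close> on \<open>z\<close>, so the growth from \<open>x\<close> to
  \<open>y\<close> is at most that weight times \<open>2 * B\<close>.\<close>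

lemma convex_on_bounded_imp_lipschitz:
  fixes f :: "'a::real_normed_vector \<Rightarrow> real"
  assumes f: "convex_on (ball p (2 * \<rho>)) f" and "0 < \<rho>"
    and B: "\<And>x. x \<in> ball p (2 * \<rho>) \<Longrightarrow> \<bar>f x\<bar> \<le> B" and "x \<in> ball p \<rho>" "y \<in> ball p \<rho>"
  shows "\<bar>f x - f y\<bar> \<le> 2 * B / \<rho> * dist x y"
proof -
  have *: "f y - f x \<le> 2 * B / \<rho> * dist x y" if "x \<in> ball p \<rho>" "y \<in> ball p \<rho>" for x y
  proof (cases "x = y")
    case False
    define n where "n = norm (y - x)"
    have n: "n > 0" using False by (simp add: n_def)
    define z where "z = y + (\<rho> / n) *\<^sub>R (y - x)"
    define t where "t = n / (n + \<rho>)"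
    have t: "0 \<le> t" "t \<le> 1" using n \<open>0 < \<rho>\<close> by (auto simp: t_def)
    have "dist y z = \<rho>" using n \<open>0 < \<rho>\<close> by (simp add: z_def dist_norm n_def)
    then have "dist p z < 2 * \<rho>" using dist_triangle[of p z y] that by auto
    then have z: "z \<in> ball p (2 * \<rho>)" by simp
    have x: "x \<in> ball p (2 * \<rho>)" using that \<open>0 < \<rho>\<close> by auto
    have "1 + \<rho> / n = (n + \<rho>) / n" "n + \<rho> \<noteq> 0" using n \<open>0 < \<rho>\<close> by (auto simp: field_simps)
    then have t': "t * (1 + \<rho> / n) = 1" using n by (simp add: t_def)
    have "(1 - t) *\<^sub>R x + t *\<^sub>R z = x + (t * (1 + \<rho> / n)) *\<^sub>R (y - x)"
      by (simp add: z_def algebra_simps)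
    also have "\<dots> = y" by (simp add: t')
    finally have "f y \<le> (1 - t) * f x + t * f z"
      using convex_onD[OF f t x z] by simp
    then have "f y - f x \<le> t * (f z - f x)" by (simp add: algebra_simps)
    also have "\<dots> \<le> t * (2 * B)" using B[OF x] B[OF z] t by (intro mult_left_mono) auto
    also have "\<dots> \<le> n / \<rho> * (2 * B)"
    proof (rule mult_right_mono)
      show "t \<le> n / \<rho>" using n \<open>0 < \<rho>\<close> unfolding t_def by (intro frac_le) auto
      show "0 \<le> 2 * B" using B[OF x] by auto
    qed
    finally show ?thesis by (simp add: n_def dist_norm norm_minus_commute mult.commute)
  qed auto
  from *[OF assms(4,5)] *[OF assms(5,4)] show ?thesis by (auto simp: dist_commute abs_le_iff)
qed

section \<open>Gradients and approximate subgradients of convex functions\<close>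

text \<open>\<open>gradient\<close> is a definite description, so both existence (the derivative
  represented by an inner product) and uniqueness are required.\<close>

lemma gradient_GDERIV:
  fixes f :: "'a::euclidean_space \<Rightarrow> real"
  assumes "f differentiable at x"
  shows "GDERIV f x :> gradient f x"
proof -
  obtain f' where f': "(f has_derivative f') (at x)" using assms by (auto simp: differentiable_def)
  then have "bounded_linear f'" by (rule has_derivative_bounded_linear)
  then have "linear f'" by (rule bounded_linear.linear)
  have "\<exists>D. \<forall>h. f' h = h \<bullet> D"
  proof (intro exI allI)
    fix h
    have "f' h = f' (\<Sum>i\<in>Basis. (h \<bullet> i) *\<^sub>R i)" by (simp add: euclidean_representation)
    also have "\<dots> = h \<bullet> (\<Sum>i\<in>Basis. f' i *\<^sub>R i)"
      by (simp add: linear_sum[OF \<open>linear f'\<close>] linear_scale[OF \<open>linear f'\<close>] inner_sum_right mult.commute)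
    finally show "f' h = h \<bullet> (\<Sum>i\<in>Basis. f' i *\<^sub>R i)" .
  qed
  then obtain D where D: "f' = (\<lambda>h. h \<bullet> D)" by auto
  then have "GDERIV f x :> D" using f' by (simp add: gderiv_def)
  moreover have "D' = D" if "GDERIV f x :> D'" for D'
  proof -
    have "(\<lambda>h. h \<bullet> D') = (\<lambda>h. h \<bullet> D)"
      using that f' unfolding gderiv_def D by (rule has_derivative_unique)
    then show ?thesis by (metis inner_commute vector_eq_ldot)
  qed
  ultimately show ?thesis unfolding gradient_def by (rule theI)
qed

text \<open>By convexity the difference quotients along \<open>h\<close> with step in (0,1) stay
  below the increment of \<open>g\<close>; the step tends to 0 from the right.\<close>

lemma gradient_subgradient:
  fixes g :: "'a::euclidean_space \<Rightarrow> real"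
  assumes g: "convex_on U g" and x: "x \<in> U" "x + h \<in> U" and D: "GDERIV g x :> D"
  shows "D \<bullet> h \<le> g (x + h) - g x"
proof -
  have "((\<lambda>t. g (x + t *\<^sub>R h)) has_derivative (\<lambda>t. (t *\<^sub>R h) \<bullet> D)) (at (0::real))"
  proof (rule has_derivative_compose[where f = "\<lambda>t. x + t *\<^sub>R h" and g = g])
    show "((\<lambda>t. x + t *\<^sub>R h) has_derivative (\<lambda>t. t *\<^sub>R h)) (at 0)"
      by (auto intro!: derivative_eq_intros)
    show "(g has_derivative (\<lambda>u. u \<bullet> D)) (at (x + 0 *\<^sub>R h))" using D by (simp add: gderiv_def)
  qed
  then have "((\<lambda>t. g (x + t *\<^sub>R h)) has_field_derivative D \<bullet> h) (at 0)"
    by (simp add: has_field_derivative_def inner_commute mult.commute[of _ "D \<bullet> h"])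
  then have "((\<lambda>t. (g (x + t *\<^sub>R h) - g x) / t) \<longlongrightarrow> D \<bullet> h) (at 0)"
    by (simp add: DERIV_def)
  then have "((\<lambda>t. (g (x + t *\<^sub>R h) - g x) / t) \<longlongrightarrow> D \<bullet> h) (at_right 0)"
    by (rule tendsto_within_subset[OF _ subset_UNIV])
  moreover have "\<forall>\<^sub>F t in at_right (0::real). (g (x + t *\<^sub>R h) - g x) / t \<le> g (x + h) - g x"
  proof (rule eventually_at_rightI[of 0 1])
    fix t :: real assume "t \<in> {0<..<1}"
    then have t: "0 < t" "t < 1" by auto
    have "(1 - t) *\<^sub>R x + t *\<^sub>R (x + h) = x + t *\<^sub>R h" by (simp add: algebra_simps)
    then have "g (x + t *\<^sub>R h) \<le> (1 - t) * g x + t * g (x + h)"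
      using convex_onD[OF g _ _ x, of t] t by simp
    then show "(g (x + t *\<^sub>R h) - g x) / t \<le> g (x + h) - g x"
      using t by (simp add: field_simps)
  qed simp
  ultimately show ?thesis by (rule tendsto_upperbound) simp
qed

text \<open>The function \<open>g u - \<xi> \<bullet> u\<close> has a local minimum at
  \<open>x\<close>, so its derivative there vanishes.\<close>

lemma subgradient_unique:
  fixes g :: "'a::euclidean_space \<Rightarrow> real"
  assumes D: "GDERIV g x :> D" and "0 < \<rho>" and sub: "\<And>h. norm h < \<rho> \<Longrightarrow> \<xi> \<bullet> h \<le> g (x + h) - g x"
  shows "\<xi> = D"
proof -
  have "((\<lambda>u. g u - \<xi> \<bullet> u) has_derivative (\<lambda>h. h \<bullet> D - \<xi> \<bullet> h)) (at x)"
    using D unfolding gderiv_def by (auto intro!: derivative_eq_intros)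
  moreover have "\<forall>y\<in>ball x \<rho>. g x - \<xi> \<bullet> x \<le> g y - \<xi> \<bullet> y"
  proof
    fix y assume "y \<in> ball x \<rho>"
    then show "g x - \<xi> \<bullet> x \<le> g y - \<xi> \<bullet> y"
      using sub[of "y - x"] by (simp add: dist_norm norm_minus_commute inner_diff_right)
  qed
  ultimately have "(\<lambda>h. h \<bullet> D - \<xi> \<bullet> h) = (\<lambda>v. 0)"
    using \<open>0 < \<rho>\<close> by (intro differential_zero_maxmin[of x "ball x \<rho>"]) auto
  then have "\<forall>h. \<xi> \<bullet> h = D \<bullet> h" by (simp add: fun_eq_iff inner_commute)
  then show ?thesis by (metis inner_commute vector_eq_ldot)
qed

text \<open>A subgradient of a convex function uniformly close to \<open>g\<close> is a subgradient
  of \<open>g\<close> up to an additive \<delta>, so this is the form in which closeness of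
  functions passes to slopes. The proof is by compactness: counterexamples with \<delta> tending to
  0 have bounded slopes, and every limit of them is an exact subgradient of \<open>g\<close>, hence
  its gradient.\<close>

lemma approx_subgradient_near_gradient:
  fixes g :: "'a::euclidean_space \<Rightarrow> real"
  assumes U: "open U" and g: "convex_on U g" and diff: "g differentiable_on U"
    and K: "compact K" "K \<subseteq> U" and sub: "\<And>x h. x \<in> K \<Longrightarrow> norm h \<le> \<rho> \<Longrightarrow> x + h \<in> U" and "0 < \<rho>" "0 < \<epsilon>"
  shows "\<exists>\<delta>>0. \<forall>x\<in>K. \<forall>\<xi>. (\<forall>h. norm h < \<rho> \<longrightarrow> \<xi> \<bullet> h \<le> g (x + h) - g x + \<delta>) \<longrightarrow> norm (\<xi> - gradient g x) < \<epsilon>"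
proof (rule ccontr)
  have G: "GDERIV g x :> gradient g x" if "x \<in> U" for x
    using diff that U by (intro gradient_GDERIV) (auto simp: differentiable_on_eq_differentiable_at)
  have cont: "continuous_on U g" by (rule convex_on_continuous[OF U g])
  let ?K = "{x + h | x h. x \<in> K \<and> h \<in> cball 0 \<rho>}"
  have "compact ?K" using K by (intro compact_sums) auto
  moreover have "?K \<subseteq> U" using sub by auto
  ultimately have "bounded (g ` ?K)"
    by (intro compact_imp_bounded compact_continuous_image continuous_on_subset[OF cont])
  then obtain B where B: "\<And>x. x \<in> ?K \<Longrightarrow> \<bar>g x\<bar> \<le> B" by (auto simp: bounded_iff)
  have B': "\<bar>g (x + h)\<bar> \<le> B" if "x \<in> K" "norm h \<le> \<rho>" for x h
    using B[of "x + h"] that by force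
  \<comment> \<open>Testing a slope with the step of length \<rho>/2 in its own direction bounds its
    norm by this value, as \<delta> is at most 1.\<close>
  define R where "R = (2 * B + 1) / (\<rho> / 2)"
  have bound: "norm \<xi> \<le> R" if "x \<in> K" "\<forall>h. norm h < \<rho> \<longrightarrow> \<xi> \<bullet> h \<le> g (x + h) - g x + \<delta>" "\<delta> \<le> 1" for x \<xi> \<delta>
  proof (cases "\<xi> = 0")
    case True
    then show ?thesis using B'[OF that(1), of 0] \<open>0 < \<rho>\<close> by (simp add: R_def)
  next
    case False
    let ?h = "(\<rho> / 2 / norm \<xi>) *\<^sub>R \<xi>"
    have h: "norm ?h = \<rho> / 2" using False \<open>0 < \<rho>\<close> by simp
    then have "\<xi> \<bullet> ?h \<le> g (x + ?h) - g x + \<delta>" using \<open>0 < \<rho>\<close> by (intro that(2)[rule_format]) linarith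
    also have "\<dots> \<le> 2 * B + 1" using B'[OF that(1), of ?h] B'[OF that(1), of 0] h \<open>0 < \<rho>\<close> that(3) by auto
    finally have "norm \<xi> * (\<rho> / 2) \<le> 2 * B + 1"
      using False by (simp add: power2_norm_eq_inner[symmetric] power2_eq_square field_simps)
    then show ?thesis using \<open>0 < \<rho>\<close> unfolding R_def by (subst pos_le_divide_eq) auto
  qed
  \<comment> \<open>Used twice: for the approximate subgradients, and with \<delta> = 0 for the
    gradients at the same points. The second use supplies the continuity of the gradient.\<close>
  have limit: "\<xi> = gradient g x"
    if "x \<in> K" "xs \<longlonglongrightarrow> x" "\<xi>s \<longlonglongrightarrow> \<xi>" "\<delta>s \<longlonglongrightarrow> 0" "\<And>m. xs m \<in> K"
      "\<And>m h. norm h < \<rho> \<Longrightarrow> \<xi>s m \<bullet> h \<le> g (xs m + h) - g (xs m) + \<delta>s m"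
    for x xs \<xi> \<xi>s and \<delta>s :: "nat \<Rightarrow> real"
  proof (rule subgradient_unique[OF G \<open>0 < \<rho>\<close>])
    show "x \<in> U" using that K by auto
    fix h :: 'a assume h: "norm h < \<rho>"
    have *: "(\<lambda>m. g (xs m + h')) \<longlonglongrightarrow> g (x + h')" if "norm h' < \<rho>" for h'
      using that sub \<open>x \<in> K\<close> \<open>xs \<longlonglongrightarrow> x\<close> \<open>\<And>m. xs m \<in> K\<close>
      by (intro continuous_on_tendsto_compose[OF cont]) (auto intro!: tendsto_intros always_eventually)
    have "(\<lambda>m. g (xs m + h) - g (xs m + 0) + \<delta>s m) \<longlonglongrightarrow> g (x + h) - g (x + 0) + 0"
      by (intro tendsto_add tendsto_diff * that h) (simp add: \<open>0 < \<rho>\<close>)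
    moreover have "(\<lambda>m. \<xi>s m \<bullet> h) \<longlonglongrightarrow> \<xi> \<bullet> h"
      by (intro tendsto_intros that)
    ultimately show "\<xi> \<bullet> h \<le> g (x + h) - g x"
      using that(6) h by (intro LIMSEQ_le[of "\<lambda>m. \<xi>s m \<bullet> h" _ "\<lambda>m. g (xs m + h) - g (xs m + 0) + \<delta>s m"]) auto
  qed
  assume "\<not> ?thesis"
  then have "\<exists>x \<xi>. x \<in> K \<and> (\<forall>h. norm h < \<rho> \<longrightarrow> \<xi> \<bullet> h \<le> g (x + h) - g x + 1 / Suc m) \<and>
      norm (\<xi> - gradient g x) \<ge> \<epsilon>" for m :: nat
    by (metis not_less of_nat_0_less_iff zero_less_Suc zero_less_divide_1_iff)
  then obtain xs \<xi>s where x\<xi>: "\<And>m. xs m \<in> K"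
      "\<And>m h. norm h < \<rho> \<Longrightarrow> \<xi>s m \<bullet> h \<le> g (xs m + h) - g (xs m) + 1 / Suc m"
      "\<And>m. norm (\<xi>s m - gradient g (xs m)) \<ge> \<epsilon>"
    by metis
  have D: "gradient g (xs m) \<bullet> h \<le> g (xs m + h) - g (xs m) + 0" if "norm h < \<rho>" for m h
    using gradient_subgradient[OF g _ _ G, of "xs m" h] x\<xi>(1)[of m] K sub[of "xs m" h] that by auto
  have "seq_compact (K \<times> cball (0::'a) R \<times> cball (0::'a) R)"
    using K by (intro compact_imp_seq_compact compact_Times compact_cball)
  moreover have "\<forall>m. (xs m, \<xi>s m, gradient g (xs m)) \<in> K \<times> cball 0 R \<times> cball 0 R"
  proof
    fix m show "(xs m, \<xi>s m, gradient g (xs m)) \<in> K \<times> cball 0 R \<times> cball 0 R"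
    using x\<xi>(1)[of m] bound[OF x\<xi>(1)[of m], of "\<xi>s m" "1 / real (Suc m)"]
      bound[OF x\<xi>(1)[of m], of "gradient g (xs m)" 0] x\<xi>(2)[of _ m] D[of _ m]
    by auto
  qed
  ultimately obtain l r where lr: "l \<in> K \<times> cball 0 R \<times> cball 0 R" "strict_mono r"
      "((\<lambda>m. (xs m, \<xi>s m, gradient g (xs m))) \<circ> r) \<longlonglongrightarrow> l"
    by (rule seq_compactE)
  obtain x \<xi> \<eta> where l: "l = (x, \<xi>, \<eta>)" by (cases l) auto
  have lim: "(xs \<circ> r) \<longlonglongrightarrow> x" "(\<xi>s \<circ> r) \<longlonglongrightarrow> \<xi>" "(\<lambda>m. gradient g (xs (r m))) \<longlonglongrightarrow> \<eta>"
    using tendsto_fst[OF lr(3)] tendsto_fst[OF tendsto_snd[OF lr(3)]] tendsto_snd[OF tendsto_snd[OF lr(3)]]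
    by (auto simp: l o_def)
  have "x \<in> K" using lr l by auto
  have "(\<lambda>m. 1 / real (Suc (r m))) \<longlonglongrightarrow> 0"
    using LIMSEQ_subseq_LIMSEQ[OF LIMSEQ_Suc[OF lim_1_over_n] lr(2)] by (simp add: o_def)
  then have "\<xi> = gradient g x"
    using x\<xi>(1) x\<xi>(2)[of _ "r _"]
    by (intro limit[OF \<open>x \<in> K\<close> lim(1,2), of "\<lambda>m. 1 / real (Suc (r m))"]) (simp_all only: o_def)
  moreover have "\<eta> = gradient g x"
    using D by (intro limit[OF \<open>x \<in> K\<close> lim(1,3), of "\<lambda>_. 0"]) (auto simp: x\<xi>)
  ultimately have "(\<lambda>m. norm ((\<xi>s \<circ> r) m - gradient g (xs (r m)))) \<longlonglongrightarrow> norm (\<xi> - \<xi>)"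
    by (intro tendsto_norm tendsto_diff lim(2)) (use lim(3) in simp)
  then have "\<epsilon> \<le> norm (\<xi> - \<xi>)" by (rule LIMSEQ_le_const) (auto simp: x\<xi>)
  then show False using \<open>0 < \<epsilon>\<close> by simp
qed

section \<open>Existence and structure of the estimator\<close>

text \<open>Says that no point \<open>(x j, z j)\<close> lies above the lower boundary of the convex
  hull of all the points. These are linear inequalities in \<open>z\<close>, so closedness and
  convexity of the set are immediate, and the values beyond \<open>n\<close> are left free. Equal
  design points force equal values.\<close>

definition interpolable :: "(nat \<Rightarrow> 'a::real_vector) \<Rightarrow> nat \<Rightarrow> (nat \<Rightarrow> real) \<Rightarrow> bool" where
  "interpolable x n z \<longleftrightarrow>
     (\<forall>j<n. \<forall>\<theta>. (\<Sum>k<n. \<theta> k) = 1 \<and> (\<Sum>k<n. \<theta> k *\<^sub>R x k) = x j \<and> (\<forall>k<n. 0 \<le> \<theta> k) \<longrightarrow> z j \<le> (\<Sum>k<n. \<theta> k * z k))"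

lemma interpolable_cong: "(\<And>k. k < n \<Longrightarrow> z k = w k) \<Longrightarrow> interpolable x n z \<longleftrightarrow> interpolable x n w"
  by (auto simp: interpolable_def)

text \<open>A polytope has finitely many facets, so one of them separates from it all points just below
  \<open>(x j, z j)\<close>; its normal gives the slope.\<close>

lemma interpolable_subgradient:
  fixes x :: "nat \<Rightarrow> 'a::euclidean_space"
  assumes "interpolable x n z" "j < n"
  shows "\<exists>\<xi>. \<forall>k<n. \<xi> \<bullet> (x k - x j) \<le> z k - z j"
proof -
  let ?P = "convex hull ((\<lambda>k. (x k, z k)) ` {..<n})"
  have "polytope ?P" by (auto simp: polytope_def)
  then have "polyhedron ?P" by (rule polytope_imp_polyhedron)
  then obtain F where F_all: "finite F \<and> ?P = \<Inter>F \<and> (\<forall>h\<in>F. \<exists>a b. a \<noteq> 0 \<and> h = {x. a \<bullet> x \<le> b})"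
    unfolding polyhedron_def by (rule exE)
  have F: "finite F" "?P = \<Inter>F" "\<And>h. h \<in> F \<Longrightarrow> \<exists>a b. a \<noteq> 0 \<and> h = {x. a \<bullet> x \<le> b}"
    using F_all by simp_all
  have mem: "(x k, z k) \<in> h" if "k < n" "h \<in> F" for k h
    using that F(2) hull_subset[of "(\<lambda>k. (x k, z k)) ` {..<n}" convex] by auto
  have notP: "(x j, z j - t) \<notin> ?P" if "0 < t" for t
  proof
    assume "(x j, z j - t) \<in> ?P"
    then obtain \<theta> where "(\<Sum>k<n. \<theta> k) = 1" "(\<Sum>k<n. \<theta> k *\<^sub>R (x k, z k)) = (x j, z j - t)" "\<forall>k<n. 0 \<le> \<theta> k"
      unfolding convex_hull_image_lessThan by blast
    moreover from this(2) have "(\<Sum>k<n. \<theta> k *\<^sub>R x k) = x j" "(\<Sum>k<n. \<theta> k * z k) = z j - t"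
      by (auto simp: prod_eq_iff fst_sum snd_sum)
    ultimately show False using assms that unfolding interpolable_def by force
  qed
  \<comment> \<open>One facet must exclude all points below \<open>(x j, z j)\<close>. Otherwise
    each half-space would contain some such point, and by convexity the one at the least depth
    \<open>s\<close> would lie in all of them, hence in the polytope.\<close>
  have "\<exists>h\<in>F. \<forall>t>0. (x j, z j - t) \<notin> h"
  proof (rule ccontr)
    assume "\<not> ?thesis"
    then obtain t where t: "\<And>h. h \<in> F \<Longrightarrow> t h > 0 \<and> (x j, z j - t h) \<in> h" by metis
    \<comment> \<open>Inserting 1 keeps the minimum meaningful when \<open>F\<close> is
      empty.\<close>
    define s where "s = Min (insert 1 (t ` F))"
    have s: "s > 0" "\<And>h. h \<in> F \<Longrightarrow> s \<le> t h" using F(1) t by (auto simp: s_def Min_gr_iff)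
    have "(x j, z j - s) \<in> h" if hF: "h \<in> F" for h
    proof -
      obtain a b where h: "h = {x. a \<bullet> x \<le> b}" using F(3)[OF hF] by blast
      have "a \<bullet> (x j, z j) \<le> b" "a \<bullet> (x j, z j - t h) \<le> b"
        using mem[OF \<open>j < n\<close> that] t[OF that] h by auto
      then have "fst a \<bullet> x j + snd a * z j \<le> b" "fst a \<bullet> x j + snd a * z j - snd a * t h \<le> b"
        by (auto simp: inner_prod_def algebra_simps)
      moreover have "- (snd a * s) \<le> max 0 (- (snd a * t h))"
      proof (cases "snd a \<ge> 0")
        case True
        then have "0 \<le> snd a * s" using s(1) by simp
        then show ?thesis by linarith
      next
        case False
        then have "snd a * t h \<le> snd a * s" using s(2)[OF hF] by (simp add: mult_left_mono_neg)
        then show ?thesis by linarith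
      qed
      ultimately have "fst a \<bullet> x j + snd a * z j - snd a * s \<le> b" by (auto simp: max_def split: if_splits)
      then show ?thesis by (auto simp: h inner_prod_def algebra_simps)
    qed
    then show False using notP[OF s(1)] F(2) by auto
  qed
  then obtain h where h: "h \<in> F" "\<forall>t>0. (x j, z j - t) \<notin> h" by blast
  then obtain a b where hab: "h = {x. a \<bullet> x \<le> b}" using F(3) by blast
  have ab: "\<And>k. k < n \<Longrightarrow> a \<bullet> (x k, z k) \<le> b" "\<And>t. t > 0 \<Longrightarrow> a \<bullet> (x j, z j - t) > b"
    using mem[OF _ h(1)] h(2) unfolding hab by auto
  define c where "c = snd a"
  have ab': "fst a \<bullet> x k + c * z k \<le> b" if "k < n" for k using ab(1)[OF that] by (simp add: inner_prod_def c_def)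
  have *: "fst a \<bullet> x j + c * z j - c * t > b" if "0 < t" for t
    using ab(2)[OF that] by (simp add: inner_prod_def c_def algebra_simps)
  \<comment> \<open>The half-space contains point \<open>j\<close> but nothing below it, so its last
    normal component is negative and the facet is the graph of an affine function.\<close>
  have "c < 0" using ab'[OF \<open>j < n\<close>] *[of 1] by simp
  have "b \<le> fst a \<bullet> x j + c * z j"
  proof (rule field_le_epsilon)
    fix e :: real assume "0 < e"
    then show "b \<le> fst a \<bullet> x j + c * z j + e" using *[of "e / - c"] \<open>c < 0\<close> by (simp add: field_simps)
  qed
  then have "fst a \<bullet> (x k - x j) \<le> - c * (z k - z j)" if "k < n" for k
    using ab'[OF that] by (simp add: algebra_simps)
  then have "((1 / - c) *\<^sub>R fst a) \<bullet> (x k - x j) \<le> z k - z j" if "k < n" for k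
    using that \<open>c < 0\<close> by (simp add: field_simps)
  then show ?thesis by blast
qed

text \<open>One direction is Jensen's inequality. For the other, the maximum of the \<open>n\<close>
  affine minorants supported at the data points is a convex interpolant.\<close>

lemma cls_feasible_iff:
  fixes x :: "nat \<Rightarrow> 'a::euclidean_space"
  assumes "convex S" "\<And>k. k < n \<Longrightarrow> x k \<in> S"
  shows "z \<in> cls_feasible S x n \<longleftrightarrow> z \<in> extensional {..<n} \<and> interpolable x n z"
proof (intro iffI conjI)
  assume z: "z \<in> cls_feasible S x n"
  then obtain \<psi> where \<psi>: "convex_on S \<psi>" "\<And>j. j < n \<Longrightarrow> \<psi> (x j) = z j" by (auto simp: cls_feasible_def)
  show "interpolable x n z" unfolding interpolable_def
  proof (intro allI impI, elim conjE)
    fix j \<theta> assume "j < n" and \<theta>: "(\<Sum>k<n. \<theta> k) = 1" "(\<Sum>k<n. \<theta> k *\<^sub>R x k) = x j" "\<forall>k<n. 0 \<le> \<theta> k"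
    then have "\<psi> (\<Sum>k<n. \<theta> k *\<^sub>R x k) \<le> (\<Sum>k<n. \<theta> k * \<psi> (x k))"
      using assms by (intro convex_on_sum[OF _ _ \<psi>(1)]) auto
    then show "z j \<le> (\<Sum>k<n. \<theta> k * z k)" using \<theta> \<psi>(2) \<open>j < n\<close> by simp
  qed
next
  assume z: "z \<in> extensional {..<n} \<and> interpolable x n z"
  show "z \<in> cls_feasible S x n"
  \<comment> \<open>With no observations the maximum would range over the empty set.\<close>
  proof (cases "n = 0")
    case True
    then show ?thesis using z assms(1) by (auto simp: cls_feasible_def convex_on_def intro!: exI[of _ "\<lambda>_. 0"])
  next
    case False
    obtain \<xi> where \<xi>: "\<And>j k. j < n \<Longrightarrow> k < n \<Longrightarrow> \<xi> j \<bullet> (x k - x j) \<le> z k - z j"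
      using interpolable_subgradient[of x n z] z by metis
    define a where "a j u = z j + \<xi> j \<bullet> (u - x j)" for j u
    define \<psi> where "\<psi> u = Max ((\<lambda>j. a j u) ` {..<n})" for u
    have le: "a j u \<le> \<psi> u" if "j < n" for j u using that by (auto simp: \<psi>_def)
    have "convex_on S \<psi>"
      unfolding convex_on_def
    proof (intro conjI ballI allI impI assms(1))
      fix u v and s t :: real assume st: "0 \<le> s" "0 \<le> t" "s + t = 1"
      have "a j (s *\<^sub>R u + t *\<^sub>R v) \<le> s * \<psi> u + t * \<psi> v" if "j < n" for j
      proof -
        have s: "s = 1 - t" using st by simp
        have "a j (s *\<^sub>R u + t *\<^sub>R v) = s * a j u + t * a j v"
          unfolding a_def s by (simp add: inner_add_right inner_diff_right algebra_simps)
        also have "\<dots> \<le> s * \<psi> u + t * \<psi> v" using le[OF that] st by (intro add_mono mult_left_mono) auto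
        finally show ?thesis .
      qed
      then show "\<psi> (s *\<^sub>R u + t *\<^sub>R v) \<le> s * \<psi> u + t * \<psi> v"
        unfolding \<psi>_def[of "s *\<^sub>R u + t *\<^sub>R v"] using False by (intro Max.boundedI) auto
    qed
    moreover have "\<psi> (x k) = z k" if "k < n" for k
      unfolding \<psi>_def
    proof (rule Max_eqI)
      show "z k \<in> (\<lambda>j. a j (x k)) ` {..<n}" using that by (intro image_eqI[of _ _ k]) (auto simp: a_def)
    qed (use \<xi>[OF _ that] in \<open>auto simp: a_def add.commute le_diff_eq\<close>)
    ultimately show ?thesis using z by (auto simp: cls_feasible_def)
  qed
qed (auto simp: cls_feasible_def)

section \<open>Projection onto the cone of interpolable values\<close>

lemma interpolable_limit:
  assumes "\<And>i. interpolable x n (z i)" "\<And>k. k < n \<Longrightarrow> (\<lambda>i::nat. z i k) \<longlonglongrightarrow> w k"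
  shows "interpolable x n w"
  unfolding interpolable_def
proof (intro allI impI)
  fix j \<theta> assume *: "j < n" "(\<Sum>k<n. \<theta> k) = 1 \<and> (\<Sum>k<n. \<theta> k *\<^sub>R x k) = x j \<and> (\<forall>k<n. 0 \<le> \<theta> k)"
  have "z i j \<le> (\<Sum>k<n. \<theta> k * z i k)" for i using assms(1) * unfolding interpolable_def by blast
  moreover have "(\<lambda>i. \<Sum>k<n. \<theta> k * z i k) \<longlonglongrightarrow> (\<Sum>k<n. \<theta> k * w k)"
    using assms(2) by (intro tendsto_intros) auto
  ultimately show "w j \<le> (\<Sum>k<n. \<theta> k * w k)" using assms(2)[OF *(1)] by (intro LIMSEQ_le) auto
qed

lemma interpolable_convex:
  assumes "interpolable x n z" "interpolable x n w" "0 \<le> t" "t \<le> 1"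
  shows "interpolable x n (\<lambda>k. (1 - t) * z k + t * w k)"
  unfolding interpolable_def
proof (intro allI impI)
  fix j \<theta> assume *: "j < n" "(\<Sum>k<n. \<theta> k) = 1 \<and> (\<Sum>k<n. \<theta> k *\<^sub>R x k) = x j \<and> (\<forall>k<n. 0 \<le> \<theta> k)"
  have "z j \<le> (\<Sum>k<n. \<theta> k * z k)" "w j \<le> (\<Sum>k<n. \<theta> k * w k)"
    using assms(1,2) * unfolding interpolable_def by blast+
  then have "(1 - t) * z j + t * w j \<le> (1 - t) * (\<Sum>k<n. \<theta> k * z k) + t * (\<Sum>k<n. \<theta> k * w k)"
    using assms(3,4) by (intro add_mono mult_left_mono) auto
  also have "\<dots> = (\<Sum>k<n. \<theta> k * ((1 - t) * z k + t * w k))"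
    by (simp add: sum_distrib_left sum.distrib[symmetric] algebra_simps)
  finally show "(1 - t) * z j + t * w j \<le> (\<Sum>k<n. \<theta> k * ((1 - t) * z k + t * w k))" .
qed

text \<open>The parallelogram law for the distances from \<open>y\<close>. The midpoint is spelled
  with \<open>1 - 1/2\<close> to match \<open>interpolable_convex\<close> at
  \<open>t = 1/2\<close>.\<close>

lemma least_squares_parallelogram:
  fixes y z w :: "nat \<Rightarrow> real"
  shows "(\<Sum>k<n. \<bar>z k - w k\<bar>\<^sup>2) = 2 * (\<Sum>k<n. \<bar>y k - z k\<bar>\<^sup>2) + 2 * (\<Sum>k<n. \<bar>y k - w k\<bar>\<^sup>2)
    - 4 * (\<Sum>k<n. \<bar>y k - ((1 - 1/2) * z k + 1/2 * w k)\<bar>\<^sup>2)"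
  unfolding sum_distrib_left sum.distrib[symmetric] sum_subtractf[symmetric]
  by (intro sum.cong refl) (simp add: power2_eq_square field_simps)

text \<open>The usual projection argument: midpoints of a minimizing sequence stay admissible, so
  the parallelogram law makes the sequence Cauchy in each coordinate, and its limit is
  admissible.\<close>

lemma interpolable_minimizer_exists:
  fixes y :: "nat \<Rightarrow> real"
  shows "\<exists>z. interpolable x n z \<and> (\<forall>w. interpolable x n w \<longrightarrow> (\<Sum>k<n. \<bar>y k - z k\<bar>\<^sup>2) \<le> (\<Sum>k<n. \<bar>y k - w k\<bar>\<^sup>2))"
proof -
  let ?Q = "\<lambda>z. \<Sum>k<n. \<bar>y k - z k\<bar>\<^sup>2"
  define F where "F = {z. interpolable x n z}"
  define m where "m = Inf (?Q ` F)"
  have "(\<lambda>_. 0) \<in> F" by (auto simp: F_def interpolable_def)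
  then have ne: "F \<noteq> {}" by auto
  have bdd: "bdd_below (?Q ` F)" by (rule bdd_belowI2[of _ 0]) (auto intro: sum_nonneg)
  have m: "m \<le> ?Q z" if "z \<in> F" for z unfolding m_def using that by (intro cINF_lower bdd)
  have "\<exists>z\<in>F. ?Q z < m + 1 / Suc i" for i :: nat
  proof -
    have "Inf (?Q ` F) < m + 1 / Suc i" by (simp add: m_def)
    then show ?thesis using cINF_less_iff[OF ne bdd] by blast
  qed
  then obtain z where z: "\<And>i. z i \<in> F" "\<And>i. ?Q (z i) < m + 1 / Suc i" by metis
  have close: "\<bar>z i k - z j k\<bar>\<^sup>2 \<le> 2 / Suc i + 2 / Suc j" if "k < n" for i j k
  proof -
    have "(\<lambda>k. (1 - 1/2) * z i k + 1/2 * z j k) \<in> F"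
      using interpolable_convex[of x n "z i" "z j" "1/2"] z(1) by (simp add: F_def)
    note mid = m[OF this]
    have "\<bar>z i k - z j k\<bar>\<^sup>2 \<le> (\<Sum>k<n. \<bar>z i k - z j k\<bar>\<^sup>2)"
      using that by (intro member_le_sum) auto
    also have "\<dots> \<le> 2 * ?Q (z i) + 2 * ?Q (z j) - 4 * m"
      using mid by (subst least_squares_parallelogram[of _ _ _ y]) simp
    finally show ?thesis using z(2)[of i] z(2)[of j] by simp
  qed
  have "Cauchy (\<lambda>i. z i k)" if "k < n" for k
  proof (rule CauchyI)
    fix e :: real assume e: "0 < e"
    obtain N where N: "4 / e\<^sup>2 < real N" using reals_Archimedean2 by blast
    have "norm (z i k - z j k) < e" if "i \<ge> N" "j \<ge> N" for i j
    proof -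
      have N0: "N > 0" using N e by (cases N) (auto simp: divide_less_0_iff power2_less_0 not_less[symmetric])
      have "2 / Suc i \<le> 2 / real N" "2 / Suc j \<le> 2 / real N" using that N0 by (auto intro!: divide_left_mono)
      then have "\<bar>z i k - z j k\<bar>\<^sup>2 \<le> 4 / real N" using close[OF \<open>k < n\<close>, of i j] by simp
      also have "\<dots> < e\<^sup>2" using N N0 e by (simp add: field_simps)
      finally show ?thesis using e power_less_imp_less_base[of "\<bar>z i k - z j k\<bar>" 2 e] by simp
    qed
    then show "\<exists>N. \<forall>i\<ge>N. \<forall>j\<ge>N. norm (z i k - z j k) < e" by blast
  qed
  then have "convergent (\<lambda>i. z i k)" if "k < n" for k
    using that by (simp add: Cauchy_convergent)
  moreover define w where "w k = lim (\<lambda>i. z i k)" for k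
  ultimately have w: "(\<lambda>i. z i k) \<longlonglongrightarrow> w k" if "k < n" for k
    using that by (simp add: convergent_LIMSEQ_iff)
  have wF: "interpolable x n w" by (rule interpolable_limit[of x n z, OF _ w]) (use z(1) in \<open>simp_all add: F_def\<close>)
  have "(\<lambda>i. ?Q (z i)) \<longlonglongrightarrow> ?Q w" by (intro tendsto_sum tendsto_power tendsto_rabs tendsto_diff tendsto_const w) simp
  moreover have "(\<lambda>i. m + 1 / Suc i) \<longlonglongrightarrow> m + 0"
    by (intro tendsto_intros) (use LIMSEQ_Suc[OF lim_1_over_n] in simp)
  ultimately have "?Q w \<le> m + 0"
    by (rule LIMSEQ_le) (use z(2) in \<open>auto intro: less_imp_le\<close>)
  then have "?Q w \<le> ?Q v" if "interpolable x n v" for v using m[of v] that by (simp add: F_def)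
  then show ?thesis using wF by blast
qed

text \<open>Shows that the definite description in \<open>cls_values\<close> denotes. Restricting a
  minimizer to \<open>{..<n}\<close> changes neither the objective nor interpolability, and two
  extensional minimizers agree by the parallelogram law.\<close>

lemma cls_values_minimizer:
  fixes x :: "nat \<Rightarrow> 'a::euclidean_space"
  assumes S: "convex S" "\<And>k. k < n \<Longrightarrow> x k \<in> S"
  shows "interpolable x n (cls_values S x y n)"
    and "interpolable x n w \<Longrightarrow> (\<Sum>k<n. \<bar>y k - cls_values S x y n k\<bar>\<^sup>2) \<le> (\<Sum>k<n. \<bar>y k - w k\<bar>\<^sup>2)"
proof -
  define Q where "Q z = (\<Sum>k<n. \<bar>y k - z k\<bar>\<^sup>2)" for z
  let ?M = "is_arg_min Q (\<lambda>z. z \<in> cls_feasible S x n)"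
  have feas: "z \<in> cls_feasible S x n \<longleftrightarrow> z \<in> extensional {..<n} \<and> interpolable x n z" for z
    by (rule cls_feasible_iff[OF S])
  have Q_restrict: "Q (restrict w {..<n}) = Q w" for w
    unfolding Q_def by (intro sum.cong) auto
  have restrict_feas: "restrict w {..<n} \<in> cls_feasible S x n" if "interpolable x n w" for w
    using that interpolable_cong[of n "restrict w {..<n}" w x] unfolding feas by simp
  have M1: "interpolable x n z" "z \<in> extensional {..<n}" "interpolable x n w \<Longrightarrow> Q z \<le> Q w" if "?M z" for z w
  proof -
    have z: "z \<in> cls_feasible S x n" and min: "\<And>v. v \<in> cls_feasible S x n \<Longrightarrow> Q z \<le> Q v"
      using that by (simp_all add: is_arg_min_linorder)
    show "interpolable x n z" "z \<in> extensional {..<n}" using z unfolding feas by simp_all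
    show "Q z \<le> Q w" if "interpolable x n w"
      using min[OF restrict_feas[OF that]] by (simp only: Q_restrict)
  qed
  obtain z where z: "interpolable x n z" "\<And>w. interpolable x n w \<Longrightarrow> Q z \<le> Q w"
    using interpolable_minimizer_exists[of x n y] unfolding Q_def by blast
  have Mz: "?M (restrict z {..<n})"
    unfolding is_arg_min_linorder Q_restrict using restrict_feas[OF z(1)] z(2) by (simp add: feas)
  have unique: "v = w" if v: "?M v" and w: "?M w" for v w
  proof (rule extensionalityI[OF M1(2)[OF v] M1(2)[OF w]])
    fix k assume k: "k \<in> {..<n}"
    have "Q v \<le> Q w" "Q w \<le> Q v" by (rule M1(3)[OF v] M1(3)[OF w] M1(1)[OF v] M1(1)[OF w])+
    moreover have "Q v \<le> Q (\<lambda>k. (1 - 1/2) * v k + 1/2 * w k)"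
      by (rule M1(3)[OF v]) (intro interpolable_convex M1(1)[OF v] M1(1)[OF w]; simp)
    ultimately have "(\<Sum>k<n. \<bar>v k - w k\<bar>\<^sup>2) \<le> 0"
      unfolding least_squares_parallelogram[of v w n y] Q_def by linarith
    moreover have "\<bar>v k - w k\<bar>\<^sup>2 \<le> (\<Sum>k<n. \<bar>v k - w k\<bar>\<^sup>2)"
      using k by (intro member_le_sum) auto
    ultimately have "\<bar>v k - w k\<bar>\<^sup>2 \<le> 0" by (rule order_trans[rotated])
    then show "v k = w k" by simp
  qed
  have M: "?M (cls_values S x y n)"
    unfolding cls_values_def Q_def[symmetric] by (rule theI[of ?M, OF Mz unique[OF _ Mz]])
  show "interpolable x n (cls_values S x y n)" by (rule M1(1)[OF M])
  show "interpolable x n w \<Longrightarrow> (\<Sum>k<n. \<bar>y k - cls_values S x y n k\<bar>\<^sup>2) \<le> (\<Sum>k<n. \<bar>y k - w k\<bar>\<^sup>2)"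
    using M1(3)[OF M] unfolding Q_def .
qed

text \<open>The variational inequality of the projection: moving the fit a fraction \<open>t\<close>
  towards \<open>g\<close> is admissible and cannot lower the objective. The expansion is divided by
  \<open>t\<close>, and \<open>t\<close> is taken small.\<close>

lemma cls_values_residual_bound:
  fixes x :: "nat \<Rightarrow> 'a::euclidean_space"
  assumes S: "convex S" "\<And>k. k < n \<Longrightarrow> x k \<in> S" and g: "convex_on S g"
    and y: "\<And>k. k < n \<Longrightarrow> y k = g (x k) + e k"
  defines "r \<equiv> \<lambda>k. cls_values S x y n k - g (x k)"
  shows "(\<Sum>k<n. (r k)\<^sup>2) \<le> (\<Sum>k<n. e k * r k)"
proof (rule field_le_epsilon)
  fix \<delta> :: real assume "0 < \<delta>"
  define R where "R = (\<Sum>k<n. (r k)\<^sup>2)"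
  have "R \<ge> 0" by (auto simp: R_def intro: sum_nonneg)
  \<comment> \<open>Small enough that the quadratic remainder \<open>t * R\<close> is at most
    \<delta>; adding 1 to \<open>R\<close> avoids division by 0.\<close>
  define t where "t = min 1 (\<delta> / (R + 1))"
  have t: "0 < t" "t \<le> 1" "t * R \<le> \<delta>"
  proof -
    have "t * R \<le> \<delta> / (R + 1) * (R + 1)" using \<open>R \<ge> 0\<close> \<open>0 < \<delta>\<close> by (intro mult_mono) (auto simp: t_def)
    then show "t * R \<le> \<delta>" using \<open>R \<ge> 0\<close> by simp
  qed (use \<open>R \<ge> 0\<close> \<open>0 < \<delta>\<close> in \<open>auto simp: t_def\<close>)
  let ?Z = "cls_values S x y n"
  have "restrict (\<lambda>k. g (x k)) {..<n} \<in> cls_feasible S x n"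
    using g by (auto simp: cls_feasible_def)
  then have "interpolable x n (\<lambda>k. g (x k))"
    by (auto simp: cls_feasible_iff[OF S] cong: interpolable_cong)
  then have "interpolable x n (\<lambda>k. (1 - t) * ?Z k + t * g (x k))"
    using t by (intro interpolable_convex cls_values_minimizer S) auto
  then have "(\<Sum>k<n. \<bar>y k - ?Z k\<bar>\<^sup>2) \<le> (\<Sum>k<n. \<bar>y k - ((1 - t) * ?Z k + t * g (x k))\<bar>\<^sup>2)"
    by (intro cls_values_minimizer S)
  also have "\<dots> = (\<Sum>k<n. \<bar>y k - ?Z k\<bar>\<^sup>2 + (2 * t * (e k * r k) - 2 * t * (r k)\<^sup>2 + t\<^sup>2 * (r k)\<^sup>2))"
    by (intro sum.cong refl) (simp add: y r_def power2_eq_square algebra_simps)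
  finally have "0 \<le> 2 * t * (\<Sum>k<n. e k * r k) - 2 * t * R + t\<^sup>2 * R"
    by (simp add: R_def sum.distrib sum_subtractf sum_distrib_left[symmetric] mult.assoc)
  then have "0 \<le> t * (2 * (\<Sum>k<n. e k * r k) - 2 * R + t * R)"
    by (simp add: power2_eq_square algebra_simps)
  then have "0 \<le> 2 * (\<Sum>k<n. e k * r k) - 2 * R + t * R" using t by (simp add: zero_le_mult_iff)
  then show "(\<Sum>k<n. (r k)\<^sup>2) \<le> (\<Sum>k<n. e k * r k) + \<delta>" using t \<open>0 < \<delta>\<close> unfolding R_def[symmetric] by simp
qed

text \<open>On the hull the infimum ranges over a nonempty set bounded below, since the weights lie
  in [0,1], and so it is real. Mixing weight vectors gives convexity. At a design point, weight 1 on
  that observation gives one inequality and interpolability is precisely the other.\<close>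

lemma cls_estimator_convex:
  fixes x :: "nat \<Rightarrow> 'a::euclidean_space"
  assumes S: "convex S" "\<And>k. k < n \<Longrightarrow> x k \<in> S"
  obtains f where "convex_on (convex hull (x ` {..<n})) f"
    and "\<And>u. u \<in> convex hull (x ` {..<n}) \<Longrightarrow> cls_estimator S x y n u = ereal (f u)"
    and "\<And>k. k < n \<Longrightarrow> f (x k) = cls_values S x y n k"
proof -
  let ?Z = "cls_values S x y n" and ?H = "convex hull (x ` {..<n})"
  define W where "W u = {\<theta>. (\<Sum>k<n. \<theta> k) = 1 \<and> (\<Sum>k<n. \<theta> k *\<^sub>R x k) = u \<and> (\<forall>k<n. 0 \<le> \<theta> k)}" for u
  let ?A = "\<lambda>\<theta>. \<Sum>k<n. \<theta> k * ?Z k"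
  define f where "f u = Inf (?A ` W u)" for u
  have ne: "W u \<noteq> {}" if "u \<in> ?H" for u using that by (auto simp: convex_hull_image_lessThan W_def)
  have bdd: "bdd_below (?A ` W u)" for u
  proof (rule bdd_belowI2)
    fix \<theta> assume "\<theta> \<in> W u"
    then have \<theta>: "\<And>k. k < n \<Longrightarrow> 0 \<le> \<theta> k" "sum \<theta> {..<n} = 1" by (auto simp: W_def)
    have "- \<bar>?Z k\<bar> \<le> \<theta> k * ?Z k" if "k < n" for k
    proof -
      have "\<theta> k \<le> sum \<theta> {..<n}" using that \<theta> by (intro member_le_sum) auto
      then have "\<bar>\<theta> k * ?Z k\<bar> \<le> 1 * \<bar>?Z k\<bar>" using \<theta>(1)[OF that] \<theta>(2)
        unfolding abs_mult by (intro mult_right_mono) auto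
      then show ?thesis by linarith
    qed
    then show "(\<Sum>k<n. - \<bar>?Z k\<bar>) \<le> ?A \<theta>" by (intro sum_mono) auto
  qed
  have le: "f u \<le> ?A \<theta>" if "\<theta> \<in> W u" for u \<theta> unfolding f_def using that by (intro cINF_lower bdd)
  have "convex_on ?H f"
    unfolding convex_on_def
  proof (intro conjI ballI allI impI convex_convex_hull)
    fix u v and s t :: real assume uv: "u \<in> ?H" "v \<in> ?H" and st: "0 \<le> s" "0 \<le> t" "s + t = 1"
    show "f (s *\<^sub>R u + t *\<^sub>R v) \<le> s * f u + t * f v"
    proof (rule field_le_epsilon)
      fix \<delta> :: real assume "0 < \<delta>"
      obtain \<theta> \<eta> where \<theta>: "\<theta> \<in> W u" "?A \<theta> < f u + \<delta>" and \<eta>: "\<eta> \<in> W v" "?A \<eta> < f v + \<delta>"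
        using cINF_less_iff[OF ne[OF uv(1)] bdd, of "f u + \<delta>"] cINF_less_iff[OF ne[OF uv(2)] bdd, of "f v + \<delta>"] \<open>0 < \<delta>\<close>
        unfolding f_def[symmetric] by auto
      have "(\<lambda>k. s * \<theta> k + t * \<eta> k) \<in> W (s *\<^sub>R u + t *\<^sub>R v)"
        using \<theta>(1) \<eta>(1) st
        by (auto simp: W_def sum.distrib sum_distrib_left[symmetric] scaleR_add_left scaleR_sum_right)
      then have "f (s *\<^sub>R u + t *\<^sub>R v) \<le> ?A (\<lambda>k. s * \<theta> k + t * \<eta> k)" by (rule le)
      also have "\<dots> = s * ?A \<theta> + t * ?A \<eta>"
        by (simp add: sum_distrib_left sum.distrib[symmetric] algebra_simps)
      also have "\<dots> \<le> s * (f u + \<delta>) + t * (f v + \<delta>)" using \<theta> \<eta> st by (intro add_mono mult_left_mono) auto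
      also have "\<dots> = s * f u + t * f v + (s + t) * \<delta>" by (simp add: algebra_simps)
      finally show "f (s *\<^sub>R u + t *\<^sub>R v) \<le> s * f u + t * f v + \<delta>" using st by simp
    qed
  qed
  moreover have "cls_estimator S x y n u = ereal (f u)" if "u \<in> ?H" for u
    using ereal_Inf'[OF bdd, of u] ne[OF that] unfolding cls_estimator_def f_def W_def[symmetric]
    by (simp add: image_image)
  moreover have "f (x k) = ?Z k" if "k < n" for k
  proof (rule antisym)
    have "(\<Sum>i<n. (if i = k then 1 else 0) *\<^sub>R x i) = (\<Sum>i<n. if i = k then x i else 0)"
      "?A (\<lambda>i. if i = k then 1 else 0) = (\<Sum>i<n. if i = k then ?Z i else 0)"
      by (intro sum.cong; simp)+
    then show "f (x k) \<le> ?Z k"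
      using le[of "\<lambda>i. if i = k then 1 else 0" "x k"] that by (auto simp: W_def)
    have "W (x k) \<noteq> {}" using that by (intro ne hull_inc) auto
    then show "?Z k \<le> f (x k)"
      unfolding f_def using cls_values_minimizer(1)[OF S, where y = y] that
      by (intro cINF_greatest) (auto simp: interpolable_def W_def)
  qed
  ultimately show ?thesis by (rule that)
qed

section \<open>Consistency for a single design and error sequence\<close>

lemma compact_UN_cball:
  fixes K :: "'a::euclidean_space set"
  assumes "compact K"
  shows "compact (\<Union>u\<in>K. cball u r)"
proof -
  have "(\<Union>u\<in>K. cball u r) = {u + h | u h. u \<in> K \<and> h \<in> cball 0 r}"
  proof (intro set_eqI iffI)
    fix v assume "v \<in> (\<Union>u\<in>K. cball u r)"
    then obtain u where "u \<in> K" "dist u v \<le> r" by auto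
    then show "v \<in> {u + h | u h. u \<in> K \<and> h \<in> cball 0 r}"
      by (intro CollectI exI[of _ u] exI[of _ "v - u"]) (auto simp: dist_norm norm_minus_commute)
  next
    fix v assume "v \<in> {u + h | u h. u \<in> K \<and> h \<in> cball 0 r}"
    then obtain u h where "u \<in> K" "norm h \<le> r" "v = u + h" by auto
    then show "v \<in> (\<Union>u\<in>K. cball u r)" by (intro UN_I[of u]) (auto simp: dist_norm)
  qed
  then show ?thesis using compact_sums[OF assms compact_cball[of 0 r]] by (simp only:)
qed

text \<open>The distance of the reflected point from \<open>p\<close> is below 2\<rho>/3 + \<rho>/3.
  It serves the lower bound on the estimator, where a point is reflected through a controlled design
  point.\<close>

lemma reflection_mem_ball:
  fixes u v p :: "'a::real_normed_vector"
  assumes "u \<in> ball p (\<rho> / 3)" "v \<in> ball p (\<rho> / 3)" "0 < \<rho>"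
  shows "2 *\<^sub>R u - v \<in> ball p \<rho>"
proof -
  have "p - (2 *\<^sub>R u - v) = (p - u) + (p - u) - (p - v)" by (simp add: scaleR_2)
  then have "dist p (2 *\<^sub>R u - v) \<le> dist p u + dist p u + dist p v"
    unfolding dist_norm by (metis (no_types, lifting) add_right_mono norm_triangle_ineq norm_triangle_ineq4 order_trans)
  then show ?thesis using assms by simp
qed

text \<open>\<open>design_dense\<close>, \<open>mean\<close>, \<open>bounded\<close> and \<open>tight\<close> hold almost surely in each of the three settings; the rest of
  the argument is not probabilistic.\<close>

locale convex_regression =
  fixes S :: "'a::euclidean_space set" and g :: "'a \<Rightarrow> real"
    and x :: "nat \<Rightarrow> 'a" and y e :: "nat \<Rightarrow> real" and \<B> :: "'a set set"
  assumes convex_S: "convex S" and convex_g: "convex_on S g"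
    and x: "\<And>k. x k \<in> S" and y: "\<And>k. y k = g (x k) + e k"
    and basis: "topological_basis \<B>"
    and design_dense: "\<And>U. open U \<Longrightarrow> U \<noteq> {} \<Longrightarrow> U \<subseteq> interior S \<Longrightarrow>
      \<exists>c>0. \<forall>\<^sub>F n in sequentially. c * real n \<le> real (card {k. k < n \<and> x k \<in> U})"
    and mean: "\<And>F \<tau>. finite F \<Longrightarrow> F \<subseteq> \<B> \<Longrightarrow> 0 < \<tau> \<Longrightarrow>
      \<forall>\<^sub>F n in sequentially. \<bar>\<Sum>k<n. indicator (\<Union>F) (x k) * e k\<bar> \<le> \<tau> * real n"
    and bounded: "\<exists>C. \<forall>\<^sub>F n in sequentially. (\<Sum>k<n. (e k)\<^sup>2) \<le> C * real n"
    and tight: "\<And>\<eta>. 0 < \<eta> \<Longrightarrow> \<exists>K. compact K \<and> K \<subseteq> interior S \<and>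
      (\<forall>\<^sub>F n in sequentially. (\<Sum>k<n. indicator (- K) (x k) * (e k)\<^sup>2) \<le> \<eta> * real n)"
begin

abbreviation hull_pts :: "nat \<Rightarrow> 'a set" where
  "hull_pts n \<equiv> convex hull (x ` {..<n})"

text \<open>Outside \<open>hull_pts n\<close> the estimator is infinite and
  \<open>real_of_ereal\<close> returns 0 there; membership in the hull is therefore carried along in
  the estimates below.\<close>

definition est :: "nat \<Rightarrow> 'a \<Rightarrow> real" where
  "est n u = real_of_ereal (cls_estimator S x y n u)"

definition err :: "nat \<Rightarrow> 'a \<Rightarrow> real" where
  "err n u = est n u - g u"

lemma
  shows convex_on_est: "convex_on (hull_pts n) (est n)"
    and cls_estimator_eq_est: "u \<in> hull_pts n \<Longrightarrow> cls_estimator S x y n u = ereal (est n u)"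
    and est_design_point: "k < n \<Longrightarrow> est n (x k) = cls_values S x y n k"
proof -
  obtain f where f: "convex_on (hull_pts n) f"
    "\<And>u. u \<in> hull_pts n \<Longrightarrow> cls_estimator S x y n u = ereal (f u)"
    "\<And>k. k < n \<Longrightarrow> f (x k) = cls_values S x y n k"
    using cls_estimator_convex[OF convex_S, of n x y] x by metis
  have eq: "est n u = f u" if "u \<in> hull_pts n" for u using f(2)[OF that] by (simp add: est_def)
  show "convex_on (hull_pts n) (est n)"
    using f(1) unfolding convex_on_def by (auto simp: eq convexD)
  show "u \<in> hull_pts n \<Longrightarrow> cls_estimator S x y n u = ereal (est n u)"
    using f(2) eq by simp
  show "k < n \<Longrightarrow> est n (x k) = cls_values S x y n k"
    using f(3) eq[of "x k"] by (simp add: hull_inc)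
qed

lemma sum_err_squared_le: "(\<Sum>k<n. (err n (x k))\<^sup>2) \<le> (\<Sum>k<n. e k * err n (x k))"
  using cls_values_residual_bound[OF convex_S _ convex_g, of n x y e] x y
  by (simp add: err_def est_design_point)

text \<open>Since \<open>e k * r\<close> is at most half of
  \<open>(e k)\<^sup>2 + r\<^sup>2\<close>, half of the left side of the basic inequality is
  absorbed and the squared deviations sum to at most the squared errors. The condition
  \<open>1 \<le> C\<close> makes later divisions by \<open>C\<close> harmless.\<close>

lemma sum_err_squared_bounded:
  obtains C where "1 \<le> C" "\<forall>\<^sub>F n in sequentially. (\<Sum>k<n. (e k)\<^sup>2) \<le> C * real n"
    "\<forall>\<^sub>F n in sequentially. (\<Sum>k<n. (err n (x k))\<^sup>2) \<le> C * real n"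
proof -
  obtain C where C: "\<forall>\<^sub>F n in sequentially. (\<Sum>k<n. (e k)\<^sup>2) \<le> C * real n" using bounded by blast
  have "(\<Sum>k<n. (err n (x k))\<^sup>2) \<le> (\<Sum>k<n. (e k)\<^sup>2)" for n
  proof -
    have "(\<Sum>k<n. e k * err n (x k)) \<le> (\<Sum>k<n. ((e k)\<^sup>2 + (err n (x k))\<^sup>2) / 2)"
    proof (intro sum_mono)
      fix k show "e k * err n (x k) \<le> ((e k)\<^sup>2 + (err n (x k))\<^sup>2) / 2"
        using sum_squares_bound[of "e k" "err n (x k)"] by simp
    qed
    also have "\<dots> = ((\<Sum>k<n. (e k)\<^sup>2) + (\<Sum>k<n. (err n (x k))\<^sup>2)) / 2"
      by (simp add: sum.distrib sum_divide_distrib[symmetric])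
    finally show ?thesis using sum_err_squared_le[of n] by simp
  qed
  moreover have e: "\<forall>\<^sub>F n in sequentially. (\<Sum>k<n. (e k)\<^sup>2) \<le> max 1 C * real n"
    using C
  proof eventually_elim
    case (elim n)
    also have "C * real n \<le> max 1 C * real n" by (intro mult_right_mono) auto
    finally show ?case .
  qed
  ultimately have "\<forall>\<^sub>F n in sequentially. (\<Sum>k<n. (err n (x k))\<^sup>2) \<le> max 1 C * real n"
    by (auto elim!: eventually_mono intro: order_trans)
  then show ?thesis using e that[of "max 1 C"] by simp
qed

lemma continuous_on_g: "continuous_on (interior S) g"
  by (intro convex_on_continuous convex_on_subset[OF convex_g] interior_subset) (auto simp: convex_S)

lemma g_bounded_on_compact:
  assumes "compact K" "K \<subseteq> interior S"
  obtains B where "\<And>u. u \<in> K \<Longrightarrow> \<bar>g u\<bar> \<le> B"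
proof -
  have "bounded (g ` K)"
    by (intro compact_imp_bounded compact_continuous_image continuous_on_subset[OF continuous_on_g] assms)
  then show ?thesis using that by (auto simp: bounded_iff)
qed

section \<open>Local boundedness and Lipschitz continuity of the estimators\<close>

lemma sum_squares_ge_card:
  assumes "\<And>k. k < n \<Longrightarrow> x k \<in> U \<Longrightarrow> a \<le> (err n (x k))\<^sup>2"
  shows "a * real (card {k. k < n \<and> x k \<in> U}) \<le> (\<Sum>k<n. (err n (x k))\<^sup>2)"
proof -
  have "a * real (card {k. k < n \<and> x k \<in> U}) = (\<Sum>k\<in>{k. k < n \<and> x k \<in> U}. a)" by simp
  also have "\<dots> \<le> (\<Sum>k\<in>{k. k < n \<and> x k \<in> U}. (err n (x k))\<^sup>2)" using assms by (intro sum_mono) auto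
  also have "\<dots> \<le> (\<Sum>k<n. (err n (x k))\<^sup>2)" by (intro sum_mono2) auto
  finally show ?thesis .
qed

text \<open>If every design point in a small ball had a large deviation, the positive proportion of
  the design in that ball would exceed the global mean square bound.\<close>

lemma eventually_controlled_design_point:
  assumes "open U" "p \<in> U" "U \<subseteq> interior S"
  shows "\<exists>B. \<forall>\<^sub>F n in sequentially. \<exists>k<n. x k \<in> U \<and> \<bar>est n (x k)\<bar> \<le> B"
proof -
  obtain r where r: "0 < r" "cball p r \<subseteq> U"
    using assms(1,2) unfolding open_contains_cball by blast
  have "cball p r \<subseteq> interior S" using r(2) assms(3) by (rule subset_trans)
  then obtain G where G: "\<And>u. u \<in> cball p r \<Longrightarrow> \<bar>g u\<bar> \<le> G"
    by (rule g_bounded_on_compact[OF compact_cball]) blast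
  have "ball p r \<subseteq> interior S" using r ball_subset_cball[of p r] assms(3) by blast
  then have "\<exists>c>0. \<forall>\<^sub>F n in sequentially. c * real n \<le> real (card {k. k < n \<and> x k \<in> ball p r})"
    using r(1) by (intro design_dense) auto
  then obtain c where c: "0 < c" "\<forall>\<^sub>F n in sequentially. c * real n \<le> real (card {k. k < n \<and> x k \<in> ball p r})"
    by (elim exE conjE)
  obtain C where "\<forall>\<^sub>F n in sequentially. (\<Sum>k<n. (e k)\<^sup>2) \<le> C * real n"
    and C: "1 \<le> C" "\<forall>\<^sub>F n in sequentially. (\<Sum>k<n. (err n (x k))\<^sup>2) \<le> C * real n"
    by (rule sum_err_squared_bounded)
  \<comment> \<open>Then \<open>D * c = C + c\<close> exceeds \<open>C\<close>, which is the
    contradiction, and \<open>1 \<le> D\<close> lets a squared deviation below \<open>D\<close> be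
    read as a deviation of at most \<open>D\<close>.\<close>
  define D where "D = C / c + 1"
  have D: "1 \<le> D" using C c by (simp add: D_def)
  have "\<forall>\<^sub>F n in sequentially. \<exists>k<n. x k \<in> U \<and> \<bar>est n (x k)\<bar> \<le> G + D"
    using c(2) C(2) eventually_gt_at_top[of 0]
  proof eventually_elim
    case (elim n)
    have "\<exists>k<n. x k \<in> ball p r \<and> (err n (x k))\<^sup>2 < D"
    proof (rule ccontr)
      assume "\<not> ?thesis"
      then have "D * real (card {k. k < n \<and> x k \<in> ball p r}) \<le> (\<Sum>k<n. (err n (x k))\<^sup>2)"
        by (intro sum_squares_ge_card) force
      moreover have "D * (c * real n) \<le> D * real (card {k. k < n \<and> x k \<in> ball p r})"
        using elim(1) D by (intro mult_left_mono) auto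
      moreover have "D * (c * real n) = C * real n + c * real n" using c by (simp add: D_def field_simps)
      ultimately have "c * real n \<le> 0" using elim(2) by linarith
      then show False using c elim(3) by (simp add: mult_le_0_iff)
    qed
    then obtain k where k: "k < n" "x k \<in> ball p r" "(err n (x k))\<^sup>2 < D" by blast
    have "\<bar>err n (x k)\<bar> \<le> D"
    proof (rule power2_le_imp_le)
      have "D * 1 \<le> D * D" using D by (intro mult_left_mono) auto
      then show "\<bar>err n (x k)\<bar>\<^sup>2 \<le> D\<^sup>2" using k(3) by (simp add: power2_eq_square)
    qed (use D in auto)
    then have "\<bar>est n (x k)\<bar> \<le> G + D" using G[of "x k"] k(2) by (auto simp: err_def)
    then show ?case using k r by (intro exI[of _ k]) auto
  qed
  then show ?thesis by blast
qed

text \<open>Above: controlled design points near the vertices of a cube still span a ball around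
  \<open>p\<close>, and a convex function on a hull is bounded by its values at the spanning points.
  Below: a controlled design point near \<open>p\<close> is the midpoint of \<open>u\<close> and its
  reflection, and the value at the reflection is already bounded above.\<close>

lemma est_locally_bounded:
  assumes "p \<in> interior S"
  shows "\<exists>\<rho>>0. \<exists>B. \<forall>\<^sub>F n in sequentially. \<forall>u\<in>ball p \<rho>. u \<in> hull_pts n \<and> \<bar>est n u\<bar> \<le> B"
proof -
  obtain r where r: "0 < r" "ball p r \<subseteq> interior S"
    using assms by (meson open_contains_ball open_interior)
  obtain V \<rho> where V: "finite V" "0 < \<rho>" "V \<subseteq> ball p r" "ball p (2 * \<rho>) \<subseteq> convex hull V"
    by (rule ball_in_convex_hull_finite[OF r(1)])
  have "\<forall>v\<in>V. \<exists>B. \<forall>\<^sub>F n in sequentially. \<exists>k<n. x k \<in> ball v \<rho> \<inter> ball p r \<and> \<bar>est n (x k)\<bar> \<le> B"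
  proof
    fix v assume "v \<in> V"
    then show "\<exists>B. \<forall>\<^sub>F n in sequentially. \<exists>k<n. x k \<in> ball v \<rho> \<inter> ball p r \<and> \<bar>est n (x k)\<bar> \<le> B"
      using V r by (intro eventually_controlled_design_point[of _ v]) auto
  qed
  from bchoice[OF this] obtain B where B: "\<forall>v\<in>V.
      \<forall>\<^sub>F n in sequentially. \<exists>k<n. x k \<in> ball v \<rho> \<inter> ball p r \<and> \<bar>est n (x k)\<bar> \<le> B v"
    by (rule exE)
  define D where "D = (\<Sum>v\<in>V. \<bar>B v\<bar>)"
  have D: "B v \<le> D" if "v \<in> V" for v
    using member_le_sum[of v V "\<lambda>v. \<bar>B v\<bar>"] that V(1) by (auto simp: D_def)
  have "\<exists>B. \<forall>\<^sub>F n in sequentially. \<exists>k<n. x k \<in> ball p (min r (\<rho> / 3)) \<and> \<bar>est n (x k)\<bar> \<le> B"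
    using r V(2) by (intro eventually_controlled_design_point[of _ p]) auto
  then obtain B' where B': "\<forall>\<^sub>F n in sequentially. \<exists>k<n. x k \<in> ball p (min r (\<rho> / 3)) \<and> \<bar>est n (x k)\<bar> \<le> B'"
    by (rule exE)
  have "\<forall>\<^sub>F n in sequentially. \<forall>v\<in>V. \<exists>k<n. x k \<in> ball v \<rho> \<inter> ball p r \<and> \<bar>est n (x k)\<bar> \<le> B v"
    by (rule eventually_ball_finite[OF V(1) B])
  then have "\<forall>\<^sub>F n in sequentially. \<forall>u\<in>ball p (\<rho> / 3). u \<in> hull_pts n \<and> \<bar>est n u\<bar> \<le> \<bar>D\<bar> + 2 * \<bar>B'\<bar>"
    using B'
  proof eventually_elim
    case (elim n)
    from bchoice[OF elim(1)] obtain \<kappa> where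
      "\<forall>v\<in>V. \<kappa> v < n \<and> x (\<kappa> v) \<in> ball v \<rho> \<inter> ball p r \<and> \<bar>est n (x (\<kappa> v))\<bar> \<le> B v"
      by (rule exE)
    then have \<kappa>: "\<kappa> v < n" "x (\<kappa> v) \<in> ball v \<rho>" "\<bar>est n (x (\<kappa> v))\<bar> \<le> B v" if "v \<in> V" for v
      using that by auto
    define T where "T = (\<lambda>v. x (\<kappa> v)) ` V"
    have sub: "ball p \<rho> \<subseteq> convex hull T"
      by (rule convex_hull_perturb_ball[OF _ _ V(4,2)]) (use \<kappa> V(1) in \<open>auto simp: T_def\<close>)
    have T: "convex hull T \<subseteq> hull_pts n" using \<kappa> by (intro hull_mono) (auto simp: T_def)
    have "\<forall>t\<in>T. est n t \<le> D" using \<kappa> D by (force simp: T_def)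
    then have "\<forall>u\<in>convex hull T. est n u \<le> D"
      using T by (intro convex_on_convex_hull_bound convex_on_subset[OF convex_on_est]) auto
    then have upper: "est n u \<le> D" if "u \<in> ball p \<rho>" for u using sub that by blast
    obtain k where k: "k < n" "x k \<in> ball p (\<rho> / 3)" "\<bar>est n (x k)\<bar> \<le> B'" using elim(2) by auto
    show ?case
    proof
      fix u assume u: "u \<in> ball p (\<rho> / 3)"
      then have u': "u \<in> ball p \<rho>" using V(2) by auto
      have w: "2 *\<^sub>R x k - u \<in> ball p \<rho>" using reflection_mem_ball[OF k(2) u V(2)] .
      \<comment> \<open>The midpoint inequality gives \<open>est n u\<close> at least twice the
        value at \<open>x k\<close> minus the value at the reflection, that is, at least
        \<open>- 2 * \<bar>B'\<bar> - \<bar>D\<bar>\<close>.\<close>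
      have mid: "(1 - 1/2) *\<^sub>R u + (1/2) *\<^sub>R (2 *\<^sub>R x k - u) = x k" by (simp add: scaleR_diff_right)
      have "est n (x k) \<le> (1 - 1/2) * est n u + 1/2 * est n (2 *\<^sub>R x k - u)"
        using convex_onD[OF convex_on_est[of n], of "1/2" u "2 *\<^sub>R x k - u"]
          subsetD[OF order_trans[OF sub T] u'] subsetD[OF order_trans[OF sub T] w] unfolding mid by simp
      then show "u \<in> hull_pts n \<and> \<bar>est n u\<bar> \<le> \<bar>D\<bar> + 2 * \<bar>B'\<bar>"
        using upper[OF u'] upper[OF w] k(3) sub T u' by auto
    qed
  qed
  then show ?thesis using V(2) by (intro exI[of _ "\<rho> / 3"]) auto
qed

lemma est_bounded_on_compact:
  assumes "compact K" "K \<subseteq> interior S"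
  shows "\<exists>B. \<forall>\<^sub>F n in sequentially. \<forall>u\<in>K. u \<in> hull_pts n \<and> \<bar>est n u\<bar> \<le> B"
proof -
  have "\<forall>p\<in>K. \<exists>\<rho>>0. \<exists>B. \<forall>\<^sub>F n in sequentially. \<forall>u\<in>ball p \<rho>. u \<in> hull_pts n \<and> \<bar>est n u\<bar> \<le> B"
    using assms(2) by (intro ballI est_locally_bounded) (rule subsetD)
  from bchoice[OF this] obtain \<rho> where
    "\<forall>p\<in>K. 0 < \<rho> p \<and> (\<exists>B. \<forall>\<^sub>F n in sequentially. \<forall>u\<in>ball p (\<rho> p). u \<in> hull_pts n \<and> \<bar>est n u\<bar> \<le> B)"
    by (rule exE)
  then have \<rho>: "\<And>p. p \<in> K \<Longrightarrow> 0 < \<rho> p" and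
    ex: "\<forall>p\<in>K. \<exists>B. \<forall>\<^sub>F n in sequentially. \<forall>u\<in>ball p (\<rho> p). u \<in> hull_pts n \<and> \<bar>est n u\<bar> \<le> B"
    by simp_all
  from bchoice[OF ex] obtain B where
    B: "\<forall>p\<in>K. \<forall>\<^sub>F n in sequentially. \<forall>u\<in>ball p (\<rho> p). u \<in> hull_pts n \<and> \<bar>est n u\<bar> \<le> B p"
    by (rule exE)
  obtain Q where Q: "Q \<subseteq> K" "finite Q" "K \<subseteq> (\<Union>p\<in>Q. ball p (\<rho> p))"
    by (rule compactE_image[OF assms(1), of K "\<lambda>p. ball p (\<rho> p)"]) (use \<rho> in force)+
  have "\<forall>\<^sub>F n in sequentially. \<forall>p\<in>Q. \<forall>u\<in>ball p (\<rho> p). u \<in> hull_pts n \<and> \<bar>est n u\<bar> \<le> B p"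
    using B Q(1) by (intro eventually_ball_finite Q(2)) blast
  then have "\<forall>\<^sub>F n in sequentially. \<forall>u\<in>K. u \<in> hull_pts n \<and> \<bar>est n u\<bar> \<le> (\<Sum>p\<in>Q. \<bar>B p\<bar>)"
  proof eventually_elim
    case (elim n)
    show ?case
    proof
      fix u assume "u \<in> K"
      then obtain p where p: "p \<in> Q" "u \<in> ball p (\<rho> p)" using Q by auto
      then have "\<bar>B p\<bar> \<le> (\<Sum>p\<in>Q. \<bar>B p\<bar>)" using Q by (intro member_le_sum) auto
      then show "u \<in> hull_pts n \<and> \<bar>est n u\<bar> \<le> (\<Sum>p\<in>Q. \<bar>B p\<bar>)" using elim p by fastforce
    qed
  qed
  then show ?thesis by blast
qed

text \<open>\<open>err n\<close> is a difference of two convex functions, both bounded on an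
  \<open>r\<close>-neighbourhood of \<open>K\<close> by constants free of \<open>n\<close>. Each is
  Lipschitz on balls of radius \<open>r / 2\<close>, and the two constants add up to
  \<open>L\<close>.\<close>

lemma err_lipschitz_on_compact:
  assumes "compact K" "K \<subseteq> interior S"
  obtains \<rho> L B where "0 < \<rho>" "0 \<le> L" "(\<Union>u\<in>K. cball u \<rho>) \<subseteq> interior S"
    "\<forall>\<^sub>F n in sequentially. \<forall>u\<in>K. u \<in> hull_pts n \<and> \<bar>err n u\<bar> \<le> B \<and> (\<forall>v\<in>ball u \<rho>. \<bar>err n u - err n v\<bar> \<le> L * dist u v)"
proof -
  obtain r where r: "0 < r" "(\<Union>u\<in>K. cball u r) \<subseteq> interior S"
    by (rule compact_subset_open_imp_cball_epsilon_subset[OF assms(1) open_interior assms(2)])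
  let ?K = "\<Union>u\<in>K. cball u r"
  note K' = compact_UN_cball[OF assms(1), of r]
  obtain B where B: "\<forall>\<^sub>F n in sequentially. \<forall>u\<in>?K. u \<in> hull_pts n \<and> \<bar>est n u\<bar> \<le> B"
    using est_bounded_on_compact[OF K' r(2)] by (rule exE)
  obtain G where G: "\<And>u. u \<in> ?K \<Longrightarrow> \<bar>g u\<bar> \<le> G" by (rule g_bounded_on_compact[OF K' r(2)]) blast
  define L where "L = 2 * \<bar>B\<bar> / (r / 2) + 2 * \<bar>G\<bar> / (r / 2)"
  have ball: "ball u (2 * (r / 2)) \<subseteq> ?K" if "u \<in> K" for u using that by auto
  have "\<forall>\<^sub>F n in sequentially. \<forall>u\<in>K. u \<in> hull_pts n \<and> \<bar>err n u\<bar> \<le> B + G \<and>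
      (\<forall>v\<in>ball u (r / 2). \<bar>err n u - err n v\<bar> \<le> L * dist u v)"
    using B
  proof eventually_elim
    case (elim n)
    show ?case
    proof (intro ballI conjI)
      fix u assume u: "u \<in> K"
      then have uK: "u \<in> ?K" using r by force
      show "u \<in> hull_pts n" using elim uK by blast
      have "\<bar>est n u\<bar> \<le> B" "\<bar>g u\<bar> \<le> G" using elim uK G by blast+
      then show "\<bar>err n u\<bar> \<le> B + G" unfolding err_def by linarith
      fix v assume v: "v \<in> ball u (r / 2)"
      have "\<bar>est n u - est n v\<bar> \<le> 2 * \<bar>B\<bar> / (r / 2) * dist u v"
      proof (rule convex_on_bounded_imp_lipschitz[OF _ _ _ _ v])
        show "convex_on (ball u (2 * (r / 2))) (est n)"
          using elim ball[OF u] by (intro convex_on_subset[OF convex_on_est]) auto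
        show "\<bar>est n w\<bar> \<le> \<bar>B\<bar>" if "w \<in> ball u (2 * (r / 2))" for w
          using elim ball[OF u] that by fastforce
      qed (use r in auto)
      moreover have "\<bar>g u - g v\<bar> \<le> 2 * \<bar>G\<bar> / (r / 2) * dist u v"
      proof (rule convex_on_bounded_imp_lipschitz[OF _ _ _ _ v])
        show "convex_on (ball u (2 * (r / 2))) g"
          using r(2) ball[OF u] interior_subset[of S] by (intro convex_on_subset[OF convex_g]) auto
        show "\<bar>g w\<bar> \<le> \<bar>G\<bar>" if "w \<in> ball u (2 * (r / 2))" for w
          using G ball[OF u] that by fastforce
      qed (use r in auto)
      ultimately have "\<bar>err n u - err n v\<bar> \<le> 2 * \<bar>B\<bar> / (r / 2) * dist u v + 2 * \<bar>G\<bar> / (r / 2) * dist u v"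
        unfolding err_def by linarith
      then show "\<bar>err n u - err n v\<bar> \<le> L * dist u v" by (simp add: L_def distrib_right)
    qed
  qed
  moreover have "(\<Union>u\<in>K. cball u (r / 2)) \<subseteq> interior S" using r by force
  ultimately show ?thesis using r(1) by (intro that[of "r / 2" L "B + G"]) (auto simp: L_def)
qed

text \<open>On a set of small diameter \<open>err n\<close> is nearly constant, so that its correlation with the errors is
  controlled by \<open>mean\<close>.\<close>

lemma cell_sums_small:
  assumes err: "\<forall>\<^sub>F n in sequentially. \<forall>u\<in>K. \<bar>err n u\<bar> \<le> B \<and> (\<forall>v\<in>ball u \<rho>. \<bar>err n u - err n v\<bar> \<le> L * dist u v)"
    and F: "finite F" "F \<subseteq> \<B>" "\<And>U. U \<in> F \<Longrightarrow> U \<subseteq> K" "\<And>U u v. U \<in> F \<Longrightarrow> u \<in> U \<Longrightarrow> v \<in> U \<Longrightarrow> dist u v < \<delta>"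
    and "\<delta> \<le> \<rho>" "0 \<le> L" "0 < \<tau>"
  shows "\<forall>\<^sub>F n in sequentially. \<bar>\<Sum>k<n. indicator (\<Union>F) (x k) * e k * err n (x k)\<bar>
    \<le> \<tau> * real n + L * \<delta> * (\<Sum>k<n. indicator (\<Union>F) (x k) * \<bar>e k\<bar>)"
  using F \<open>0 < \<tau>\<close>
proof (induction F arbitrary: \<tau>)
  case (insert U F)
  \<comment> \<open>Cells may overlap, so only the new part of \<open>U\<close> is treated. It is
    the difference of two nested finite unions of base sets, so \<open>mean\<close> applies to it at
    twice the cost. Half of \<tau> goes to this part and half to the induction hypothesis.\<close>
  define A where "A = U - \<Union>F"
  have ind: "indicator (\<Union>(insert U F)) = (\<lambda>u. indicator (\<Union>F) u + indicator A u :: real)"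
    by (auto simp: A_def indicator_def fun_eq_iff)
  \<comment> \<open>Chosen such that
    \<open>(\<bar>B\<bar> + 1) * (2 * b) = \<tau> / 2\<close>.\<close>
  define b where "b = \<tau> / (4 * (\<bar>B\<bar> + 1))"
  have b: "0 < b" using insert.prems by (simp add: b_def)
  have IH: "\<forall>\<^sub>F n in sequentially. \<bar>\<Sum>k<n. indicator (\<Union>F) (x k) * e k * err n (x k)\<bar>
    \<le> \<tau> / 2 * real n + L * \<delta> * (\<Sum>k<n. indicator (\<Union>F) (x k) * \<bar>e k\<bar>)"
  proof (rule insert.IH)
    show "F \<subseteq> \<B>" "\<And>V. V \<in> F \<Longrightarrow> V \<subseteq> K" "0 < \<tau> / 2" using insert.prems by auto
    show "dist u v < \<delta>" if "V \<in> F" "u \<in> V" "v \<in> V" for V u v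
      using that by (intro insert.prems(3)[of V]) auto
  qed
  have m1: "\<forall>\<^sub>F n in sequentially. \<bar>\<Sum>k<n. indicator (\<Union>F) (x k) * e k\<bar> \<le> b * real n"
    using insert b by (intro mean) auto
  have m2: "\<forall>\<^sub>F n in sequentially. \<bar>\<Sum>k<n. indicator (\<Union>(insert U F)) (x k) * e k\<bar> \<le> b * real n"
    using insert b by (intro mean) auto
  show ?case
    using IH m1 m2 err
  proof eventually_elim
    case (elim n)
    have A_small: "\<bar>\<Sum>k<n. indicator A (x k) * e k\<bar> \<le> 2 * b * real n"
      using elim(2,3) unfolding ind by (simp add: distrib_right sum.distrib)
    have A_bound: "\<bar>\<Sum>k<n. indicator A (x k) * e k * err n (x k)\<bar>
      \<le> \<tau> / 2 * real n + L * \<delta> * (\<Sum>k<n. indicator A (x k) * \<bar>e k\<bar>)"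
    proof (cases "A = {}")
      case True
      then show ?thesis using insert.prems by simp
    next
      case False
      then obtain a where a: "a \<in> A" by blast
      then have aK: "a \<in> K" "a \<in> U" using insert.prems by (auto simp: A_def)
      have split: "(\<Sum>k<n. indicator A (x k) * e k * err n (x k)) =
          err n a * (\<Sum>k<n. indicator A (x k) * e k) + (\<Sum>k<n. indicator A (x k) * e k * (err n (x k) - err n a))"
        unfolding sum_distrib_left sum.distrib[symmetric] by (intro sum.cong refl) (simp add: algebra_simps)
      have "\<bar>\<Sum>k<n. indicator A (x k) * e k * err n (x k)\<bar> \<le> \<bar>err n a\<bar> * \<bar>\<Sum>k<n. indicator A (x k) * e k\<bar> +
          (\<Sum>k<n. \<bar>indicator A (x k) * e k * (err n (x k) - err n a)\<bar>)"
        unfolding split by (intro order_trans[OF abs_triangle_ineq] add_mono sum_abs) (simp add: abs_mult)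
      also have "\<dots> \<le> (\<bar>B\<bar> + 1) * (2 * b * real n) + (\<Sum>k<n. L * \<delta> * (indicator A (x k) * \<bar>e k\<bar>))"
      proof (rule add_mono)
        have "\<bar>err n a\<bar> \<le> B" using bspec[OF elim(4) aK(1)] by (rule conjunct1)
        then have "\<bar>err n a\<bar> \<le> \<bar>B\<bar> + 1" by linarith
        then show "\<bar>err n a\<bar> * \<bar>\<Sum>k<n. indicator A (x k) * e k\<bar> \<le> (\<bar>B\<bar> + 1) * (2 * b * real n)"
          using A_small by (rule mult_mono) simp_all
        show "(\<Sum>k<n. \<bar>indicator A (x k) * e k * (err n (x k) - err n a)\<bar>)
            \<le> (\<Sum>k<n. L * \<delta> * (indicator A (x k) * \<bar>e k\<bar>))"
        proof (rule sum_mono)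
          fix k
          show "\<bar>indicator A (x k) * e k * (err n (x k) - err n a)\<bar> \<le> L * \<delta> * (indicator A (x k) * \<bar>e k\<bar>)"
          proof (cases "x k \<in> A")
            case True
            then have d: "dist a (x k) < \<delta>" using aK(2) by (intro insert.prems(3)[of U]) (auto simp: A_def)
            then have "\<bar>err n a - err n (x k)\<bar> \<le> L * dist a (x k)"
              using bspec[OF elim(4) aK(1), THEN conjunct2] \<open>\<delta> \<le> \<rho>\<close> by simp
            also have "\<dots> \<le> L * \<delta>" using d \<open>0 \<le> L\<close> by (intro mult_left_mono) auto
            finally have "\<bar>e k\<bar> * \<bar>err n (x k) - err n a\<bar> \<le> \<bar>e k\<bar> * (L * \<delta>)"
              by (intro mult_left_mono) (auto simp: abs_minus_commute)
            then show ?thesis using True by (simp add: abs_mult mult.commute)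
          qed simp
        qed
      qed
      also have "(\<bar>B\<bar> + 1) * (2 * b * real n) = \<tau> / 2 * real n"
        by (simp add: b_def field_simps)
      finally show ?thesis unfolding sum_distrib_left .
    qed
    have "\<bar>\<Sum>k<n. indicator (\<Union>(insert U F)) (x k) * e k * err n (x k)\<bar>
       \<le> \<bar>\<Sum>k<n. indicator (\<Union>F) (x k) * e k * err n (x k)\<bar> + \<bar>\<Sum>k<n. indicator A (x k) * e k * err n (x k)\<bar>"
      unfolding ind distrib_right sum.distrib by (rule abs_triangle_ineq)
    also have "\<dots> \<le> (\<tau> / 2 * real n + L * \<delta> * (\<Sum>k<n. indicator (\<Union>F) (x k) * \<bar>e k\<bar>)) +
       (\<tau> / 2 * real n + L * \<delta> * (\<Sum>k<n. indicator A (x k) * \<bar>e k\<bar>))"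
      by (intro add_mono elim(1) A_bound)
    also have "\<dots> = \<tau> * real n + L * \<delta> * (\<Sum>k<n. indicator (\<Union>(insert U F)) (x k) * \<bar>e k\<bar>)"
      unfolding ind distrib_right sum.distrib by (simp add: distrib_left)
    finally show ?case .
  qed
qed simp

section \<open>From small correlation to uniform convergence\<close>

text \<open>The correlation of errors and deviations is split along a finite union \<open>W\<close>
  of small base sets covering a large compact set. Inside, \<open>cell_sums_small\<close> applies;
  outside, the errors are small in mean square. Each half contributes at most
  \<open>\<eta> / 2 * real n\<close>.\<close>

lemma mean_err_squared_small:
  assumes "0 < \<eta>"
  shows "\<forall>\<^sub>F n in sequentially. (\<Sum>k<n. (err n (x k))\<^sup>2) \<le> \<eta> * real n"
proof -
  obtain C where C: "1 \<le> C" "\<forall>\<^sub>F n in sequentially. (\<Sum>k<n. (e k)\<^sup>2) \<le> C * real n"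
    "\<forall>\<^sub>F n in sequentially. (\<Sum>k<n. (err n (x k))\<^sup>2) \<le> C * real n"
    by (rule sum_err_squared_bounded)
  \<comment> \<open>With the Young weight \<open>a = \<eta> / (2 * C)\<close> below, this level and
    the mean square bound \<open>C\<close> each contribute \<eta>/4.\<close>
  have "0 < \<eta>\<^sup>2 / (4 * C)" using assms C(1) by simp
  from tight[OF this] obtain K where K: "compact K" "K \<subseteq> interior S"
    "\<forall>\<^sub>F n in sequentially. (\<Sum>k<n. indicator (- K) (x k) * (e k)\<^sup>2) \<le> \<eta>\<^sup>2 / (4 * C) * real n"
    by (elim exE conjE)
  obtain r where r: "0 < r" "(\<Union>u\<in>K. cball u r) \<subseteq> interior S"
    by (rule compact_subset_open_imp_cball_epsilon_subset[OF K(1) open_interior K(2)])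
  \<comment> \<open>The cells covering \<open>K\<close> may stick out of it, so the Lipschitz bound
    is taken on a neighbourhood.\<close>
  let ?K = "\<Union>u\<in>K. cball u r"
  obtain \<rho> L B where \<rho>: "0 < \<rho>" "0 \<le> L" "(\<Union>u\<in>?K. cball u \<rho>) \<subseteq> interior S"
    "\<forall>\<^sub>F n in sequentially. \<forall>u\<in>?K. u \<in> hull_pts n \<and> \<bar>err n u\<bar> \<le> B \<and> (\<forall>v\<in>ball u \<rho>. \<bar>err n u - err n v\<bar> \<le> L * dist u v)"
    by (rule err_lipschitz_on_compact[OF compact_UN_cball[OF K(1)] r(2)])
  \<comment> \<open>The last entry makes \<open>L * \<delta> * (C + 1)\<close> at most \<eta>/4,
    where \<open>(C + 1) * real n\<close> bounds the sum of absolute errors by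
    \<open>\<bar>e\<bar> \<le> 1 + e\<^sup>2\<close>. The other two keep cells inside
    \<open>?K\<close> and within the range of the Lipschitz bound.\<close>
  define \<delta> where "\<delta> = min \<rho> (min r (\<eta> / (4 * (L + 1) * (C + 1))))"
  have \<delta>: "0 < \<delta>" "\<delta> \<le> \<rho>" "\<delta> \<le> r" using \<rho> r assms C by (auto simp: \<delta>_def)
  have "L * \<delta> * (C + 1) \<le> (L + 1) * (\<eta> / (4 * (L + 1) * (C + 1))) * (C + 1)"
    using \<rho>(2) C(1) \<delta>(1) assms by (intro mult_mono) (auto simp: \<delta>_def intro!: divide_nonneg_nonneg)
  also have "\<dots> = \<eta> / 4"
  proof -
    have "a * (\<eta> / (4 * a * b)) * b = \<eta> / 4" if "a \<noteq> 0" "b \<noteq> 0" for a b :: real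
      using that by simp
    from this[of "L + 1" "C + 1"] show ?thesis using \<rho>(2) C(1) by linarith
  qed
  finally have L\<delta>: "L * \<delta> * (C + 1) \<le> \<eta> / 4" .
  have "\<forall>p. \<exists>U. U \<in> \<B> \<and> p \<in> U \<and> U \<subseteq> ball p (\<delta> / 2)"
  proof
    fix p :: 'a
    have "p \<in> ball p (\<delta> / 2)" using \<delta>(1) by simp
    then obtain U where "U \<in> \<B>" "p \<in> U" "U \<subseteq> ball p (\<delta> / 2)"
      by (rule topological_basisE[OF basis open_ball])
    then show "\<exists>U. U \<in> \<B> \<and> p \<in> U \<and> U \<subseteq> ball p (\<delta> / 2)" by blast
  qed
  from choice[OF this] obtain U where "\<forall>p. U p \<in> \<B> \<and> p \<in> U p \<and> U p \<subseteq> ball p (\<delta> / 2)" by (rule exE)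
  then have U: "\<And>p. U p \<in> \<B>" "\<And>p. p \<in> U p" "\<And>p. U p \<subseteq> ball p (\<delta> / 2)" by simp_all
  obtain Q where Q: "Q \<subseteq> K" "finite Q" "K \<subseteq> (\<Union>p\<in>Q. U p)"
    by (rule compactE_image[OF K(1), of K U])
       (use U topological_basis_open[OF basis] in auto)
  define W where "W = \<Union>(U ` Q)"
  have cells: "\<forall>\<^sub>F n in sequentially. \<bar>\<Sum>k<n. indicator W (x k) * e k * err n (x k)\<bar>
    \<le> \<eta> / 4 * real n + L * \<delta> * (\<Sum>k<n. indicator W (x k) * \<bar>e k\<bar>)"
    unfolding W_def
  proof (rule cell_sums_small[where K = ?K and B = B and \<rho> = \<rho>])
    show "\<forall>\<^sub>F n in sequentially. \<forall>u\<in>?K. \<bar>err n u\<bar> \<le> B \<and> (\<forall>v\<in>ball u \<rho>. \<bar>err n u - err n v\<bar> \<le> L * dist u v)"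
      using \<rho>(4)
    proof eventually_elim
      case (elim n)
      show ?case by (rule ballI, drule bspec[OF elim], elim conjE, intro conjI)
    qed
    show "V \<subseteq> ?K" if V: "V \<in> U ` Q" for V
    proof -
      obtain p where p: "p \<in> Q" "V = U p" using V by blast
      have "V \<subseteq> ball p (\<delta> / 2)" using U(3)[of p] unfolding p(2) .
      also have "\<dots> \<subseteq> cball p r" using \<delta> by auto
      finally have "V \<subseteq> cball p r" .
      then show ?thesis using p(1) Q(1) by blast
    qed
    show "dist u v < \<delta>" if V: "V \<in> U ` Q" "u \<in> V" "v \<in> V" for V u v
    proof -
      obtain p where p: "V = U p" using V(1) by blast
      have "dist p u < \<delta> / 2" "dist p v < \<delta> / 2" using U(3)[of p] V p by auto
      then show ?thesis by (metis dist_commute dist_triangle_half_r)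
    qed
    show "finite (U ` Q)" "U ` Q \<subseteq> \<B>" using Q(2) U(1) by auto
  qed (use \<delta>(2) \<rho>(2) assms in simp_all)
  define a where "a = \<eta> / (2 * C)"
  have a: "0 < a" using assms C(1) by (simp add: a_def)
  show ?thesis
    using cells C(2,3) K(3)
  proof eventually_elim
    case (elim n)
    let ?i = "indicator :: 'a set \<Rightarrow> 'a \<Rightarrow> real"
    have "(\<Sum>k<n. ?i W (x k) * \<bar>e k\<bar>) \<le> (\<Sum>k<n. 1 + (e k)\<^sup>2)"
    proof (rule sum_mono)
      fix k
      have "0 \<le> (\<bar>e k\<bar> - 1)\<^sup>2" "0 \<le> \<bar>e k\<bar>" by simp_all
      then have "\<bar>e k\<bar> \<le> 1 + (e k)\<^sup>2" unfolding power2_diff by simp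
      then show "?i W (x k) * \<bar>e k\<bar> \<le> 1 + (e k)\<^sup>2" by (auto simp: indicator_def)
    qed
    also have "\<dots> \<le> (C + 1) * real n" using elim(2) by (simp add: sum.distrib distrib_right)
    finally have "L * \<delta> * (\<Sum>k<n. ?i W (x k) * \<bar>e k\<bar>) \<le> L * \<delta> * ((C + 1) * real n)"
      using \<rho>(2) \<delta>(1) by (intro mult_left_mono) auto
    also have "\<dots> \<le> \<eta> / 4 * real n"
      using mult_right_mono[OF L\<delta>, of "real n"] by (simp add: mult.assoc)
    finally have inside: "(\<Sum>k<n. ?i W (x k) * e k * err n (x k)) \<le> \<eta> / 2 * real n"
      using elim(1) by simp
    \<comment> \<open>Young's inequality with weight \<open>a\<close>. As \<open>W\<close> covers
      \<open>K\<close>, a point outside \<open>W\<close> is outside \<open>K\<close>, so the error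
      terms are those controlled by \<open>tight\<close>.\<close>
    have "(\<Sum>k<n. ?i (- W) (x k) * e k * err n (x k)) \<le>
        (\<Sum>k<n. ?i (- K) (x k) * (e k)\<^sup>2 / (2 * a) + a / 2 * (err n (x k))\<^sup>2)"
    proof (rule sum_mono)
      fix k
      have "(e k - a * err n (x k))\<^sup>2 / (2 * a) = (e k)\<^sup>2 / (2 * a) + a / 2 * (err n (x k))\<^sup>2 - e k * err n (x k)"
        using a by (simp add: power2_eq_square field_simps)
      moreover have "0 \<le> (e k - a * err n (x k))\<^sup>2 / (2 * a)" using a by simp
      ultimately have *: "e k * err n (x k) \<le> (e k)\<^sup>2 / (2 * a) + a / 2 * (err n (x k))\<^sup>2" by linarith
      show "?i (- W) (x k) * e k * err n (x k) \<le> ?i (- K) (x k) * (e k)\<^sup>2 / (2 * a) + a / 2 * (err n (x k))\<^sup>2"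
        using * Q(3) a by (cases "x k \<in> W") (auto simp: W_def indicator_def)
    qed
    also have "\<dots> = (\<Sum>k<n. ?i (- K) (x k) * (e k)\<^sup>2) / (2 * a) + a / 2 * (\<Sum>k<n. (err n (x k))\<^sup>2)"
      unfolding sum.distrib sum_divide_distrib sum_distrib_left ..
    also have "\<dots> \<le> \<eta>\<^sup>2 / (4 * C) * real n / (2 * a) + a / 2 * (C * real n)"
      using elim(3,4) a by (intro add_mono divide_right_mono mult_left_mono) auto
    also have "\<dots> = \<eta> / 2 * real n" using assms C(1) by (simp add: a_def power2_eq_square field_simps)
    finally have outside: "(\<Sum>k<n. ?i (- W) (x k) * e k * err n (x k)) \<le> \<eta> / 2 * real n" .
    have "(\<Sum>k<n. e k * err n (x k)) = (\<Sum>k<n. ?i W (x k) * e k * err n (x k)) + (\<Sum>k<n. ?i (- W) (x k) * e k * err n (x k))"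
      unfolding sum.distrib[symmetric] by (intro sum.cong refl) (simp add: indicator_compl algebra_simps)
    then show ?case using inside outside sum_err_squared_le[of n] by simp
  qed
qed

text \<open>A large deviation at one point persists, halved, on a ball by the Lipschitz bound, and
  such a ball holds a positive proportion of the design. Finitely many fixed balls cover
  \<open>K\<close>, so one threshold for \<open>n\<close> serves all of \<open>K\<close>.\<close>

lemma err_uniformly_small:
  assumes K: "compact K" "K \<subseteq> interior S" and "0 < \<epsilon>"
  shows "\<forall>\<^sub>F n in sequentially. \<forall>u\<in>K. u \<in> hull_pts n \<and> \<bar>err n u\<bar> \<le> \<epsilon>"
proof -
  obtain \<rho> L B where \<rho>: "0 < \<rho>" "0 \<le> L" "(\<Union>u\<in>K. cball u \<rho>) \<subseteq> interior S"
    "\<forall>\<^sub>F n in sequentially. \<forall>u\<in>K. u \<in> hull_pts n \<and> \<bar>err n u\<bar> \<le> B \<and> (\<forall>v\<in>ball u \<rho>. \<bar>err n u - err n v\<bar> \<le> L * dist u v)"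
    by (rule err_lipschitz_on_compact[OF K])
  define \<delta> where "\<delta> = min \<rho> (\<epsilon> / (2 * (L + 1)))"
  have \<delta>: "0 < \<delta>" "\<delta> \<le> \<rho>" using \<rho> \<open>0 < \<epsilon>\<close> by (auto simp: \<delta>_def)
  have "L * \<delta> \<le> (L + 1) * (\<epsilon> / (2 * (L + 1)))" using \<rho> \<delta> by (intro mult_mono) (auto simp: \<delta>_def)
  also have "\<dots> = \<epsilon> / 2" using \<rho> by (simp add: field_simps)
  finally have L\<delta>: "L * \<delta> \<le> \<epsilon> / 2" .
  have sub: "ball q (\<delta> / 2) \<subseteq> interior S" if "q \<in> K" for q
  proof -
    have "ball q (\<delta> / 2) \<subseteq> cball q \<rho>" using \<delta> by auto
    then show ?thesis using \<rho>(3) that by blast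
  qed
  have "\<forall>q\<in>K. \<exists>c>0. \<forall>\<^sub>F n in sequentially. c * real n \<le> real (card {k. k < n \<and> x k \<in> ball q (\<delta> / 2)})"
    using \<delta>(1) by (intro ballI design_dense sub) auto
  from bchoice[OF this] obtain c where
    "\<forall>q\<in>K. 0 < c q \<and> (\<forall>\<^sub>F n in sequentially. c q * real n \<le> real (card {k. k < n \<and> x k \<in> ball q (\<delta> / 2)}))"
    by (rule exE)
  then have c: "\<And>q. q \<in> K \<Longrightarrow> 0 < c q"
    "\<And>q. q \<in> K \<Longrightarrow> \<forall>\<^sub>F n in sequentially. c q * real n \<le> real (card {k. k < n \<and> x k \<in> ball q (\<delta> / 2)})"
    by simp_all
  obtain Q where Q: "Q \<subseteq> K" "finite Q" "K \<subseteq> (\<Union>q\<in>Q. ball q (\<delta> / 2))"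
    by (rule compactE_image[OF K(1), of K "\<lambda>q. ball q (\<delta> / 2)"]) (use \<delta>(1) in force)+
  have "\<forall>\<^sub>F n in sequentially. \<forall>q\<in>Q. c q * real n \<le> real (card {k. k < n \<and> x k \<in> ball q (\<delta> / 2)}) \<and>
      (\<Sum>k<n. (err n (x k))\<^sup>2) \<le> c q * (\<epsilon>\<^sup>2 / 8) * real n"
    using Q c \<open>0 < \<epsilon>\<close> by (intro eventually_ball_finite ballI eventually_conj mean_err_squared_small) auto
  then show ?thesis
    using \<rho>(4) eventually_gt_at_top[of 0]
  proof eventually_elim
    case (elim n)
    show ?case
    proof (intro ballI conjI)
      fix u assume u: "u \<in> K"
      then show "u \<in> hull_pts n" using elim by blast
      show "\<bar>err n u\<bar> \<le> \<epsilon>"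
      proof (rule ccontr)
        \<comment> \<open>The design points in the ball around \<open>q\<close> would contribute at
          least \<open>c q * \<epsilon>\<^sup>2 / 4 * real n\<close>, twice the mean square bound
          arranged for this \<open>q\<close>.\<close>
        assume large: "\<not> \<bar>err n u\<bar> \<le> \<epsilon>"
        obtain q where q: "q \<in> Q" "u \<in> ball q (\<delta> / 2)" using Q(3) u by auto
        have "(\<epsilon> / 2)\<^sup>2 \<le> (err n v)\<^sup>2" if "v \<in> ball q (\<delta> / 2)" for v
        proof -
          have d: "dist u v < \<delta>" using q(2) that by (metis dist_commute dist_triangle_half_r mem_ball)
          then have "\<bar>err n u - err n v\<bar> \<le> L * dist u v" using elim(2) u \<delta> by (meson less_le_trans mem_ball)
          also have "\<dots> \<le> L * \<delta>" using d \<rho>(2) by (intro mult_left_mono) auto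
          finally have "\<epsilon> / 2 \<le> \<bar>err n v\<bar>" using L\<delta> large by linarith
          then have "(\<epsilon> / 2)\<^sup>2 \<le> \<bar>err n v\<bar>\<^sup>2" using \<open>0 < \<epsilon>\<close> by (intro power_mono) auto
          then show ?thesis by simp
        qed
        then have "(\<epsilon> / 2)\<^sup>2 * real (card {k. k < n \<and> x k \<in> ball q (\<delta> / 2)}) \<le> (\<Sum>k<n. (err n (x k))\<^sup>2)"
          by (intro sum_squares_ge_card)
        moreover have "(\<epsilon> / 2)\<^sup>2 * (c q * real n) \<le> (\<epsilon> / 2)\<^sup>2 * real (card {k. k < n \<and> x k \<in> ball q (\<delta> / 2)})"
          using elim(1) q by (intro mult_left_mono) auto
        ultimately have "(\<epsilon> / 2)\<^sup>2 * (c q * real n) \<le> c q * (\<epsilon>\<^sup>2 / 8) * real n" using elim(1) q by fastforce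
        then have "\<epsilon>\<^sup>2 * (c q * real n) \<le> 0" by (simp add: power2_eq_square field_simps)
        moreover have "0 < \<epsilon>\<^sup>2 * (c q * real n)" using \<open>0 < \<epsilon>\<close> elim(3) c(1) q(1) Q(1) by auto
        ultimately show False by linarith
      qed
    qed
  qed
qed

text \<open>A deviation of at most \<delta>/2 at both \<open>u\<close> and \<open>u + h\<close>
  turns a subgradient of the estimator into one of \<open>g\<close> up to \<delta>. Only
  \<open>h\<close> shorter than \<rho> are tested, which keeps \<open>u + h\<close> in a compact
  subset of the interior.\<close>

theorem subgradients_uniformly_close:
  assumes diff: "g differentiable_on interior S" and K: "compact K" "K \<subseteq> interior S" and "0 < \<epsilon>"
  shows "\<forall>\<^sub>F n in sequentially. \<forall>u\<in>K. \<forall>\<xi>\<in>subdifferential (cls_estimator S x y n) u. norm (\<xi> - gradient g u) < \<epsilon>"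
proof -
  obtain \<rho> where \<rho>: "0 < \<rho>" "(\<Union>u\<in>K. cball u \<rho>) \<subseteq> interior S"
    by (rule compact_subset_open_imp_cball_epsilon_subset[OF K(1) open_interior K(2)])
  have sub: "u + h \<in> (\<Union>u\<in>K. cball u \<rho>)" if "u \<in> K" "norm h \<le> \<rho>" for u h
    using that by (intro UN_I[of u]) (auto simp: dist_norm)
  have "convex_on (interior S) g"
    by (intro convex_on_subset[OF convex_g] interior_subset) (auto simp: convex_S)
  moreover have "u + h \<in> interior S" if "u \<in> K" "norm h \<le> \<rho>" for u h
    by (rule subsetD[OF \<rho>(2) sub[OF that]])
  ultimately have "\<exists>\<delta>>0. \<forall>u\<in>K. \<forall>\<xi>. (\<forall>h. norm h < \<rho> \<longrightarrow> \<xi> \<bullet> h \<le> g (u + h) - g u + \<delta>) \<longrightarrow>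
      norm (\<xi> - gradient g u) < \<epsilon>"
    by (intro approx_subgradient_near_gradient[OF open_interior _ diff K _ \<rho>(1) \<open>0 < \<epsilon>\<close>])
  then obtain \<delta> where "0 < \<delta>" "\<forall>u\<in>K. \<forall>\<xi>. (\<forall>h. norm h < \<rho> \<longrightarrow> \<xi> \<bullet> h \<le> g (u + h) - g u + \<delta>) \<longrightarrow>
      norm (\<xi> - gradient g u) < \<epsilon>"
    by (elim exE conjE)
  then have \<delta>: "0 < \<delta>" "\<And>u \<xi>. u \<in> K \<Longrightarrow> (\<And>h. norm h < \<rho> \<Longrightarrow> \<xi> \<bullet> h \<le> g (u + h) - g u + \<delta>) \<Longrightarrow>
      norm (\<xi> - gradient g u) < \<epsilon>"
    by simp_all
  have "\<forall>\<^sub>F n in sequentially. \<forall>u\<in>(\<Union>u\<in>K. cball u \<rho>). u \<in> hull_pts n \<and> \<bar>err n u\<bar> \<le> \<delta> / 2"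
    using \<rho> \<delta> by (intro err_uniformly_small compact_UN_cball K) auto
  then show ?thesis
  proof eventually_elim
    case (elim n)
    show ?case
    proof (intro ballI)
      fix u \<xi> assume u: "u \<in> K" and \<xi>: "\<xi> \<in> subdifferential (cls_estimator S x y n) u"
      have ev: "w \<in> hull_pts n" "\<bar>err n w\<bar> \<le> \<delta> / 2" if "w \<in> (\<Union>u\<in>K. cball u \<rho>)" for w
        using elim that by blast+
      show "norm (\<xi> - gradient g u) < \<epsilon>"
      proof (rule \<delta>(2)[OF u])
        fix h :: 'a assume h: "norm h < \<rho>"
        have "u \<in> (\<Union>u\<in>K. cball u \<rho>)" "u + h \<in> (\<Union>u\<in>K. cball u \<rho>)"
          using sub[OF u, of 0] sub[OF u, of h] h \<rho>(1) by auto
        note 1 = ev[OF this(1)] and 2 = ev[OF this(2)]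
        have "ereal (\<xi> \<bullet> h) \<le> cls_estimator S x y n (u + h) - cls_estimator S x y n u"
          using \<xi> by (simp add: subdifferential_def)
        then have "\<xi> \<bullet> h \<le> est n (u + h) - est n u"
          by (simp add: cls_estimator_eq_est[OF 1(1)] cls_estimator_eq_est[OF 2(1)])
        then show "\<xi> \<bullet> h \<le> g (u + h) - g u + \<delta>" using 1(2) 2(2) unfolding err_def by linarith
      qed
    qed
  qed
qed

end

section \<open>Strong laws of large numbers\<close>

context prob_space
begin

text \<open>The sum of all the squares has finite expectation, so it is a.s. finite and its terms
  tend to 0.\<close>

lemma AE_tendsto_0_if_summable_second_moment:
  fixes V :: "nat \<Rightarrow> 'a \<Rightarrow> real"
  assumes int: "\<And>m. integrable M (\<lambda>\<omega>. (V m \<omega>)\<^sup>2)" and sum: "summable (\<lambda>m. expectation (\<lambda>\<omega>. (V m \<omega>)\<^sup>2))"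
  shows "AE \<omega> in M. (\<lambda>m. V m \<omega>) \<longlonglongrightarrow> 0"
proof -
  have meas: "(\<lambda>\<omega>. ennreal ((V m \<omega>)\<^sup>2)) \<in> borel_measurable M" for m
    using borel_measurable_integrable[OF int] by simp
  have "(\<integral>\<^sup>+\<omega>. (\<Sum>m. ennreal ((V m \<omega>)\<^sup>2)) \<partial>M) = (\<Sum>m. \<integral>\<^sup>+\<omega>. ennreal ((V m \<omega>)\<^sup>2) \<partial>M)"
    by (rule nn_integral_suminf[OF meas])
  also have "\<dots> = (\<Sum>m. ennreal (expectation (\<lambda>\<omega>. (V m \<omega>)\<^sup>2)))"
    by (intro suminf_cong nn_integral_eq_integral int) simp
  also have "\<dots> = ennreal (\<Sum>m. expectation (\<lambda>\<omega>. (V m \<omega>)\<^sup>2))"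
    by (intro suminf_ennreal2 sum Bochner_Integration.integral_nonneg) simp
  finally have fin: "(\<integral>\<^sup>+\<omega>. (\<Sum>m. ennreal ((V m \<omega>)\<^sup>2)) \<partial>M) \<noteq> \<infinity>" by simp
  have "AE \<omega> in M. (\<Sum>m. ennreal ((V m \<omega>)\<^sup>2)) \<noteq> \<infinity>"
    by (rule nn_integral_PInf_AE[OF _ fin]) (use meas in measurable)
  then show ?thesis
  proof eventually_elim
    case (elim \<omega>)
    then have "summable (\<lambda>m. (V m \<omega>)\<^sup>2)" by (intro summable_suminf_not_top) auto
    then have "(\<lambda>m. sqrt ((V m \<omega>)\<^sup>2)) \<longlonglongrightarrow> sqrt 0" by (intro tendsto_real_sqrt summable_LIMSEQ_zero)
    then show ?case by (simp add: tendsto_rabs_zero_iff)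
  qed
qed

lemma integrable_of_square_integrable:
  fixes X :: "'a \<Rightarrow> real"
  assumes "X \<in> borel_measurable M" "integrable M (\<lambda>\<omega>. (X \<omega>)\<^sup>2)"
  shows "integrable M X"
proof (rule Bochner_Integration.integrable_bound[of _ "\<lambda>\<omega>. 1 + (X \<omega>)\<^sup>2"])
  show "AE \<omega> in M. norm (X \<omega>) \<le> norm (1 + (X \<omega>)\<^sup>2)"
  proof (rule AE_I2)
    fix \<omega>
    have "0 \<le> (\<bar>X \<omega>\<bar> - 1)\<^sup>2" "0 \<le> \<bar>X \<omega>\<bar>" by simp_all
    then have "\<bar>X \<omega>\<bar> \<le> 1 + (X \<omega>)\<^sup>2" unfolding power2_diff by simp
    then show "norm (X \<omega>) \<le> norm (1 + (X \<omega>)\<^sup>2)" by simp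
  qed
qed (use assms in auto)

text \<open>The cross terms vanish by independence and centring. Integrability is part of the claim
  because the induction step uses it.\<close>

lemma indep_sum_second_moment:
  fixes X :: "nat \<Rightarrow> 'a \<Rightarrow> real"
  assumes indep: "indep_vars (\<lambda>_. borel) X UNIV" and mean: "\<And>k. expectation (X k) = 0"
    and sq: "\<And>k. integrable M (\<lambda>\<omega>. (X k \<omega>)\<^sup>2)" and "finite A"
  shows "integrable M (\<lambda>\<omega>. (\<Sum>k\<in>A. X k \<omega>)\<^sup>2) \<and>
    expectation (\<lambda>\<omega>. (\<Sum>k\<in>A. X k \<omega>)\<^sup>2) = (\<Sum>k\<in>A. expectation (\<lambda>\<omega>. (X k \<omega>)\<^sup>2))"
  using \<open>finite A\<close>
proof (induction A rule: finite_induct)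
  case (insert i A)
  have rv: "X k \<in> borel_measurable M" for k using indep by (auto simp: indep_vars_def)
  have int: "integrable M (X k)" for k by (rule integrable_of_square_integrable[OF rv sq])
  let ?S = "\<lambda>\<omega>. \<Sum>k\<in>A. X k \<omega>"
  have "indep_var borel (X i) borel ?S"
    using insert by (intro indep_vars_sum indep_vars_subset[OF indep]) auto
  moreover have S: "integrable M ?S" by (intro Bochner_Integration.integrable_sum int)
  ultimately have "expectation (\<lambda>\<omega>. X i \<omega> * ?S \<omega>) = 0" "integrable M (\<lambda>\<omega>. X i \<omega> * ?S \<omega>)"
    using indep_var_lebesgue_integral[OF _ int S] indep_var_integrable[OF _ int S] mean by auto
  moreover have "(\<Sum>k\<in>insert i A. X k \<omega>)\<^sup>2 = (X i \<omega>)\<^sup>2 + (2 * (X i \<omega> * ?S \<omega>) + (?S \<omega>)\<^sup>2)" for \<omega>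
    using insert.hyps by (simp add: power2_sum algebra_simps)
  ultimately show ?case using insert sq by simp
qed simp

text \<open>Bounded second moments suffice along the squares \<open>n = m\<^sup>2\<close>, and the absolute sums over the blocks
  between consecutive squares are negligible.\<close>

lemma strong_law_bounded_second_moment:
  fixes X :: "nat \<Rightarrow> 'a \<Rightarrow> real"
  assumes indep: "indep_vars (\<lambda>_. borel) X UNIV" and mean: "\<And>k. expectation (X k) = 0"
    and sq: "\<And>k. integrable M (\<lambda>\<omega>. (X k \<omega>)\<^sup>2)" and bound: "\<And>k. expectation (\<lambda>\<omega>. (X k \<omega>)\<^sup>2) \<le> C"
  shows "AE \<omega> in M. \<forall>\<tau>>0. \<forall>\<^sub>F n in sequentially. \<bar>\<Sum>k<n. X k \<omega>\<bar> \<le> \<tau> * real n"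
proof -
  have rv: "X k \<in> borel_measurable M" for k using indep by (auto simp: indep_vars_def)
  have "0 \<le> expectation (\<lambda>\<omega>. (X 0 \<omega>)\<^sup>2)" by (intro Bochner_Integration.integral_nonneg) simp
  then have "0 \<le> C" using bound[of 0] by linarith
  \<comment> \<open>The average at time \<open>(Suc m)\<^sup>2\<close>. Its second moment is at most
    \<open>C / (real (Suc m))\<^sup>2\<close>, which is summable.\<close>
  define V where "V m \<omega> = (\<Sum>k<(Suc m)\<^sup>2. X k \<omega>) / (real (Suc m))\<^sup>2" for m \<omega>
  define B where "B m = {(Suc m)\<^sup>2..<(Suc (Suc m))\<^sup>2}" for m
  define W where "W m \<omega> = (\<Sum>k\<in>B m. \<bar>X k \<omega>\<bar>) / (real (Suc m))\<^sup>2" for m \<omega>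
  have "summable (\<lambda>m. inverse ((real (Suc m))\<^sup>2))"
    using inverse_power_summable[of 2, where 'a = real] by (subst summable_Suc_iff) simp
  then have sum: "summable (\<lambda>m. c * (1 / (real (Suc m))\<^sup>2))" for c
    by (intro summable_mult) (simp only: inverse_eq_divide)
  have "AE \<omega> in M. (\<lambda>m. V m \<omega>) \<longlonglongrightarrow> 0"
  proof (rule AE_tendsto_0_if_summable_second_moment)
    note moment = indep_sum_second_moment[OF indep mean sq]
    have V: "(V m \<omega>)\<^sup>2 = (\<Sum>k<(Suc m)\<^sup>2. X k \<omega>)\<^sup>2 / ((real (Suc m))\<^sup>2)\<^sup>2" for m \<omega>
      by (simp add: V_def power_divide)
    show "integrable M (\<lambda>\<omega>. (V m \<omega>)\<^sup>2)" for m unfolding V using moment[of "{..<(Suc m)\<^sup>2}"] by simp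
    show "summable (\<lambda>m. expectation (\<lambda>\<omega>. (V m \<omega>)\<^sup>2))"
    proof (rule summable_comparison_test[OF _ sum[of C]], intro exI allI impI)
      fix m
      define q where "q = (real (Suc m))\<^sup>2"
      have q: "0 < q" by (simp add: q_def)
      have "expectation (\<lambda>\<omega>. (V m \<omega>)\<^sup>2) = (\<Sum>k<(Suc m)\<^sup>2. expectation (\<lambda>\<omega>. (X k \<omega>)\<^sup>2)) / q\<^sup>2"
        unfolding V q_def[symmetric] using moment[of "{..<(Suc m)\<^sup>2}"] by simp
      also have "\<dots> \<le> (\<Sum>k<(Suc m)\<^sup>2. C) / q\<^sup>2" by (intro divide_right_mono sum_mono bound) simp
      also have "(\<Sum>k<(Suc m)\<^sup>2. C) = q * C" unfolding q_def by simp
      also have "q * C / q\<^sup>2 = C * (1 / q)" using q by (simp add: power2_eq_square)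
      finally show "norm (expectation (\<lambda>\<omega>. (V m \<omega>)\<^sup>2)) \<le> C * (1 / (real (Suc m))\<^sup>2)"
        unfolding q_def by simp
    qed
  qed
  moreover have "AE \<omega> in M. (\<lambda>m. W m \<omega>) \<longlonglongrightarrow> 0"
  proof (rule AE_tendsto_0_if_summable_second_moment)
    \<comment> \<open>Cauchy-Schwarz over the block. It has \<open>2 * Suc m + 1\<close> indices, at
      most three times \<open>Suc m\<close>, so the second moment of \<open>W m\<close> is at most
      \<open>9 * C / (real (Suc m))\<^sup>2\<close>.\<close>
    have W: "(W m \<omega>)\<^sup>2 \<le> (\<Sum>k\<in>B m. (X k \<omega>)\<^sup>2) * (card (B m) / ((real (Suc m))\<^sup>2)\<^sup>2)" for m \<omega>
      using sum_squared_le_sum_of_squares[of "\<lambda>k. \<bar>X k \<omega>\<bar>" "B m"]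
      by (simp add: W_def power_divide divide_right_mono)
    have [measurable]: "W m \<in> borel_measurable M" for m unfolding W_def using rv by measurable
    have int: "integrable M (\<lambda>\<omega>. (\<Sum>k\<in>B m. (X k \<omega>)\<^sup>2) * (card (B m) / ((real (Suc m))\<^sup>2)\<^sup>2))" for m
      using sq by (intro integrable_mult_left Bochner_Integration.integrable_sum) 
    show W_int: "integrable M (\<lambda>\<omega>. (W m \<omega>)\<^sup>2)" for m
      by (rule Bochner_Integration.integrable_bound[OF int[of m]]) (use order_trans[OF W abs_ge_self] in auto)
    show "summable (\<lambda>m. expectation (\<lambda>\<omega>. (W m \<omega>)\<^sup>2))"
    proof (rule summable_comparison_test[OF _ sum[of "9 * C"]], intro exI allI impI)
      fix m
      define s where "s = real (Suc m)"
      have s: "1 \<le> s" by (simp add: s_def)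
      have "expectation (\<lambda>\<omega>. (W m \<omega>)\<^sup>2) \<le> expectation (\<lambda>\<omega>. (\<Sum>k\<in>B m. (X k \<omega>)\<^sup>2) * (card (B m) / (s\<^sup>2)\<^sup>2))"
        unfolding s_def by (rule integral_mono[OF W_int int W])
      also have "\<dots> = (\<Sum>k\<in>B m. expectation (\<lambda>\<omega>. (X k \<omega>)\<^sup>2)) * (card (B m) / (s\<^sup>2)\<^sup>2)"
        using sq by simp
      also have "\<dots> \<le> (\<Sum>k\<in>B m. C) * (card (B m) / (s\<^sup>2)\<^sup>2)" by (intro mult_right_mono sum_mono bound) simp
      also have "\<dots> = C * (real (card (B m)))\<^sup>2 / (s\<^sup>2)\<^sup>2" by (simp add: power2_eq_square)
      also have "\<dots> \<le> C * (3 * s)\<^sup>2 / (s\<^sup>2)\<^sup>2"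
      proof (intro divide_right_mono mult_left_mono power_mono \<open>0 \<le> C\<close>)
        have "card (B m) = 2 * Suc m + 1" by (simp add: B_def power2_eq_square)
        then show "real (card (B m)) \<le> 3 * s" by (simp add: s_def)
      qed simp_all
      also have "\<dots> = 9 * C * (1 / s\<^sup>2)" using s by (simp add: power2_eq_square)
      finally show "norm (expectation (\<lambda>\<omega>. (W m \<omega>)\<^sup>2)) \<le> 9 * C * (1 / (real (Suc m))\<^sup>2)"
        unfolding s_def by simp
    qed
  qed
  ultimately show ?thesis
  proof eventually_elim
    case (elim \<omega>)
    show ?case
    proof (intro allI impI)
      fix \<tau> :: real assume "0 < \<tau>"
      have "\<forall>\<^sub>F m in sequentially. \<bar>V m \<omega>\<bar> < \<tau> / 2 \<and> \<bar>W m \<omega>\<bar> < \<tau> / 2"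
        using tendstoD[OF elim(1), of "\<tau> / 2"] tendstoD[OF elim(2), of "\<tau> / 2"] \<open>0 < \<tau>\<close>
        by (intro eventually_conj) (simp_all add: dist_real_def)
      then obtain N where N: "\<And>m. N \<le> m \<Longrightarrow> \<bar>V m \<omega>\<bar> < \<tau> / 2 \<and> \<bar>W m \<omega>\<bar> < \<tau> / 2"
        by (auto simp: eventually_sequentially)
      show "\<forall>\<^sub>F n in sequentially. \<bar>\<Sum>k<n. X k \<omega>\<bar> \<le> \<tau> * real n"
      proof (rule eventually_sequentiallyI[of "(Suc N)\<^sup>2"])
        fix n :: nat assume n: "(Suc N)\<^sup>2 \<le> n"
        \<comment> \<open>\<open>(Suc m)\<^sup>2\<close> will be the last square not above
          \<open>n\<close>, so the indices from there up to \<open>n\<close> lie in the single block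
          \<open>B m\<close>.\<close>
        then have "Suc N \<le> floor_sqrt n" by (rule le_floor_sqrtI)
        then obtain m where m: "floor_sqrt n = Suc m" "N \<le> m" by (cases "floor_sqrt n") auto
        have le: "(Suc m)\<^sup>2 \<le> n" "n < (Suc (Suc m))\<^sup>2"
          using floor_sqrt_power2_le[of n] Suc_floor_sqrt_power2_gt[of n] by (simp_all add: m(1))
        have blocks: "{..<n} = {..<(Suc m)\<^sup>2} \<union> {(Suc m)\<^sup>2..<n}" using le by auto
        have "(\<Sum>k<n. X k \<omega>) = (\<Sum>k<(Suc m)\<^sup>2. X k \<omega>) + (\<Sum>k\<in>{(Suc m)\<^sup>2..<n}. X k \<omega>)"
          unfolding blocks by (rule sum.union_disjoint) auto
        then have "\<bar>\<Sum>k<n. X k \<omega>\<bar> \<le> \<bar>\<Sum>k<(Suc m)\<^sup>2. X k \<omega>\<bar> + (\<Sum>k\<in>{(Suc m)\<^sup>2..<n}. \<bar>X k \<omega>\<bar>)"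
          using abs_triangle_ineq[of "\<Sum>k<(Suc m)\<^sup>2. X k \<omega>" "\<Sum>k\<in>{(Suc m)\<^sup>2..<n}. X k \<omega>"]
            sum_abs[of "\<lambda>k. X k \<omega>" "{(Suc m)\<^sup>2..<n}"] by linarith
        also have "\<dots> \<le> \<bar>\<Sum>k<(Suc m)\<^sup>2. X k \<omega>\<bar> + (\<Sum>k\<in>B m. \<bar>X k \<omega>\<bar>)"
          using le by (intro add_left_mono sum_mono2) (auto simp: B_def)
        also have "\<dots> = (\<bar>V m \<omega>\<bar> + W m \<omega>) * (real (Suc m))\<^sup>2"
          by (simp add: V_def W_def distrib_right)
        also have "\<dots> \<le> \<tau> * (real (Suc m))\<^sup>2"
          using N[OF m(2)] by (intro mult_right_mono) auto
        also have "\<dots> \<le> \<tau> * real n"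
        proof -
          have "real ((Suc m)\<^sup>2) \<le> real n" using le(1) by (rule of_nat_mono)
          then show ?thesis using \<open>0 < \<tau>\<close> by (intro mult_left_mono) simp_all
        qed
        finally show "\<bar>\<Sum>k<n. X k \<omega>\<bar> \<le> \<tau> * real n" .
      qed
    qed
  qed
qed

end

section \<open>Upper strong laws for nonnegative variables\<close>

text \<open>Exchange the sums: \<open>v k\<close> is counted once for each \<open>j\<close> with
  \<open>k < 2 ^ j\<close>, and the geometric series of the weights is at most 4/3 of its first
  term, hence at most \<open>4/3 / (real (Suc k))\<^sup>2\<close>. Kolmogorov's variance condition
  thus controls the averages along powers of two.\<close>

lemma summable_dyadic_averages:
  fixes v :: "nat \<Rightarrow> real"
  assumes nonneg: "\<And>k. 0 \<le> v k" and sum: "summable (\<lambda>k. v k / (real (Suc k))\<^sup>2)"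
  shows "summable (\<lambda>j. (\<Sum>k<2 ^ j. v k) / (2 ^ j)\<^sup>2)"
proof (rule summableI_nonneg_bounded)
  fix J
  have tail: "(\<Sum>j\<in>{j. j < J \<and> k < 2 ^ j}. 1 / ((2::real) ^ j)\<^sup>2) \<le> 4/3 * (1 / (real (Suc k))\<^sup>2)" for k :: nat
  proof -
    define a where "a = (LEAST j. k < 2 ^ j)"
    have a: "k < 2 ^ a" unfolding a_def by (rule LeastI[of _ k]) (rule less_exp)
    have geometric: "(\<Sum>j\<in>{a..<b}. (1/4 :: real) ^ j) \<le> 4/3 * (1/4) ^ a - 4/3 * (1/4) ^ b" if "a \<le> b" for b :: nat
      using that by (induction b rule: dec_induct) auto
    \<comment> \<open>The upper end \<open>max a J\<close> covers the case where \<open>J\<close>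
      lies below \<open>a\<close> and the left sum is empty.\<close>
    have "(\<Sum>j\<in>{j. j < J \<and> k < 2 ^ j}. 1 / ((2::real) ^ j)\<^sup>2) \<le> (\<Sum>j\<in>{a..<max a J}. 1 / ((2::real) ^ j)\<^sup>2)"
      by (intro sum_mono2) (auto simp: a_def intro: Least_le)
    also have "\<dots> = (\<Sum>j\<in>{a..<max a J}. (1/4) ^ j)"
      by (intro sum.cong refl) (simp add: power_one_over power2_eq_square flip: power_mult_distrib)
    also have "\<dots> \<le> 4/3 * (1/4) ^ a - 4/3 * (1/4) ^ max a J" by (rule geometric) simp
    also have "\<dots> \<le> 4/3 * (1/4) ^ a" by simp
    also have "(1/4) ^ a = 1 / ((2::real) ^ a)\<^sup>2"
      by (simp add: power_one_over power2_eq_square flip: power_mult_distrib)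
    also have "4/3 * (1 / ((2::real) ^ a)\<^sup>2) \<le> 4/3 * (1 / (real (Suc k))\<^sup>2)"
    proof -
      have "real (Suc k) \<le> real (2 ^ a)" using a by (intro of_nat_mono) simp
      then show ?thesis by (intro mult_left_mono divide_left_mono power_mono) auto
    qed
    finally show ?thesis .
  qed
  have "(\<Sum>j<J. (\<Sum>k<2 ^ j. v k) / (2 ^ j)\<^sup>2) = (\<Sum>j<J. \<Sum>k<2 ^ J. if k < 2 ^ j then v k / (2 ^ j)\<^sup>2 else 0)"
  proof (intro sum.cong refl)
    fix j assume "j \<in> {..<J}"
    then have le: "(2::nat) ^ j \<le> 2 ^ J" by (intro power_increasing) auto
    have "(\<Sum>k<2 ^ J. if k < 2 ^ j then v k / (2 ^ j)\<^sup>2 else 0) = (\<Sum>k\<in>{..<2 ^ J} \<inter> {k. k < 2 ^ j}. v k / (2 ^ j)\<^sup>2)"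
      by (simp add: sum.If_cases)
    also have "{..<2 ^ J} \<inter> {k. k < 2 ^ j} = {..<(2::nat) ^ j}" using less_le_trans[OF _ le] by auto
    finally show "(\<Sum>k<2 ^ j. v k) / (2 ^ j)\<^sup>2 = (\<Sum>k<2 ^ J. if k < 2 ^ j then v k / (2 ^ j)\<^sup>2 else 0)"
      by (simp add: sum_divide_distrib)
  qed
  also have "\<dots> = (\<Sum>k<2 ^ J. \<Sum>j<J. if k < 2 ^ j then v k / (2 ^ j)\<^sup>2 else 0)" by (rule sum.swap)
  also have "\<dots> = (\<Sum>k<2 ^ J. v k * (\<Sum>j\<in>{j. j < J \<and> k < 2 ^ j}. 1 / ((2::real) ^ j)\<^sup>2))"
  proof (intro sum.cong refl)
    fix k :: nat
    have "{..<J} \<inter> {j. k < 2 ^ j} = {j. j < J \<and> k < 2 ^ j}" by auto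
    then show "(\<Sum>j<J. if k < 2 ^ j then v k / (2 ^ j)\<^sup>2 else 0) = v k * (\<Sum>j\<in>{j. j < J \<and> k < 2 ^ j}. 1 / ((2::real) ^ j)\<^sup>2)"
      by (simp add: sum.If_cases sum_distrib_left)
  qed
  also have "\<dots> \<le> (\<Sum>k<2 ^ J. v k * (4/3 * (1 / (real (Suc k))\<^sup>2)))"
    by (intro sum_mono mult_left_mono tail nonneg)
  also have "\<dots> = 4/3 * (\<Sum>k<2 ^ J. v k / (real (Suc k))\<^sup>2)"
    unfolding sum_distrib_left by (intro sum.cong refl) simp
  also have "\<dots> \<le> 4/3 * (\<Sum>k. v k / (real (Suc k))\<^sup>2)"
    by (intro mult_left_mono sum_le_suminf sum) (auto simp: nonneg)
  finally show "(\<Sum>j<J. (\<Sum>k<2 ^ j. v k) / (2 ^ j)\<^sup>2) \<le> 4/3 * (\<Sum>k. v k / (real (Suc k))\<^sup>2)" .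
qed (auto intro!: divide_nonneg_nonneg sum_nonneg nonneg)

context prob_space
begin

text \<open>For nonnegative variables the averages along \<open>n = 2\<^sup>j\<close> control all averages up to a factor 2.\<close>

lemma AE_average_upper_bound:
  fixes Z :: "nat \<Rightarrow> 'a \<Rightarrow> real"
  assumes indep: "indep_vars (\<lambda>_. borel) Z UNIV" and nonneg: "\<And>k \<omega>. 0 \<le> Z k \<omega>"
    and sq: "\<And>k. integrable M (\<lambda>\<omega>. (Z k \<omega>)\<^sup>2)"
    and sum: "summable (\<lambda>k. variance (Z k) / (real (Suc k))\<^sup>2)"
  shows "AE \<omega> in M. \<forall>c e. 0 < e \<longrightarrow> (\<forall>\<^sub>F n in sequentially. (\<Sum>k<n. expectation (Z k)) \<le> c * real n) \<longrightarrow>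
    (\<forall>\<^sub>F n in sequentially. (\<Sum>k<n. Z k \<omega>) \<le> (2 * c + e) * real n)"
proof -
  have rv: "Z k \<in> borel_measurable M" for k using indep by (auto simp: indep_vars_def)
  have int: "integrable M (Z k)" for k by (rule integrable_of_square_integrable[OF rv sq])
  define X where "X k \<omega> = Z k \<omega> - expectation (Z k)" for k \<omega>
  have X_indep: "indep_vars (\<lambda>_. borel) X UNIV"
    unfolding X_def by (rule indep_vars_compose2[OF indep]) simp
  have X_mean: "expectation (X k) = 0" for k unfolding X_def using int by (simp add: prob_space)
  have X_sq: "integrable M (\<lambda>\<omega>. (X k \<omega>)\<^sup>2)" for k
    unfolding X_def power2_diff using sq int by simp
  define V where "V j \<omega> = (\<Sum>k<2 ^ j. X k \<omega>) / 2 ^ j" for j \<omega>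
  have "AE \<omega> in M. (\<lambda>j. V j \<omega>) \<longlonglongrightarrow> 0"
  proof (rule AE_tendsto_0_if_summable_second_moment)
    note moment = indep_sum_second_moment[OF X_indep X_mean X_sq]
    have V: "(V j \<omega>)\<^sup>2 = (\<Sum>k<2 ^ j. X k \<omega>)\<^sup>2 / (2 ^ j)\<^sup>2" for j \<omega>
      by (simp add: V_def power_divide)
    show "integrable M (\<lambda>\<omega>. (V j \<omega>)\<^sup>2)" for j unfolding V using moment[of "{..<2 ^ j}"] by simp
    have "expectation (\<lambda>\<omega>. (V j \<omega>)\<^sup>2) = (\<Sum>k<2 ^ j. variance (Z k)) / (2 ^ j)\<^sup>2" for j
      unfolding V using moment[of "{..<2 ^ j}"] by (simp add: X_def)
    then show "summable (\<lambda>j. expectation (\<lambda>\<omega>. (V j \<omega>)\<^sup>2))"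
      using summable_dyadic_averages[OF variance_positive sum] by simp
  qed
  then show ?thesis
  proof eventually_elim
    case (elim \<omega>)
    show ?case
    proof (intro allI impI)
      fix c e :: real assume "0 < e" and c: "\<forall>\<^sub>F n in sequentially. (\<Sum>k<n. expectation (Z k)) \<le> c * real n"
      then obtain N1 where N1: "\<And>n. N1 \<le> n \<Longrightarrow> (\<Sum>k<n. expectation (Z k)) \<le> c * real n"
        by (auto simp: eventually_sequentially)
      have "\<forall>\<^sub>F j in sequentially. \<bar>V j \<omega>\<bar> < e / 2"
        using tendstoD[OF elim, of "e / 2"] \<open>0 < e\<close> by (simp add: dist_real_def)
      then obtain N2 where N2: "\<And>j. N2 \<le> j \<Longrightarrow> \<bar>V j \<omega>\<bar> < e / 2"
        by (auto simp: eventually_sequentially)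
      show "\<forall>\<^sub>F n in sequentially. (\<Sum>k<n. Z k \<omega>) \<le> (2 * c + e) * real n"
      proof (rule eventually_sequentiallyI[of "max 1 (max N1 (2 ^ N2))"])
        fix n :: nat assume n: "max 1 (max N1 (2 ^ N2)) \<le> n"
        \<comment> \<open>The least power of two above \<open>n\<close>; it is at most
          \<open>2 * n\<close>, which is where the factor 2 originates.\<close>
        define j where "j = Suc (floor_log n)"
        have j: "n < 2 ^ j" "2 ^ j \<le> 2 * n"
          using floor_log_exp2_gt[of n] floor_log_exp2_le[of n] n by (auto simp: j_def)
        have "N2 \<le> j"
        proof (rule ccontr)
          assume "\<not> N2 \<le> j"
          then have "(2::nat) ^ j \<le> 2 ^ N2" by (intro power_increasing) auto
          moreover have "2 ^ N2 \<le> n" using n by simp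
          ultimately show False using j(1) by linarith
        qed
        have "(\<Sum>k<n. Z k \<omega>) \<le> (\<Sum>k<2 ^ j. Z k \<omega>)"
          using j nonneg by (intro sum_mono2) auto
        also have "\<dots> = (\<Sum>k<2 ^ j. expectation (Z k)) + V j \<omega> * 2 ^ j"
          by (simp add: V_def X_def sum_subtractf)
        also have "\<dots> \<le> c * real (2 ^ j) + e / 2 * 2 ^ j"
          using N1[of "2 ^ j"] N2[OF \<open>N2 \<le> j\<close>] j n by (intro add_mono mult_right_mono) auto
        also have "\<dots> = (c + e / 2) * real (2 ^ j)" by (simp add: distrib_right)
        also have "\<dots> \<le> (c + e / 2) * real (2 * n)"
        proof (rule mult_left_mono)
          \<comment> \<open>Nonnegative expectations force \<open>c\<close> to be nonnegative, so
            that replacing \<open>2 ^ j\<close> by \<open>2 * n\<close> enlarges the bound.\<close>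
          have "0 \<le> (\<Sum>k<n. expectation (Z k))" using nonneg by (intro sum_nonneg Bochner_Integration.integral_nonneg) auto
          then have "0 \<le> c * real n" using N1[of n] n by simp
          then have "0 \<le> c" using n by (simp add: zero_le_mult_iff)
          then show "0 \<le> c + e / 2" using \<open>0 < e\<close> by simp
        qed (use j(2) of_nat_mono in blast)
        finally show "(\<Sum>k<n. Z k \<omega>) \<le> (2 * c + e) * real n" by (simp add: algebra_simps)
      qed
    qed
  qed
qed

end

text \<open>The terms vanish until \<open>k + 1\<close> reaches \<open>z\<close>, and from there on
  the series of inverse squares is of order \<open>1 / z\<close>. After taking expectations it
  bounds the weighted variances of truncated variables by a first moment.\<close>

lemma sum_truncated_squares_le:
  fixes z :: real
  assumes "0 \<le> z"
  shows "(\<Sum>k<n. (if z \<le> real (Suc k) then z else 0)\<^sup>2 / (real (Suc k))\<^sup>2) \<le> 2 * z"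
proof -
  \<comment> \<open>Strengthened for the induction: the correction \<open>z\<^sup>2 / real n\<close>
    leaves room for the later terms, since \<open>1 / m\<^sup>2\<close> is at most
    \<open>1 / (m - 1) - 1 / m\<close>.\<close>
  have "(\<Sum>k<n. (if z \<le> real (Suc k) then z else 0)\<^sup>2 / (real (Suc k))\<^sup>2)
      \<le> (if z \<le> real n \<and> 0 < n then 2 * z - z\<^sup>2 / real n else 0)"
  proof (induction n)
    case (Suc n)
    let ?f = "\<lambda>k. (if z \<le> real (Suc k) then z else 0)\<^sup>2 / (real (Suc k))\<^sup>2"
    define m where "m = real (Suc n)"
    have m: "1 \<le> m" "real n = m - 1" by (auto simp: m_def)
    have cases: "z > m \<or> (z \<le> m \<and> \<not> (z \<le> real n \<and> 0 < n)) \<or> (z \<le> real n \<and> 0 < n)" by linarith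
    note IH = Suc
    have split: "(\<Sum>k<Suc n. ?f k) = (\<Sum>k<n. ?f k) + ?f n" by simp
    have f: "?f n = (if z \<le> m then z\<^sup>2 / m\<^sup>2 else 0)" unfolding m_def by simp
    have "(\<Sum>k<Suc n. ?f k) \<le> (if z \<le> m then 2 * z - z\<^sup>2 / m else 0)"
      using cases
    proof (elim disjE; (elim conjE)?)
      assume 1: "z > m"
      have "\<not> z \<le> real n" using 1 m(2) by linarith
      then show ?thesis using IH 1 unfolding split f by simp
    next
      \<comment> \<open>The first term that can be nonzero enters here; both \<open>z / m\<close>
        and \<open>1 / m\<close> are at most 1.\<close>
      assume 2: "z \<le> m" "\<not> (z \<le> real n \<and> 0 < n)"
      then have "(\<Sum>k<n. ?f k) \<le> 0" using IH by (simp only: if_False)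
      moreover have "z\<^sup>2 / m\<^sup>2 \<le> 2 * z - z\<^sup>2 / m"
      proof -
        have "z\<^sup>2 / m\<^sup>2 + z\<^sup>2 / m = z * (z / m) * (1 / m + 1)"
          using m(1) by (simp add: power2_eq_square field_simps)
        also have "\<dots> \<le> z * 1 * (1 + 1)"
          using assms 2 m(1) by (intro mult_mono add_mono) (auto simp: field_simps)
        finally show ?thesis by simp
      qed
      ultimately show ?thesis using 2 unfolding split f by simp
    next
      assume 3: "z \<le> real n" "0 < n"
      then have "(\<Sum>k<n. ?f k) \<le> 2 * z - z\<^sup>2 / (m - 1)" using IH unfolding m(2)[symmetric] by simp
      moreover have "z \<le> m" "1 < m" using 3 m(2) by linarith+
      moreover have "z\<^sup>2 / m\<^sup>2 + z\<^sup>2 / m \<le> z\<^sup>2 / (m - 1)"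
      proof -
        have "1 / m\<^sup>2 + 1 / m \<le> 1 / (m - 1)" using \<open>1 < m\<close> by (simp add: power2_eq_square field_simps)
        then have "z\<^sup>2 * (1 / m\<^sup>2 + 1 / m) \<le> z\<^sup>2 * (1 / (m - 1))" by (intro mult_left_mono) auto
        then show ?thesis by (simp add: distrib_left)
      qed
      ultimately show ?thesis unfolding split f by simp
    qed
    then show ?case unfolding m_def by simp
  qed simp
  also have "\<dots> \<le> 2 * z" using assms by simp
  finally show ?thesis .
qed

text \<open>After taking expectations, the tail probabilities of \<open>z\<close> at the positive
  integers sum to at most its mean.\<close>

lemma count_less_le:
  fixes z :: real
  assumes "0 \<le> z"
  shows "(\<Sum>k<n. if real (Suc k) < z then 1 else 0) \<le> z"
proof -
  have "(\<Sum>k<n. if real (Suc k) < z then 1 else 0) \<le> min (real n) z"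
    by (induction n) (use assms in \<open>auto split: if_splits\<close>)
  then show ?thesis by simp
qed

context prob_space
begin

text \<open>Kolmogorov's truncation at level \<open>k + 1\<close>, with a first moment only. The
  truncated variables satisfy the variance condition, and by Borel-Cantelli only finitely many of
  them differ from the original ones.\<close>

lemma AE_average_upper_bound_iid:
  fixes Z :: "nat \<Rightarrow> 'a \<Rightarrow> real"
  assumes indep: "indep_vars (\<lambda>_. borel) Z UNIV" and nonneg: "\<And>k \<omega>. 0 \<le> Z k \<omega>"
    and distr: "\<And>k. distr M borel (Z k) = distr M borel (Z 0)" and int: "integrable M (Z 0)"
  shows "AE \<omega> in M. \<forall>e>0. \<forall>\<^sub>F n in sequentially. (\<Sum>k<n. Z k \<omega>) \<le> (2 * expectation (Z 0) + e) * real n"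
proof -
  have rv [measurable]: "Z k \<in> borel_measurable M" for k using indep by (auto simp: indep_vars_def)
  have transfer: "expectation (\<lambda>\<omega>. f (Z k \<omega>)) = expectation (\<lambda>\<omega>. f (Z 0 \<omega>))"
    if [measurable]: "f \<in> borel_measurable borel" for f :: "real \<Rightarrow> real" and k
    using integral_distr[OF rv that, of k] integral_distr[OF rv that, of 0] distr[of k] by simp
  define t where "t k z = (if z \<le> real (Suc k) then z else 0)" for k and z :: real
  have t_meas [measurable]: "t k \<in> borel_measurable borel" for k unfolding t_def by measurable
  define T where "T k \<omega> = t k (Z k \<omega>)" for k \<omega>
  have T_meas [measurable]: "T k \<in> borel_measurable M" for k unfolding T_def by measurable
  have t_bounds: "0 \<le> t k (Z j \<omega>)" "t k (Z j \<omega>) \<le> Z j \<omega>" "t k (Z j \<omega>) \<le> real (Suc k)" for k j \<omega>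
    using nonneg[of j \<omega>] by (auto simp: t_def)
  have t_sq_int: "integrable M (\<lambda>\<omega>. (t k (Z j \<omega>))\<^sup>2)" for k j
    by (rule integrable_const_bound[of _ "(real (Suc k))\<^sup>2"])
       (use t_bounds in \<open>auto intro!: power_mono simp del: of_nat_Suc\<close>)
  have t_int: "integrable M (\<lambda>\<omega>. t k (Z j \<omega>))" for k j
    by (rule integrable_of_square_integrable[OF _ t_sq_int]) measurable
  have "AE \<omega> in M. \<forall>c e. 0 < e \<longrightarrow> (\<forall>\<^sub>F n in sequentially. (\<Sum>k<n. expectation (T k)) \<le> c * real n) \<longrightarrow>
    (\<forall>\<^sub>F n in sequentially. (\<Sum>k<n. T k \<omega>) \<le> (2 * c + e) * real n)"
  proof (rule AE_average_upper_bound)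
    show "indep_vars (\<lambda>_. borel) T UNIV" unfolding T_def by (rule indep_vars_compose2[OF indep]) simp
    show "0 \<le> T k \<omega>" for k \<omega> unfolding T_def by (rule t_bounds)
    show sq: "integrable M (\<lambda>\<omega>. (T k \<omega>)\<^sup>2)" for k unfolding T_def by (rule t_sq_int)
    show "summable (\<lambda>k. variance (T k) / (real (Suc k))\<^sup>2)"
    proof (rule summableI_nonneg_bounded)
      fix n
      have "variance (T k) \<le> expectation (\<lambda>\<omega>. (t k (Z 0 \<omega>))\<^sup>2)" for k
      proof -
        have "variance (T k) = expectation (\<lambda>\<omega>. (T k \<omega>)\<^sup>2) - (expectation (T k))\<^sup>2"
          by (rule variance_eq) (use sq t_int in \<open>simp_all add: T_def\<close>)
        also have "\<dots> \<le> expectation (\<lambda>\<omega>. (T k \<omega>)\<^sup>2)" by simp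
        also have "\<dots> = expectation (\<lambda>\<omega>. (t k (Z 0 \<omega>))\<^sup>2)" unfolding T_def by (rule transfer) measurable
        finally show ?thesis .
      qed
      then have "(\<Sum>k<n. variance (T k) / (real (Suc k))\<^sup>2)
          \<le> (\<Sum>k<n. expectation (\<lambda>\<omega>. (t k (Z 0 \<omega>))\<^sup>2) / (real (Suc k))\<^sup>2)"
        by (intro sum_mono divide_right_mono) auto
      also have "\<dots> = expectation (\<lambda>\<omega>. \<Sum>k<n. (t k (Z 0 \<omega>))\<^sup>2 / (real (Suc k))\<^sup>2)"
        using t_sq_int by (subst Bochner_Integration.integral_sum) auto
      also have "\<dots> \<le> expectation (\<lambda>\<omega>. 2 * Z 0 \<omega>)"
      proof (rule integral_mono)
        show "integrable M (\<lambda>\<omega>. \<Sum>k<n. (t k (Z 0 \<omega>))\<^sup>2 / (real (Suc k))\<^sup>2)"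
          using t_sq_int by (intro Bochner_Integration.integrable_sum) auto
        show "(\<Sum>k<n. (t k (Z 0 \<omega>))\<^sup>2 / (real (Suc k))\<^sup>2) \<le> 2 * Z 0 \<omega>" for \<omega>
          unfolding t_def by (rule sum_truncated_squares_le[OF nonneg])
      qed (use int in simp)
      finally show "(\<Sum>k<n. variance (T k) / (real (Suc k))\<^sup>2) \<le> expectation (\<lambda>\<omega>. 2 * Z 0 \<omega>)" .
    qed (auto intro!: divide_nonneg_nonneg variance_positive)
  qed
  moreover have "AE \<omega> in M. \<forall>\<^sub>F k in sequentially. \<omega> \<in> space M - {\<omega> \<in> space M. real (Suc k) < Z k \<omega>}"
  proof (rule borel_cantelli_AE1)
    have prob: "prob {\<omega> \<in> space M. real (Suc k) < Z k \<omega>} = expectation (\<lambda>\<omega>. if real (Suc k) < Z 0 \<omega> then 1 else 0)" for k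
    proof -
      have "prob {\<omega> \<in> space M. real (Suc k) < Z k \<omega>} = expectation (indicator {\<omega> \<in> space M. real (Suc k) < Z k \<omega>})"
        by simp
      also have "\<dots> = expectation (\<lambda>\<omega>. (\<lambda>z. if real (Suc k) < z then 1 else 0) (Z k \<omega>))"
        by (intro Bochner_Integration.integral_cong) auto
      also have "\<dots> = expectation (\<lambda>\<omega>. (\<lambda>z. if real (Suc k) < z then 1 else 0) (Z 0 \<omega>))"
        by (rule transfer) measurable
      finally show ?thesis .
    qed
    have int1: "integrable M (\<lambda>\<omega>. if real (Suc k) < Z 0 \<omega> then 1 else (0::real))" for k
      by (rule integrable_const_bound[of _ 1]) auto
    show "summable (\<lambda>k. prob {\<omega> \<in> space M. real (Suc k) < Z k \<omega>})"
    proof (rule summableI_nonneg_bounded)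
      fix n
      have "(\<Sum>k<n. prob {\<omega> \<in> space M. real (Suc k) < Z k \<omega>}) = expectation (\<lambda>\<omega>. \<Sum>k<n. if real (Suc k) < Z 0 \<omega> then 1 else 0)"
        unfolding prob by (rule Bochner_Integration.integral_sum[symmetric]) (rule int1)
      also have "\<dots> \<le> expectation (Z 0)"
        by (intro integral_mono Bochner_Integration.integrable_sum int1 int count_less_le nonneg)
      finally show "(\<Sum>k<n. prob {\<omega> \<in> space M. real (Suc k) < Z k \<omega>}) \<le> expectation (Z 0)" .
    qed simp
    show "emeasure M {\<omega> \<in> space M. real (Suc k) < Z k \<omega>} < \<infinity>" for k
      using emeasure_finite by (simp add: top.not_eq_extremum[symmetric])
  qed measurable
  ultimately show ?thesis
  proof eventually_elim
    case (elim \<omega>)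
    from elim(2) obtain N where "\<forall>k\<ge>N. \<omega> \<in> space M - {\<omega> \<in> space M. real (Suc k) < Z k \<omega>}"
      unfolding eventually_sequentially by (rule exE)
    then have N: "Z k \<omega> = T k \<omega>" if "N \<le> k" for k
      using that by (auto simp: T_def t_def not_less)
    show ?case
    proof (intro allI impI)
      fix e :: real assume "0 < e"
      have "expectation (T k) \<le> expectation (Z 0)" for k
      proof -
        have "expectation (T k) = expectation (\<lambda>\<omega>. t k (Z 0 \<omega>))" unfolding T_def by (rule transfer) measurable
        also have "\<dots> \<le> expectation (Z 0)" by (intro integral_mono t_int int t_bounds)
        finally show ?thesis .
      qed
      then have "(\<Sum>k<n. expectation (T k)) \<le> expectation (Z 0) * real n" for n
        using sum_bounded_above[of "{..<n}" "\<lambda>k. expectation (T k)" "expectation (Z 0)"] by (simp add: mult.commute)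
      then have 1: "\<forall>\<^sub>F n in sequentially. (\<Sum>k<n. T k \<omega>) \<le> (2 * expectation (Z 0) + e / 2) * real n"
        using elim(1) \<open>0 < e\<close> by (auto intro!: always_eventually)
      \<comment> \<open>The total effect of truncation. Its terms are nonnegative and vanish from
        \<open>N\<close> on, so \<open>D\<close> bounds every partial sum and is eventually below
        \<open>e / 2 * real n\<close>.\<close>
      define D where "D = (\<Sum>k<N. Z k \<omega> - T k \<omega>)"
      have D: "(\<Sum>k<n. Z k \<omega>) \<le> (\<Sum>k<n. T k \<omega>) + D" for n
      proof -
        have "(\<Sum>k<n. Z k \<omega> - T k \<omega>) \<le> D"
        proof (cases "n \<le> N")
          case True
          then show ?thesis unfolding D_def T_def using t_bounds by (intro sum_mono2) auto
        next
          case False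
          then have "(\<Sum>k<n. Z k \<omega> - T k \<omega>) = D"
            unfolding D_def using N by (intro sum.mono_neutral_right) auto
          then show ?thesis by simp
        qed
        then show ?thesis by (simp add: sum_subtractf)
      qed
      have "\<forall>\<^sub>F n in sequentially. D / (e / 2) \<le> real n"
        using filterlim_real_sequentially by (auto simp: filterlim_at_top)
      with 1 show "\<forall>\<^sub>F n in sequentially. (\<Sum>k<n. Z k \<omega>) \<le> (2 * expectation (Z 0) + e) * real n"
      proof eventually_elim
        case (elim n)
        have "D \<le> e / 2 * real n" using elim(2) \<open>0 < e\<close> by (simp add: field_simps)
        then have "(\<Sum>k<n. Z k \<omega>) \<le> (2 * expectation (Z 0) + e / 2) * real n + e / 2 * real n"
          using D[of n] elim(1) by linarith
        then show ?case by (simp add: algebra_simps)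
      qed
    qed
  qed
qed

end

section \<open>The design\<close>

definition visits :: "(nat \<Rightarrow> 'a) \<Rightarrow> nat \<Rightarrow> 'a set \<Rightarrow> real" where
  "visits x n A = real (card {k. k < n \<and> x k \<in> A})"

lemma visits_eq_sum: "visits x n A = (\<Sum>k<n. indicator A (x k))"
proof -
  have "{k. k < n \<and> x k \<in> A} = {..<n} \<inter> {k. x k \<in> A}" by auto
  then show ?thesis by (simp add: visits_def indicator_def of_bool_def sum.If_cases)
qed

lemma visits_Un_Int: "visits x n (A \<union> B) = visits x n A + visits x n B - visits x n (A \<inter> B)"
  unfolding visits_eq_sum sum.distrib[symmetric] sum_subtractf[symmetric]
  by (intro sum.cong) (auto simp: indicator_def)

lemma visits_mono: "A \<subseteq> B \<Longrightarrow> visits x n A \<le> visits x n B"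
  unfolding visits_def by (intro of_nat_mono card_mono) auto

lemma visits_Compl: "visits x n (- A) = real n - visits x n A"
proof -
  have "visits x n UNIV = visits x n A + visits x n (- A)"
    using visits_Un_Int[of x n A "- A"] by (simp add: visits_def)
  then show ?thesis by (simp add: visits_def)
qed

text \<open>The boundary of a convex set is Lebesgue null, hence null for \<nu>.\<close>

lemma emeasure_interior_eq:
  fixes S :: "'a::euclidean_space set"
  assumes \<nu>: "sets \<nu> = sets borel" "same_null_sets_on S \<nu>" and S: "closed S" "convex S"
  shows "emeasure \<nu> (interior S) = emeasure \<nu> S"
proof -
  have borel: "S \<in> sets borel" "interior S \<in> sets borel" using S by auto
  have "negligible (S - interior S)"
    using negligible_convex_frontier[OF S(2)] by (rule negligible_subset) (auto simp: frontier_def closure_closed[OF S(1)])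
  then have "S - interior S \<in> null_sets lebesgue" by (simp add: negligible_iff_null_sets)
  moreover have "S - interior S \<in> sets lborel" unfolding sets_lborel using borel by (rule sets.Diff)
  ultimately have "S - interior S \<in> null_sets lborel" by (simp only: null_sets_completion_iff)
  then have "emeasure lborel (S - interior S) = 0" by (rule null_setsD1)
  moreover have "emeasure \<nu> (S - interior S) = 0 \<longleftrightarrow> emeasure lborel (S - interior S) = 0"
    by (rule \<nu>(2)[unfolded same_null_sets_on_def, rule_format]) (use borel in auto)
  ultimately have "emeasure \<nu> (S - interior S) = 0" by simp
  then have "emeasure \<nu> (interior S \<union> (S - interior S)) = emeasure \<nu> (interior S)"
    using borel \<nu>(1) by (intro emeasure_Un_null_set) auto
  also have "interior S \<union> (S - interior S) = S" using interior_subset by blast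
  finally show ?thesis by simp
qed

lemma emeasure_open_pos:
  fixes S :: "'a::euclidean_space set"
  assumes "same_null_sets_on S \<nu>" "open U" "U \<noteq> {}" "U \<subseteq> S"
  shows "emeasure \<nu> U \<noteq> 0"
proof
  assume "emeasure \<nu> U = 0"
  then have "emeasure lborel U = 0" using assms unfolding same_null_sets_on_def by auto
  then have "U \<in> null_sets lborel" using assms(2) by auto
  then have "negligible U" unfolding negligible_iff_null_sets by (rule null_sets_completionI)
  then show False using open_not_negligible assms(2,3) by blast
qed

text \<open>Inclusion-exclusion for one box \<open>B\<close> against the rest \<open>G\<close>: the
  overlap is the union of the traces of \<open>G\<close> on \<open>B\<close>, which are again boxes
  and at most as many as \<open>G\<close>. Both smaller families are reached by induction on the
  cardinality; the traces need not belong to \<open>F\<close>, so induction on the set would not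
  do.\<close>

lemma visits_union_boxes:
  fixes x :: "nat \<Rightarrow> 'a::euclidean_space"
  assumes "finite_measure \<nu>" "sets \<nu> = sets borel"
    and lim: "\<And>a b. box a b \<subseteq> U \<Longrightarrow> (\<lambda>n. visits x n (box a b) / real n) \<longlonglongrightarrow> measure \<nu> (box a b)"
    and F: "finite F" "\<And>A. A \<in> F \<Longrightarrow> A \<subseteq> U \<and> (\<exists>a b. A = box a b)"
  shows "(\<lambda>n. visits x n (\<Union>F) / real n) \<longlonglongrightarrow> measure \<nu> (\<Union>F)"
  using F
proof (induction "card F" arbitrary: F rule: less_induct)
  case less
  interpret finite_measure \<nu> by fact
  show ?case
  proof (cases "F = {}")
    case True
    then show ?thesis by (simp add: visits_def)
  next
    case False
    then obtain B where B: "B \<in> F" by blast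
    define G where "G = F - {B}"
    define H where "H = (\<lambda>A. A \<inter> B) ` G"
    have G: "finite G" "card G < card F" using less.prems(1) card_Diff1_less[OF less.prems(1) B] by (simp_all add: G_def)
    have H: "finite H" "card H < card F" unfolding H_def using G(1) le_less_trans[OF card_image_le[OF G(1)] G(2)] by simp_all
    obtain c d where cd: "B = box c d" using less.prems(2)[OF B] by blast
    have boxH: "A \<subseteq> U \<and> (\<exists>a b. A = box a b)" if A: "A \<in> H" for A
    proof -
      obtain A' where A': "A' \<in> F" "A = A' \<inter> B" using A by (auto simp: H_def G_def)
      obtain a b where "A' = box a b" using less.prems(2)[OF A'(1)] by blast
      then have eq: "A = box a b \<inter> box c d" using A'(2) cd by simp
      have "\<exists>a b. A = box a b" unfolding eq box_Int_box by blast
      then show ?thesis using less.prems(2)[OF A'(1)] A'(2) by blast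
    qed
    have 1: "(\<lambda>n. visits x n (\<Union>G) / real n) \<longlonglongrightarrow> measure \<nu> (\<Union>G)"
      using G less.prems(2) by (intro less.hyps) (auto simp: G_def)
    have 2: "(\<lambda>n. visits x n (\<Union>H) / real n) \<longlonglongrightarrow> measure \<nu> (\<Union>H)"
      using H boxH by (intro less.hyps) auto
    have 3: "(\<lambda>n. visits x n B / real n) \<longlonglongrightarrow> measure \<nu> B"
      using less.prems(2)[OF B] lim by auto
    have UF: "\<Union>F = \<Union>G \<union> B" "\<Union>G \<inter> B = \<Union>H" using B by (auto simp: G_def H_def)
    have "open A" if "A \<in> G" for A using less.prems(2)[of A] that by (auto simp: G_def)
    then have "open (\<Union>G)" by (intro open_Union) blast
    then have "\<Union>G \<in> sets \<nu>" "B \<in> sets \<nu>" using assms(2) cd by simp_all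
    then have "measure \<nu> (\<Union>F) = measure \<nu> (\<Union>G) + measure \<nu> B - measure \<nu> (\<Union>G \<inter> B)"
      unfolding UF(1) by (intro measure_Un3) (simp_all add: fmeasurable_eq_sets)
    then have "measure \<nu> (\<Union>F) = measure \<nu> (\<Union>G) + measure \<nu> B - measure \<nu> (\<Union>H)"
      unfolding UF(2) .
    moreover have "visits x n (\<Union>F) / real n = visits x n (\<Union>G) / real n + visits x n B / real n - visits x n (\<Union>H) / real n" for n
      unfolding UF(1) visits_Un_Int UF(2) by (simp add: add_divide_distrib diff_divide_distrib)
    ultimately show ?thesis using tendsto_diff[OF tendsto_add[OF 1 3] 2] by simp
  qed
qed

lemma measure_exhaustion:
  fixes U :: "'a::euclidean_space set"
  assumes \<nu>: "finite_measure \<nu>" "sets \<nu> = sets borel" and "open U" "0 < \<eta>"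
  shows "\<exists>K. compact K \<and> K \<subseteq> U \<and> measure \<nu> U - \<eta> < measure \<nu> K"
proof -
  interpret finite_measure \<nu> by fact
  obtain C where C: "\<And>n. compact (C n)" "\<And>n. C n \<subseteq> U" "\<And>n. C n \<subseteq> interior (C (Suc n))" "\<Union>(range C) = U"
    "\<And>K. compact K \<Longrightarrow> K \<subseteq> U \<Longrightarrow> \<exists>N. \<forall>n\<ge>N. K \<subseteq> C n"
    by (rule open_Union_compact_subsets[OF \<open>open U\<close>]) (rule that; assumption)
  have "(\<lambda>n. measure \<nu> (C n)) \<longlonglongrightarrow> measure \<nu> (\<Union>(range C))"
  proof (rule finite_Lim_measure_incseq)
    show "range C \<subseteq> sets \<nu>" using C(1) \<nu>(2) by (auto intro: borel_closed compact_imp_closed)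
    show "incseq C" using C(3) interior_subset by (intro incseq_SucI) blast
  qed
  then have "(\<lambda>n. measure \<nu> (C n)) \<longlonglongrightarrow> measure \<nu> U" unfolding C(4) .
  then have "\<forall>\<^sub>F n in sequentially. measure \<nu> U - \<eta> < measure \<nu> (C n)"
    using \<open>0 < \<eta>\<close> by (intro order_tendstoD(1)) auto
  then obtain n where "measure \<nu> U - \<eta> < measure \<nu> (C n)"
    by (auto simp: eventually_sequentially)
  then show ?thesis using C(1,2) by blast
qed

text \<open>An open set contains an open box of positive measure, and half of that measure serves as
  \<open>c\<close>. For tightness, a compact set of measure above 1 - \<eta> is covered by finitely
  many open boxes, whose union has a known limiting frequency.\<close>

lemma
  fixes x :: "nat \<Rightarrow> 'a::euclidean_space"
  assumes fd: "fixed_design S x" and S: "closed S" "convex S"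
  shows fixed_design_dense: "open U \<Longrightarrow> U \<noteq> {} \<Longrightarrow> U \<subseteq> interior S \<Longrightarrow>
      \<exists>c>0. \<forall>\<^sub>F n in sequentially. c * real n \<le> visits x n U"
    and fixed_design_tight: "0 < \<eta> \<Longrightarrow>
      \<exists>K. compact K \<and> K \<subseteq> interior S \<and> (\<forall>\<^sub>F n in sequentially. visits x n (- K) \<le> \<eta> * real n)"
proof -
  from fd obtain \<nu> where \<nu>: "sets \<nu> = sets borel" "prob_space \<nu>" "measure \<nu> S = 1" "same_null_sets_on S \<nu>"
    and lim: "\<And>a b. box a b \<subseteq> interior S \<Longrightarrow> (\<lambda>n. visits x n (box a b) / real n) \<longlonglongrightarrow> measure \<nu> (box a b)"
    unfolding fixed_design_def visits_def by blast
  interpret prob_space \<nu> by fact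
  show "\<exists>c>0. \<forall>\<^sub>F n in sequentially. c * real n \<le> visits x n U"
    if U: "open U" "U \<noteq> {}" "U \<subseteq> interior S"
  proof -
    obtain p where p: "p \<in> U" using U(2) by blast
    obtain a b where ab: "cbox a b \<subseteq> U" "p \<in> box a b" by (rule open_contains_cbox[OF U(1) p])
    then have sub: "box a b \<subseteq> U" using box_subset_cbox by blast
    define q where "q = measure \<nu> (box a b)"
    have "box a b \<subseteq> S" using sub U(3) interior_subset by blast
    then have "emeasure \<nu> (box a b) \<noteq> 0" using ab(2) by (intro emeasure_open_pos[OF \<nu>(4) open_box]) auto
    then have q: "0 < q" by (simp add: q_def emeasure_eq_measure less_le)
    have "box a b \<subseteq> interior S" using sub U(3) by (rule subset_trans)
    then have "\<forall>\<^sub>F n in sequentially. q / 2 < visits x n (box a b) / real n"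
      using q by (intro order_tendstoD(1)[OF lim]) (auto simp: q_def)
    then have "\<forall>\<^sub>F n in sequentially. q / 2 * real n \<le> visits x n U"
      using eventually_gt_at_top[of 0]
    proof eventually_elim
      case (elim n)
      then have "q / 2 * real n \<le> visits x n (box a b)" by (simp add: field_simps)
      also have "\<dots> \<le> visits x n U" by (rule visits_mono[OF sub])
      finally show ?case .
    qed
    then show ?thesis using q by (intro exI[of _ "q / 2"]) simp
  qed
  show "\<exists>K. compact K \<and> K \<subseteq> interior S \<and> (\<forall>\<^sub>F n in sequentially. visits x n (- K) \<le> \<eta> * real n)" if "0 < \<eta>"
  proof -
    have "emeasure \<nu> (interior S) = emeasure \<nu> S" by (rule emeasure_interior_eq[OF \<nu>(1,4) S])
    then have one: "measure \<nu> (interior S) = 1" using \<nu>(3) by (simp add: measure_def)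
    obtain C where C: "compact C" "C \<subseteq> interior S" "measure \<nu> (interior S) - \<eta> < measure \<nu> C"
      using measure_exhaustion[OF finite_measure_axioms \<nu>(1) open_interior \<open>0 < \<eta>\<close>, of S] by blast
    have "\<forall>p\<in>C. \<exists>ab. cbox (fst ab) (snd ab) \<subseteq> interior S \<and> p \<in> box (fst ab) (snd ab)"
    proof
      fix p assume "p \<in> C"
      then have "p \<in> interior S" using C(2) by blast
      then obtain a b where "cbox a b \<subseteq> interior S" "p \<in> box a b" by (rule open_contains_cbox[OF open_interior])
      then show "\<exists>ab. cbox (fst ab) (snd ab) \<subseteq> interior S \<and> p \<in> box (fst ab) (snd ab)"
        by (intro exI[of _ "(a, b)"]) simp
    qed
    from bchoice[OF this] obtain ab where
      ab: "\<forall>p\<in>C. cbox (fst (ab p)) (snd (ab p)) \<subseteq> interior S \<and> p \<in> box (fst (ab p)) (snd (ab p))" by (rule exE)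
    \<comment> \<open>The open boxes carry the limiting frequencies; the closed ones supply
      compactness and still lie in the interior.\<close>
    define A B where "A p = box (fst (ab p)) (snd (ab p))" and "B p = cbox (fst (ab p)) (snd (ab p))" for p
    have AB: "B p \<subseteq> interior S" "p \<in> A p" if "p \<in> C" for p using ab that by (auto simp: A_def B_def)
    have AB': "open (A p)" "A p \<subseteq> B p" "compact (B p)" for p
      by (simp_all add: A_def B_def open_box box_subset_cbox compact_cbox)
    obtain Q where Q: "Q \<subseteq> C" "finite Q" "C \<subseteq> (\<Union>p\<in>Q. A p)"
      by (rule compactE_image[OF C(1), of C A]) (use AB AB' in auto)
    define K where "K = \<Union>(B ` Q)"
    have K: "compact K" "K \<subseteq> interior S"
      unfolding K_def using Q AB AB' by (auto intro!: compact_UN)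
    have "(\<lambda>n. visits x n (\<Union>(A ` Q)) / real n) \<longlonglongrightarrow> measure \<nu> (\<Union>(A ` Q))"
    proof (rule visits_union_boxes[OF finite_measure_axioms \<nu>(1) lim])
      fix V assume V: "V \<in> A ` Q"
      then obtain p where p: "p \<in> Q" "V = A p" by blast
      then have "p \<in> C" using Q(1) by blast
      then have "V \<subseteq> interior S" using AB(1)[of p] AB'(2)[of p] p(2) by blast
      then show "V \<subseteq> interior S \<and> (\<exists>a b. V = box a b)" unfolding p(2) A_def by blast
    qed (use Q(2) in auto)
    moreover have "1 - \<eta> < measure \<nu> (\<Union>(A ` Q))"
    proof -
      have "measure \<nu> C \<le> measure \<nu> (\<Union>(A ` Q))"
        using Q(3) AB'(1) unfolding \<nu>(1) by (intro finite_measure_mono) (auto simp: \<nu>(1) intro!: borel_open)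
      then show ?thesis using C(3) one by simp
    qed
    ultimately have "\<forall>\<^sub>F n in sequentially. 1 - \<eta> < visits x n (\<Union>(A ` Q)) / real n"
      by (rule order_tendstoD(1))
    then have "\<forall>\<^sub>F n in sequentially. visits x n (- K) \<le> \<eta> * real n"
      using eventually_gt_at_top[of 0]
    proof eventually_elim
      case (elim n)
      have "(1 - \<eta>) * real n \<le> visits x n (\<Union>(A ` Q))" using elim by (simp add: field_simps)
      also have "\<dots> \<le> visits x n K" unfolding K_def using AB'(2) by (intro visits_mono) blast
      finally show ?case unfolding visits_Compl by (simp add: algebra_simps)
    qed
    then show ?thesis using K by blast
  qed
qed

section \<open>The three settings\<close>

lemma convex_on_real_of_ereal:
  assumes \<phi>: "proper_convex \<phi>" and S: "convex S" "S \<subseteq> Dom \<phi>"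
  shows "convex_on S (\<lambda>x. real_of_ereal (\<phi> x))"
proof (rule convex_onI)
  fix t :: real and u v assume t: "0 < t" "t < 1" and uv: "u \<in> S" "v \<in> S"
  have eq: "\<phi> w = ereal (real_of_ereal (\<phi> w))" if "w \<in> S" for w
    using \<phi> S(2) that by (intro ereal_real'[symmetric]) (auto simp: proper_convex_def Dom_def)
  have w: "(1 - t) *\<^sub>R u + t *\<^sub>R v \<in> S" using uv t S(1) by (simp add: convex_alt)
  have "\<phi> ((1 - t) *\<^sub>R u + t *\<^sub>R v) \<le> ereal (1 - t) * \<phi> u + ereal t * \<phi> v"
    using \<phi> t unfolding proper_convex_def convex_ereal_def by auto
  then have "ereal (real_of_ereal (\<phi> ((1 - t) *\<^sub>R u + t *\<^sub>R v)))
      \<le> ereal ((1 - t) * real_of_ereal (\<phi> u) + t * real_of_ereal (\<phi> v))"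
    by (subst (asm) eq[OF w], subst (asm) eq[OF uv(1)], subst (asm) eq[OF uv(2)]) simp
  then show "real_of_ereal (\<phi> ((1 - t) *\<^sub>R u + t *\<^sub>R v))
      \<le> (1 - t) * real_of_ereal (\<phi> u) + t * real_of_ereal (\<phi> v)" by simp
qed (rule S(1))

section \<open>Fixed designs\<close>

text \<open>For a fixed design the indicators are constants of absolute value at most 1, so the
  weighted errors remain independent, centred and bounded in second moment. A countable base has
  countably many finite subfamilies, hence one null set suffices.\<close>

lemma AE_mean_fixed_design:
  fixes x :: "nat \<Rightarrow> 'a::euclidean_space" and \<epsilon> :: "nat \<Rightarrow> 'w \<Rightarrow> real"
  assumes "prob_space M" and \<B>: "countable \<B>"
    and indep: "prob_space.indep_vars M (\<lambda>_. borel) \<epsilon> UNIV"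
    and mean: "\<And>k. prob_space.expectation M (\<epsilon> k) = 0"
    and sq: "\<And>k. integrable M (\<lambda>\<omega>. (\<epsilon> k \<omega>)\<^sup>2)" "\<And>k. prob_space.expectation M (\<lambda>\<omega>. (\<epsilon> k \<omega>)\<^sup>2) \<le> C"
  shows "AE \<omega> in M. \<forall>F\<in>{F. finite F \<and> F \<subseteq> \<B>}. \<forall>\<tau>>0. \<forall>\<^sub>F n in sequentially.
    \<bar>\<Sum>k<n. indicator (\<Union>F) (x k) * \<epsilon> k \<omega>\<bar> \<le> \<tau> * real n"
proof -
  interpret prob_space M by fact
  show ?thesis
  proof (subst AE_ball_countable[OF countable_Collect_finite_subset[OF \<B>]], rule ballI, rule strong_law_bounded_second_moment)
    fix F
    define w where "w k = (indicator (\<Union>F) (x k) :: real)" for k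
    have w: "0 \<le> w k" "(w k)\<^sup>2 \<le> 1" for k by (auto simp: w_def indicator_def)
    show "indep_vars (\<lambda>_. borel) (\<lambda>k \<omega>. indicator (\<Union>F) (x k) * \<epsilon> k \<omega>) UNIV"
      by (rule indep_vars_compose2[OF indep]) simp
    show "expectation (\<lambda>\<omega>. indicator (\<Union>F) (x k) * \<epsilon> k \<omega>) = 0" for k
      using mean by simp
    show "integrable M (\<lambda>\<omega>. (indicator (\<Union>F) (x k) * \<epsilon> k \<omega>)\<^sup>2)" for k
      using sq(1) by (simp add: power_mult_distrib)
    have "expectation (\<lambda>\<omega>. (w k * \<epsilon> k \<omega>)\<^sup>2) \<le> C" for k
    proof -
      have "expectation (\<lambda>\<omega>. (w k * \<epsilon> k \<omega>)\<^sup>2) = (w k)\<^sup>2 * expectation (\<lambda>\<omega>. (\<epsilon> k \<omega>)\<^sup>2)"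
        using sq(1) by (simp add: power_mult_distrib)
      also have "\<dots> \<le> 1 * expectation (\<lambda>\<omega>. (\<epsilon> k \<omega>)\<^sup>2)"
        by (intro mult_right_mono w Bochner_Integration.integral_nonneg) simp
      finally show ?thesis using sq(2)[of k] by simp
    qed
    then show "expectation (\<lambda>\<omega>. (indicator (\<Union>F) (x k) * \<epsilon> k \<omega>)\<^sup>2) \<le> C" for k
      unfolding w_def .
  qed
qed

text \<open>The part of the squared error exceeding the threshold \<open>m\<close> in size has an
  expectation that tends to 0 by dominated convergence, and the upper strong law applies to it for
  each of the countably many \<open>m\<close>. Threshold 0 leaves the square intact, which gives the
  second claim.\<close>

lemma iid_errors_truncation:
  fixes \<epsilon> :: "nat \<Rightarrow> 'w \<Rightarrow> real"
  assumes "prob_space M" and indep: "prob_space.indep_vars M (\<lambda>_. borel) \<epsilon> UNIV"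
    and distr: "\<And>k. distr M borel (\<epsilon> k) = distr M borel (\<epsilon> 0)"
    and sq: "integrable M (\<lambda>\<omega>. (\<epsilon> 0 \<omega>)\<^sup>2)"
  shows "AE \<omega> in M. \<forall>\<eta>>0. \<exists>m::nat. \<forall>\<^sub>F n in sequentially.
    (\<Sum>k<n. if real m < (\<epsilon> k \<omega>)\<^sup>2 then (\<epsilon> k \<omega>)\<^sup>2 else 0) \<le> \<eta> * real n"
    and "AE \<omega> in M. \<exists>C. \<forall>\<^sub>F n in sequentially. (\<Sum>k<n. (\<epsilon> k \<omega>)\<^sup>2) \<le> C * real n"
proof -
  interpret prob_space M by fact
  have rv [measurable]: "\<epsilon> k \<in> borel_measurable M" for k using indep by (auto simp: indep_vars_def)
  define f where "f m z = (if real m < z\<^sup>2 then z\<^sup>2 else 0)" for m :: nat and z :: real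
  have f_meas [measurable]: "f m \<in> borel_measurable borel" for m unfolding f_def by measurable
  have f_bounds: "0 \<le> f m z" "f m z \<le> z\<^sup>2" for m z by (auto simp: f_def)
  have f_int: "integrable M (\<lambda>\<omega>. f m (\<epsilon> 0 \<omega>))" for m
    by (rule Bochner_Integration.integrable_bound[OF sq]) (auto simp: f_bounds)
  have distr_f: "distr M borel (\<lambda>\<omega>. f m (\<epsilon> k \<omega>)) = distr M borel (\<lambda>\<omega>. f m (\<epsilon> 0 \<omega>))" for m k
  proof -
    have "distr M borel (\<lambda>\<omega>. f m (\<epsilon> k \<omega>)) = distr (distr M borel (\<epsilon> k)) borel (f m)" for k
      by (subst distr_distr) (auto simp: comp_def)
    then show ?thesis using distr by metis
  qed
  have law: "AE \<omega> in M. \<forall>e>0. \<forall>\<^sub>F n in sequentially.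
      (\<Sum>k<n. f m (\<epsilon> k \<omega>)) \<le> (2 * expectation (\<lambda>\<omega>. f m (\<epsilon> 0 \<omega>)) + e) * real n" for m
    by (rule AE_average_upper_bound_iid[OF indep_vars_compose2[OF indep] f_bounds(1) distr_f f_int]) simp
  have "(\<lambda>m. expectation (\<lambda>\<omega>. f m (\<epsilon> 0 \<omega>))) \<longlonglongrightarrow> expectation (\<lambda>\<omega>. 0)"
  proof (rule integral_dominated_convergence[OF _ _ sq])
    show "AE \<omega> in M. (\<lambda>m. f m (\<epsilon> 0 \<omega>)) \<longlonglongrightarrow> 0"
    proof (rule AE_I2)
      fix \<omega>
      have "\<forall>\<^sub>F m in sequentially. (\<epsilon> 0 \<omega>)\<^sup>2 \<le> real m"
        using filterlim_real_sequentially unfolding filterlim_at_top by blast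
      then have "\<forall>\<^sub>F m in sequentially. f m (\<epsilon> 0 \<omega>) = 0"
        by eventually_elim (simp add: f_def)
      then show "(\<lambda>m. f m (\<epsilon> 0 \<omega>)) \<longlonglongrightarrow> 0" by (rule tendsto_eventually)
    qed
  qed (auto simp: f_bounds)
  then have f_lim: "(\<lambda>m. expectation (\<lambda>\<omega>. f m (\<epsilon> 0 \<omega>))) \<longlonglongrightarrow> 0" by simp
  have all: "AE \<omega> in M. \<forall>m. \<forall>e>0. \<forall>\<^sub>F n in sequentially.
      (\<Sum>k<n. f m (\<epsilon> k \<omega>)) \<le> (2 * expectation (\<lambda>\<omega>. f m (\<epsilon> 0 \<omega>)) + e) * real n"
    using law by (simp add: AE_all_countable)
  then show "AE \<omega> in M. \<forall>\<eta>>0. \<exists>m::nat. \<forall>\<^sub>F n in sequentially.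
    (\<Sum>k<n. if real m < (\<epsilon> k \<omega>)\<^sup>2 then (\<epsilon> k \<omega>)\<^sup>2 else 0) \<le> \<eta> * real n"
  proof eventually_elim
    case (elim \<omega>)
    show ?case
    proof (intro allI impI)
      fix \<eta> :: real assume "0 < \<eta>"
      then have "\<forall>\<^sub>F m in sequentially. expectation (\<lambda>\<omega>. f m (\<epsilon> 0 \<omega>)) < \<eta> / 4"
        by (intro order_tendstoD(2)[OF f_lim]) simp
      then obtain m where m: "expectation (\<lambda>\<omega>. f m (\<epsilon> 0 \<omega>)) < \<eta> / 4"
        by (auto simp: eventually_sequentially)
      have "\<forall>\<^sub>F n in sequentially. (\<Sum>k<n. f m (\<epsilon> k \<omega>)) \<le> (2 * expectation (\<lambda>\<omega>. f m (\<epsilon> 0 \<omega>)) + \<eta> / 2) * real n"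
        using elim \<open>0 < \<eta>\<close> half_gt_zero by blast
      then have "\<forall>\<^sub>F n in sequentially. (\<Sum>k<n. f m (\<epsilon> k \<omega>)) \<le> \<eta> * real n"
      proof eventually_elim
        case (elim n)
        also have "(2 * expectation (\<lambda>\<omega>. f m (\<epsilon> 0 \<omega>)) + \<eta> / 2) * real n \<le> \<eta> * real n"
          using m by (intro mult_right_mono) auto
        finally show ?case .
      qed
      then show "\<exists>m::nat. \<forall>\<^sub>F n in sequentially. (\<Sum>k<n. if real m < (\<epsilon> k \<omega>)\<^sup>2 then (\<epsilon> k \<omega>)\<^sup>2 else 0) \<le> \<eta> * real n"
        unfolding f_def by blast
    qed
  qed
  have f0: "f 0 z = z\<^sup>2" for z by (auto simp: f_def)
  show "AE \<omega> in M. \<exists>C. \<forall>\<^sub>F n in sequentially. (\<Sum>k<n. (\<epsilon> k \<omega>)\<^sup>2) \<le> C * real n"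
    using law[of 0]
  proof eventually_elim
    case (elim \<omega>)
    from elim[rule_format, OF zero_less_one] show ?case unfolding f0 by (rule exI)
  qed
qed

text \<open>The weights only decrease the variances of the squares, and the mean of the weighted
  squares is at most \<open>V * c\<close>. With \<open>A\<close> everything this yields
  \<open>bounded\<close>; with \<open>A\<close> the complement of a compact set it yields
  \<open>tight\<close>.\<close>

lemma heteroscedastic_errors_weighted:
  fixes \<epsilon> :: "nat \<Rightarrow> 'w \<Rightarrow> real" and x :: "nat \<Rightarrow> 'a"
  assumes "prob_space M" and indep: "prob_space.indep_vars M (\<lambda>_. borel) \<epsilon> UNIV"
    and sq: "\<And>k. integrable M (\<lambda>\<omega>. (\<epsilon> k \<omega>)\<^sup>2)" "\<And>k. integrable M (\<lambda>\<omega>. ((\<epsilon> k \<omega>)\<^sup>2)\<^sup>2)"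
    and sum: "summable (\<lambda>k. prob_space.variance M (\<lambda>\<omega>. (\<epsilon> k \<omega>)\<^sup>2) / (real (Suc k))\<^sup>2)"
    and V: "\<And>k. prob_space.expectation M (\<lambda>\<omega>. (\<epsilon> k \<omega>)\<^sup>2) \<le> V"
    and A: "\<forall>\<^sub>F n in sequentially. visits x n A \<le> c * real n"
  shows "AE \<omega> in M. \<forall>e>0. \<forall>\<^sub>F n in sequentially.
    (\<Sum>k<n. indicator A (x k) * (\<epsilon> k \<omega>)\<^sup>2) \<le> (2 * (V * c) + e) * real n"
proof -
  interpret prob_space M by fact
  define w where "w k = (indicator A (x k) :: real)" for k
  have w: "0 \<le> w k" "(w k)\<^sup>2 \<le> 1" for k by (auto simp: w_def indicator_def)
  have "0 \<le> expectation (\<lambda>\<omega>. (\<epsilon> 0 \<omega>)\<^sup>2)" by (intro Bochner_Integration.integral_nonneg) simp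
  then have "0 \<le> V" using V[of 0] by linarith
  have "AE \<omega> in M. \<forall>c e. 0 < e \<longrightarrow> (\<forall>\<^sub>F n in sequentially. (\<Sum>k<n. expectation (\<lambda>\<omega>. w k * (\<epsilon> k \<omega>)\<^sup>2)) \<le> c * real n) \<longrightarrow>
    (\<forall>\<^sub>F n in sequentially. (\<Sum>k<n. w k * (\<epsilon> k \<omega>)\<^sup>2) \<le> (2 * c + e) * real n)"
  proof (rule AE_average_upper_bound)
    show "indep_vars (\<lambda>_. borel) (\<lambda>k \<omega>. w k * (\<epsilon> k \<omega>)\<^sup>2) UNIV"
      by (rule indep_vars_compose2[OF indep]) simp
    show "0 \<le> w k * (\<epsilon> k \<omega>)\<^sup>2" for k \<omega> using w by simp
    show "integrable M (\<lambda>\<omega>. (w k * (\<epsilon> k \<omega>)\<^sup>2)\<^sup>2)" for k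
      using sq(2) unfolding power_mult_distrib by (rule integrable_mult_right)
    have var: "variance (\<lambda>\<omega>. w k * (\<epsilon> k \<omega>)\<^sup>2) = (w k)\<^sup>2 * variance (\<lambda>\<omega>. (\<epsilon> k \<omega>)\<^sup>2)" for k
      by (simp add: right_diff_distrib[symmetric] power_mult_distrib)
    show "summable (\<lambda>k. variance (\<lambda>\<omega>. w k * (\<epsilon> k \<omega>)\<^sup>2) / (real (Suc k))\<^sup>2)"
    proof (rule summable_comparison_test[OF _ sum], intro exI allI impI)
      fix k
      have "(w k)\<^sup>2 * variance (\<lambda>\<omega>. (\<epsilon> k \<omega>)\<^sup>2) \<le> 1 * variance (\<lambda>\<omega>. (\<epsilon> k \<omega>)\<^sup>2)"
        by (intro mult_right_mono w variance_positive)
      then show "norm (variance (\<lambda>\<omega>. w k * (\<epsilon> k \<omega>)\<^sup>2) / (real (Suc k))\<^sup>2)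
          \<le> variance (\<lambda>\<omega>. (\<epsilon> k \<omega>)\<^sup>2) / (real (Suc k))\<^sup>2"
        unfolding var using variance_positive[of "\<lambda>\<omega>. (\<epsilon> k \<omega>)\<^sup>2"]
        by (simp add: abs_mult divide_right_mono del: of_nat_Suc)
    qed
  qed
  then show ?thesis
  proof eventually_elim
    case (elim \<omega>)
    have "\<forall>\<^sub>F n in sequentially. (\<Sum>k<n. expectation (\<lambda>\<omega>. w k * (\<epsilon> k \<omega>)\<^sup>2)) \<le> V * c * real n"
      using A
    proof eventually_elim
      case (elim n)
      have "(\<Sum>k<n. expectation (\<lambda>\<omega>. w k * (\<epsilon> k \<omega>)\<^sup>2)) = (\<Sum>k<n. w k * expectation (\<lambda>\<omega>. (\<epsilon> k \<omega>)\<^sup>2))"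
        by simp
      also have "\<dots> \<le> (\<Sum>k<n. w k * V)" by (intro sum_mono mult_left_mono V w)
      also have "\<dots> = V * visits x n A"
        unfolding visits_eq_sum w_def sum_distrib_left by (intro sum.cong refl) (rule mult.commute)
      also have "\<dots> \<le> V * (c * real n)" by (intro mult_left_mono elim \<open>0 \<le> V\<close>)
      finally show ?case by (simp only: mult.assoc)
    qed
    then show ?case using elim unfolding w_def by blast
  qed
qed

text \<open>The common part of both fixed design settings. The conditions \<open>bounded\<close> and
  \<open>tight\<close> stay as assumptions because they are where the two error models require
  different laws.\<close>

lemma AE_convex_regression_fixed_design:
  fixes S :: "'a::euclidean_space set" and \<epsilon> :: "nat \<Rightarrow> 'w \<Rightarrow> real"
  assumes "prob_space M" and S: "closed S" "convex S" and g: "convex_on S g" and fd: "fixed_design S x"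
    and XY: "\<And>k \<omega>. \<omega> \<in> space M \<Longrightarrow> X k \<omega> = x k \<and> Y k \<omega> = g (x k) + \<epsilon> k \<omega>"
    and indep: "prob_space.indep_vars M (\<lambda>_. borel) \<epsilon> UNIV"
    and mean: "\<And>k. prob_space.expectation M (\<epsilon> k) = 0"
    and sq: "\<And>k. integrable M (\<lambda>\<omega>. (\<epsilon> k \<omega>)\<^sup>2)" "\<And>k. prob_space.expectation M (\<lambda>\<omega>. (\<epsilon> k \<omega>)\<^sup>2) \<le> C"
    and bounded: "AE \<omega> in M. \<exists>C. \<forall>\<^sub>F n in sequentially. (\<Sum>k<n. (\<epsilon> k \<omega>)\<^sup>2) \<le> C * real n"
    and tight: "AE \<omega> in M. \<forall>\<eta>>0. \<exists>K. compact K \<and> K \<subseteq> interior S \<and>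
      (\<forall>\<^sub>F n in sequentially. (\<Sum>k<n. indicator (- K) (x k) * (\<epsilon> k \<omega>)\<^sup>2) \<le> \<eta> * real n)"
  shows "\<exists>\<B>. AE \<omega> in M. convex_regression S g (\<lambda>k. X k \<omega>) (\<lambda>k. Y k \<omega>) (\<lambda>k. \<epsilon> k \<omega>) \<B>"
proof -
  obtain \<B> :: "'a set set" where \<B>: "countable \<B>" "topological_basis \<B>" using ex_countable_basis by blast
  have "AE \<omega> in M. convex_regression S g (\<lambda>k. X k \<omega>) (\<lambda>k. Y k \<omega>) (\<lambda>k. \<epsilon> k \<omega>) \<B>"
    using AE_mean_fixed_design[OF \<open>prob_space M\<close> \<B>(1) indep mean sq, of x] bounded tight AE_space
  proof eventually_elim
    case (elim \<omega>)
    have eq: "X k \<omega> = x k" "Y k \<omega> = g (x k) + \<epsilon> k \<omega>" for k using XY[OF elim(4)] by blast+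
    show ?case
      unfolding eq(1)
    proof
      show "x k \<in> S" for k using fd unfolding fixed_design_def by (rule conjE) (rule spec)
      show "Y k \<omega> = g (x k) + \<epsilon> k \<omega>" for k by (rule eq)
      show "\<exists>c>0. \<forall>\<^sub>F n in sequentially. c * real n \<le> real (card {k. k < n \<and> x k \<in> U})"
        if "open U" "U \<noteq> {}" "U \<subseteq> interior S" for U
        using fixed_design_dense[OF fd S that] unfolding visits_def .
      show "\<forall>\<^sub>F n in sequentially. \<bar>\<Sum>k<n. indicator (\<Union>F) (x k) * \<epsilon> k \<omega>\<bar> \<le> \<tau> * real n"
        if "finite F" "F \<subseteq> \<B>" "0 < \<tau>" for F \<tau>
        using elim(1)[THEN bspec, of F] that by simp
      show "\<exists>K. compact K \<and> K \<subseteq> interior S \<and>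
          (\<forall>\<^sub>F n in sequentially. (\<Sum>k<n. indicator (- K) (x k) * (\<epsilon> k \<omega>)\<^sup>2) \<le> \<eta> * real n)"
        if "0 < \<eta>" for \<eta> using elim(3) that by simp
    qed (fact S(2) g \<B>(2) elim(2))+
  qed
  then show ?thesis by (rule exI)
qed

lemma AE_convex_regression_iid_errors:
  fixes S :: "'a::euclidean_space set"
  assumes M: "prob_space M" and S: "closed S" "convex S"
    and g: "convex_on S (\<lambda>x. real_of_ereal (\<phi> x))" and setting: "setting_iid_errors M S \<phi> X Y \<sigma>"
  shows "\<exists>e \<B>. AE \<omega> in M. convex_regression S (\<lambda>x. real_of_ereal (\<phi> x)) (\<lambda>k. X k \<omega>) (\<lambda>k. Y k \<omega>) (\<lambda>k. e k \<omega>) \<B>"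
proof -
  from setting obtain \<epsilon> where \<epsilon>: "fixed_design_model M S \<phi> X Y \<epsilon>"
    "prob_space.indep_vars M (\<lambda>_. borel) \<epsilon> UNIV" "\<forall>k. distr M borel (\<epsilon> k) = distr M borel (\<epsilon> 0)"
    "\<forall>k. integrable M (\<epsilon> k) \<and> prob_space.expectation M (\<epsilon> k) = 0"
    "\<forall>k. integrable M (\<lambda>\<omega>. (\<epsilon> k \<omega>)\<^sup>2) \<and> prob_space.expectation M (\<lambda>\<omega>. (\<epsilon> k \<omega>)\<^sup>2) = \<sigma>\<^sup>2"
    unfolding setting_iid_errors_def by (elim exE conjE)
  from \<epsilon>(1) obtain x where fd: "fixed_design S x" and
    XY: "\<forall>k. \<forall>\<omega>\<in>space M. X k \<omega> = x k \<and> Y k \<omega> = real_of_ereal (\<phi> (x k)) + \<epsilon> k \<omega>"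
    unfolding fixed_design_model_def by (elim exE conjE)
  have distr: "distr M borel (\<epsilon> k) = distr M borel (\<epsilon> 0)" and mean: "prob_space.expectation M (\<epsilon> k) = 0"
    and sq: "integrable M (\<lambda>\<omega>. (\<epsilon> k \<omega>)\<^sup>2)" "prob_space.expectation M (\<lambda>\<omega>. (\<epsilon> k \<omega>)\<^sup>2) \<le> \<sigma>\<^sup>2" for k
    using \<epsilon>(3,4,5) by simp_all
  have "AE \<omega> in M. \<forall>\<eta>>0. \<exists>K. compact K \<and> K \<subseteq> interior S \<and>
      (\<forall>\<^sub>F n in sequentially. (\<Sum>k<n. indicator (- K) (x k) * (\<epsilon> k \<omega>)\<^sup>2) \<le> \<eta> * real n)"
    using iid_errors_truncation(1)[OF M \<epsilon>(2) distr sq(1)]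
  proof eventually_elim
    case (elim \<omega>)
    show ?case
    proof (intro allI impI)
      fix \<eta> :: real assume "0 < \<eta>"
      then have "0 < \<eta> / 2" by simp
      from elim[rule_format, OF this] obtain m :: nat where m: "\<forall>\<^sub>F n in sequentially.
          (\<Sum>k<n. if real m < (\<epsilon> k \<omega>)\<^sup>2 then (\<epsilon> k \<omega>)\<^sup>2 else 0) \<le> \<eta> / 2 * real n" by (rule exE)
      \<comment> \<open>Squared errors above \<open>m\<close> contribute at most \<eta>/2; the
        others are below \<open>Suc m\<close>, so this visiting rate makes them contribute at most
        \<eta>/2 too. The threshold, and with it \<open>K\<close>, may depend on \<omega>, since
        \<open>fixed_design_tight\<close> concerns the nonrandom design alone.\<close>
      have "0 < \<eta> / (2 * real (Suc m))" using \<open>0 < \<eta>\<close> by simp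
      from fixed_design_tight[OF fd S this] obtain K where K: "compact K" "K \<subseteq> interior S"
        "\<forall>\<^sub>F n in sequentially. visits x n (- K) \<le> \<eta> / (2 * real (Suc m)) * real n" by (elim exE conjE)
      have "\<forall>\<^sub>F n in sequentially. (\<Sum>k<n. indicator (- K) (x k) * (\<epsilon> k \<omega>)\<^sup>2) \<le> \<eta> * real n"
        using m K(3)
      proof eventually_elim
        case (elim n)
        have "(\<Sum>k<n. indicator (- K) (x k) * (\<epsilon> k \<omega>)\<^sup>2) \<le>
            (\<Sum>k<n. real (Suc m) * indicator (- K) (x k) + (if real m < (\<epsilon> k \<omega>)\<^sup>2 then (\<epsilon> k \<omega>)\<^sup>2 else 0))"
          by (intro sum_mono) (auto simp: indicator_def)
        also have "\<dots> = real (Suc m) * visits x n (- K) + (\<Sum>k<n. if real m < (\<epsilon> k \<omega>)\<^sup>2 then (\<epsilon> k \<omega>)\<^sup>2 else 0)"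
          unfolding visits_eq_sum sum.distrib sum_distrib_left ..
        also have "\<dots> \<le> real (Suc m) * (\<eta> / (2 * real (Suc m)) * real n) + \<eta> / 2 * real n"
          by (intro add_mono mult_left_mono elim) simp
        also have "\<dots> = \<eta> * real n" by (simp del: of_nat_Suc)
        finally show ?case .
      qed
      then show "\<exists>K. compact K \<and> K \<subseteq> interior S \<and>
          (\<forall>\<^sub>F n in sequentially. (\<Sum>k<n. indicator (- K) (x k) * (\<epsilon> k \<omega>)\<^sup>2) \<le> \<eta> * real n)"
        using K by (intro exI[of _ K] conjI)
    qed
  qed
  then show ?thesis
    by (intro exI[of _ \<epsilon>] AE_convex_regression_fixed_design[OF M S g fd _ \<epsilon>(2) mean sq
          iid_errors_truncation(2)[OF M \<epsilon>(2) distr sq(1)]])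
       (use XY in blast)
qed

lemma AE_convex_regression_heteroscedastic_errors:
  fixes S :: "'a::euclidean_space set"
  assumes M: "prob_space M" and S: "closed S" "convex S"
    and g: "convex_on S (\<lambda>x. real_of_ereal (\<phi> x))" and setting: "setting_heteroscedastic_errors M S \<phi> X Y \<sigma>"
  shows "\<exists>e \<B>. AE \<omega> in M. convex_regression S (\<lambda>x. real_of_ereal (\<phi> x)) (\<lambda>k. X k \<omega>) (\<lambda>k. Y k \<omega>) (\<lambda>k. e k \<omega>) \<B>"
proof -
  interpret prob_space M by fact
  from setting obtain \<epsilon> where \<epsilon>: "fixed_design_model M S \<phi> X Y \<epsilon>"
    "indep_vars (\<lambda>_. borel) \<epsilon> UNIV"
    "\<forall>k. integrable M (\<epsilon> k) \<and> expectation (\<epsilon> k) = 0"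
    "\<forall>k. integrable M (\<lambda>\<omega>. (\<epsilon> k \<omega>)\<^sup>2) \<and> integrable M (\<lambda>\<omega>. ((\<epsilon> k \<omega>)\<^sup>2)\<^sup>2)"
    "summable (\<lambda>k. variance (\<lambda>\<omega>. (\<epsilon> k \<omega>)\<^sup>2) / (real (Suc k))\<^sup>2)"
    "bdd_above (range (\<lambda>k. expectation (\<lambda>\<omega>. (\<epsilon> k \<omega>)\<^sup>2)))"
    unfolding setting_heteroscedastic_errors_def by (elim exE conjE)
  from \<epsilon>(1) obtain x where fd: "fixed_design S x" and
    XY: "\<forall>k. \<forall>\<omega>\<in>space M. X k \<omega> = x k \<and> Y k \<omega> = real_of_ereal (\<phi> (x k)) + \<epsilon> k \<omega>"
    unfolding fixed_design_model_def by (elim exE conjE)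
  from \<epsilon>(6) obtain V where V: "expectation (\<lambda>\<omega>. (\<epsilon> k \<omega>)\<^sup>2) \<le> V" for k
    unfolding bdd_above_def by blast
  have mean: "expectation (\<epsilon> k) = 0" and sq: "integrable M (\<lambda>\<omega>. (\<epsilon> k \<omega>)\<^sup>2)" "integrable M (\<lambda>\<omega>. ((\<epsilon> k \<omega>)\<^sup>2)\<^sup>2)" for k
    using \<epsilon>(3,4) by simp_all
  note weighted = heteroscedastic_errors_weighted[OF M \<epsilon>(2) sq \<epsilon>(5) V]
  \<comment> \<open>Here the law depends on the compact set, so a countable sequence of them is
    fixed before \<omega>.\<close>
  have "\<forall>m. \<exists>K. compact K \<and> K \<subseteq> interior S \<and> (\<forall>\<^sub>F n in sequentially. visits x n (- K) \<le> 1 / real (Suc m) * real n)"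
    by (intro allI fixed_design_tight[OF fd S]) simp
  from choice[OF this] obtain K where "\<forall>m. compact (K m) \<and> K m \<subseteq> interior S \<and>
      (\<forall>\<^sub>F n in sequentially. visits x n (- K m) \<le> 1 / real (Suc m) * real n)" by (rule exE)
  then have K: "compact (K m)" "K m \<subseteq> interior S"
    "\<forall>\<^sub>F n in sequentially. visits x n (- K m) \<le> 1 / real (Suc m) * real n" for m by simp_all
  have "AE \<omega> in M. \<forall>m. \<forall>e>0. \<forall>\<^sub>F n in sequentially.
      (\<Sum>k<n. indicator (- K m) (x k) * (\<epsilon> k \<omega>)\<^sup>2) \<le> (2 * (V * (1 / real (Suc m))) + e) * real n"
    unfolding AE_all_countable by (intro allI weighted K(3))
  then have tight: "AE \<omega> in M. \<forall>\<eta>>0. \<exists>K. compact K \<and> K \<subseteq> interior S \<and>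
      (\<forall>\<^sub>F n in sequentially. (\<Sum>k<n. indicator (- K) (x k) * (\<epsilon> k \<omega>)\<^sup>2) \<le> \<eta> * real n)"
  proof eventually_elim
    case (elim \<omega>)
    show ?case
    proof (intro allI impI)
      fix \<eta> :: real assume "0 < \<eta>"
      have "(\<lambda>m. 2 * (V * (1 / real (Suc m)))) \<longlonglongrightarrow> 2 * (V * 0)"
        by (intro tendsto_intros LIMSEQ_Suc[OF lim_1_over_n])
      then have "\<forall>\<^sub>F m in sequentially. 2 * (V * (1 / real (Suc m))) < \<eta> / 2"
        using \<open>0 < \<eta>\<close> by (intro order_tendstoD(2)) auto
      then obtain m where m: "2 * (V * (1 / real (Suc m))) < \<eta> / 2"
        by (auto simp: eventually_sequentially simp del: of_nat_Suc)
      have "\<forall>\<^sub>F n in sequentially. (\<Sum>k<n. indicator (- K m) (x k) * (\<epsilon> k \<omega>)\<^sup>2)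
          \<le> (2 * (V * (1 / real (Suc m))) + \<eta> / 2) * real n"
        using \<open>0 < \<eta>\<close> by (intro elim[rule_format]) simp
      then have "\<forall>\<^sub>F n in sequentially. (\<Sum>k<n. indicator (- K m) (x k) * (\<epsilon> k \<omega>)\<^sup>2) \<le> \<eta> * real n"
      proof eventually_elim
        case (elim n)
        also have "(2 * (V * (1 / real (Suc m))) + \<eta> / 2) * real n \<le> \<eta> * real n"
          using m by (intro mult_right_mono) auto
        finally show ?case .
      qed
      then show "\<exists>K. compact K \<and> K \<subseteq> interior S \<and>
          (\<forall>\<^sub>F n in sequentially. (\<Sum>k<n. indicator (- K) (x k) * (\<epsilon> k \<omega>)\<^sup>2) \<le> \<eta> * real n)"
        using K(1,2) by (intro exI[of _ "K m"] conjI)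
    qed
  qed
  have "AE \<omega> in M. \<forall>e>0. \<forall>\<^sub>F n in sequentially.
      (\<Sum>k<n. indicator UNIV (x k) * (\<epsilon> k \<omega>)\<^sup>2) \<le> (2 * (V * 1) + e) * real n"
    by (rule weighted) (simp add: visits_def)
  then have bounded: "AE \<omega> in M. \<exists>C. \<forall>\<^sub>F n in sequentially. (\<Sum>k<n. (\<epsilon> k \<omega>)\<^sup>2) \<le> C * real n"
  proof eventually_elim
    case (elim \<omega>)
    from elim[rule_format, OF zero_less_one] show ?case by (intro exI[of _ "2 * (V * 1) + 1"]) simp
  qed
  show ?thesis
    by (intro exI[of _ \<epsilon>] AE_convex_regression_fixed_design[OF M S g fd _ \<epsilon>(2) mean sq(1) V bounded tight])
       (use XY in blast)
qed

section \<open>Stochastic design\<close>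

text \<open>Both laws are applied to functions of an i.i.d. sequence. Only second moments of
  \<open>\<psi>\<close> are available, so its squares are handled by the law that requires just a
  first moment.\<close>

lemma
  fixes R :: "nat \<Rightarrow> 'w \<Rightarrow> 'b::second_countable_topology" and \<mu> :: "'b measure" and \<psi> :: "'b \<Rightarrow> real"
  assumes "prob_space M" and indep: "prob_space.indep_vars M (\<lambda>_. borel) R UNIV"
    and distr: "\<And>k. distr M borel (R k) = \<mu>"
    and \<psi>: "\<psi> \<in> borel_measurable borel" "integrable \<mu> (\<lambda>p. (\<psi> p)\<^sup>2)"
  shows iid_mean_zero: "(\<integral>p. \<psi> p \<partial>\<mu>) = 0 \<Longrightarrow>
      AE \<omega> in M. \<forall>\<tau>>0. \<forall>\<^sub>F n in sequentially. \<bar>\<Sum>k<n. \<psi> (R k \<omega>)\<bar> \<le> \<tau> * real n"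
    and iid_squares: "AE \<omega> in M. \<forall>e>0. \<forall>\<^sub>F n in sequentially.
      (\<Sum>k<n. (\<psi> (R k \<omega>))\<^sup>2) \<le> (2 * (\<integral>p. (\<psi> p)\<^sup>2 \<partial>\<mu>) + e) * real n"
proof -
  interpret prob_space M by fact
  have rv [measurable]: "R k \<in> borel_measurable M" for k using indep by (auto simp: indep_vars_def)
  note [measurable] = \<psi>(1)
  have int: "integrable M (\<lambda>\<omega>. f (R k \<omega>))" if "f \<in> borel_measurable borel" "integrable \<mu> f" for f :: "'b \<Rightarrow> real" and k
    using integrable_distr_eq[OF rv that(1), of k] that(2) distr by simp
  have expect: "expectation (\<lambda>\<omega>. f (R k \<omega>)) = (\<integral>p. f p \<partial>\<mu>)" if "f \<in> borel_measurable borel" for f :: "'b \<Rightarrow> real" and k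
    using integral_distr[OF rv that, of k] distr by simp
  have sq_meas: "(\<lambda>p. (\<psi> p)\<^sup>2) \<in> borel_measurable borel" by measurable
  show "AE \<omega> in M. \<forall>\<tau>>0. \<forall>\<^sub>F n in sequentially. \<bar>\<Sum>k<n. \<psi> (R k \<omega>)\<bar> \<le> \<tau> * real n"
    if "(\<integral>p. \<psi> p \<partial>\<mu>) = 0"
  proof (rule strong_law_bounded_second_moment[where C = "\<integral>p. (\<psi> p)\<^sup>2 \<partial>\<mu>"])
    show "indep_vars (\<lambda>_. borel) (\<lambda>k \<omega>. \<psi> (R k \<omega>)) UNIV"
      by (rule indep_vars_compose2[OF indep]) (rule \<psi>(1))
  qed (simp_all add: expect[OF \<psi>(1)] that int[OF sq_meas \<psi>(2)] expect[OF sq_meas])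
  have "AE \<omega> in M. \<forall>e>0. \<forall>\<^sub>F n in sequentially.
      (\<Sum>k<n. (\<psi> (R k \<omega>))\<^sup>2) \<le> (2 * expectation (\<lambda>\<omega>. (\<psi> (R 0 \<omega>))\<^sup>2) + e) * real n"
  proof (rule AE_average_upper_bound_iid)
    show "indep_vars (\<lambda>_. borel) (\<lambda>k \<omega>. (\<psi> (R k \<omega>))\<^sup>2) UNIV"
      by (rule indep_vars_compose2[OF indep]) (rule sq_meas)
    have "distr M borel (\<lambda>\<omega>. (\<psi> (R k \<omega>))\<^sup>2) = distr \<mu> borel (\<lambda>p. (\<psi> p)\<^sup>2)" for k
      unfolding distr[of k, symmetric] by (subst distr_distr) (auto simp: comp_def)
    then show "distr M borel (\<lambda>\<omega>. (\<psi> (R k \<omega>))\<^sup>2) = distr M borel (\<lambda>\<omega>. (\<psi> (R 0 \<omega>))\<^sup>2)" for k by simp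
    show "integrable M (\<lambda>\<omega>. (\<psi> (R 0 \<omega>))\<^sup>2)" by (rule int[OF sq_meas \<psi>(2)])
  qed simp
  then show "AE \<omega> in M. \<forall>e>0. \<forall>\<^sub>F n in sequentially.
      (\<Sum>k<n. (\<psi> (R k \<omega>))\<^sup>2) \<le> (2 * (\<integral>p. (\<psi> p)\<^sup>2 \<partial>\<mu>) + e) * real n"
    unfolding expect[OF sq_meas] .
qed

text \<open>The residual \<open>r\<close> is measurable only for the completion, so the laws are
  applied to a Borel function \<open>f\<close> that agrees with it almost everywhere. The design
  charges only the interior of \<open>S\<close>, where the regression function is
  continuous.\<close>

lemma AE_convex_regression_stochastic_design:
  fixes S :: "'a::euclidean_space set"
  assumes M: "prob_space M" and S: "closed S" "convex S"
    and g_convex: "convex_on S (\<lambda>x. real_of_ereal (\<phi> x))" and setting: "setting_stochastic_design M S \<phi> X Y \<sigma>"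
  shows "\<exists>e \<B>. AE \<omega> in M. convex_regression S (\<lambda>x. real_of_ereal (\<phi> x)) (\<lambda>k. X k \<omega>) (\<lambda>k. Y k \<omega>) (\<lambda>k. e k \<omega>) \<B>"
proof -
  define g where "g x = real_of_ereal (\<phi> x)" for x
  define r where "r p = snd p - g (fst p)" for p :: "'a \<times> real"
  have r_case: "(\<lambda>(x, y). y - real_of_ereal (\<phi> x)) = r" "(\<lambda>(x, y). \<bar>y - real_of_ereal (\<phi> x)\<bar>\<^sup>2) = (\<lambda>p. (r p)\<^sup>2)"
    by (auto simp: r_def g_def fun_eq_iff)
  from setting obtain \<mu> :: "('a \<times> real) measure" where \<mu>: "sets \<mu> = sets borel" "prob_space \<mu>" "measure \<mu> (S \<times> UNIV) = 1"
    "prob_space.indep_vars M (\<lambda>_. borel) (\<lambda>k \<omega>. (X k \<omega>, Y k \<omega>)) UNIV"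
    "\<forall>k. distr M borel (\<lambda>\<omega>. (X k \<omega>, Y k \<omega>)) = \<mu>"
    and r_int: "integrable (completion \<mu>) r"
    and r_cond: "AE p in completion \<mu>. real_cond_exp (completion \<mu>) (vimage_algebra UNIV fst borel) r p = 0"
    and r_sq: "integrable (completion \<mu>) (\<lambda>p. (r p)\<^sup>2)"
    and null: "same_null_sets_on S (distr \<mu> borel fst)"
    unfolding setting_stochastic_design_def r_case by (elim exE conjE)
  interpret prob_space M by fact
  interpret \<mu>: prob_space \<mu> by fact
  define R where "R k \<omega> = (X k \<omega>, Y k \<omega>)" for k \<omega>
  have R_indep: "indep_vars (\<lambda>_. borel) R UNIV" and R_distr: "distr M borel (R k) = \<mu>" for k
    using \<mu>(4,5) unfolding R_def by simp_all
  have rv [measurable]: "R k \<in> borel_measurable M" for k using R_indep by (auto simp: indep_vars_def)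
  have space_\<mu>: "space \<mu> = UNIV" using sets_eq_imp_space_eq[OF \<mu>(1)] by simp
  have fst_borel [measurable]: "fst \<in> borel_measurable (borel :: ('a \<times> real) measure)"
    and snd_borel [measurable]: "snd \<in> borel_measurable (borel :: ('a \<times> real) measure)"
    by (intro borel_measurable_continuous_onI continuous_on_fst continuous_on_snd continuous_on_id)+
  have meas_\<mu>: "f \<in> borel_measurable \<mu>" if "f \<in> borel_measurable borel" for f :: "'a \<times> real \<Rightarrow> 'c::topological_space"
    using that measurable_cong_sets[OF \<mu>(1) refl] by blast
  have fst_\<mu>: "fst \<in> borel_measurable \<mu>" by (rule meas_\<mu>[OF fst_borel])
  \<comment> \<open>Cutting \<open>g\<close> off outside the interior makes it Borel, whatever its
    boundary values.\<close>
  define h where "h x = indicator (interior S) x *\<^sub>R g x" for x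
  have g_conv: "convex_on S g" using g_convex unfolding g_def .
  then have "continuous_on (interior S) g"
    by (intro convex_on_continuous convex_on_subset[OF g_conv] interior_subset) (auto simp: S)
  then have h_meas [measurable]: "h \<in> borel_measurable borel"
    unfolding h_def by (intro borel_measurable_continuous_on_indicator) auto
  define f where "f p = indicator (interior S) (fst p) * (snd p - h (fst p))" for p :: "'a \<times> real"
  have ind_meas: "(\<lambda>p. indicator A (fst p) :: real) \<in> borel_measurable (borel :: ('a \<times> real) measure)"
    if "A \<in> sets borel" for A
    using that by measurable
  have f_meas [measurable]: "f \<in> borel_measurable borel"
    unfolding f_def using ind_meas[of "interior S"] by measurable
  have f_eq: "f p = r p" if "fst p \<in> interior S" for p using that by (simp add: f_def h_def r_def)
  have f_out: "f p = 0" if "fst p \<notin> interior S" for p using that by (simp add: f_def)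

  have vimage_S: "fst -` S \<inter> space \<mu> = S \<times> UNIV" unfolding space_\<mu> by auto
  have "emeasure (distr \<mu> borel fst) S = emeasure \<mu> (S \<times> UNIV)"
    using emeasure_distr[OF fst_\<mu>, of S] S(1) unfolding vimage_S by simp
  also have "\<dots> = 1" using \<mu>(3) by (simp add: \<mu>.emeasure_eq_measure)
  finally have "emeasure (distr \<mu> borel fst) (interior S) = 1"
    using emeasure_interior_eq[of "distr \<mu> borel fst" S] null S by simp
  then have "emeasure \<mu> (fst -` interior S \<inter> space \<mu>) = 1"
    using emeasure_distr[OF fst_\<mu>, of "interior S"] by simp
  then have "\<mu>.prob (fst -` interior S \<inter> space \<mu>) = 1" by (simp add: \<mu>.emeasure_eq_measure)
  then have "AE p in \<mu>. p \<in> fst -` interior S \<inter> space \<mu>" by (rule \<mu>.AE_prob_1)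
  then have int_\<mu>: "AE p in \<mu>. fst p \<in> interior S" by eventually_elim simp
  then have "AE p in \<mu>. f p = r p" by eventually_elim (rule f_eq)
  then have fr: "AE p in completion \<mu>. f p = r p" by (rule AE_completion)
  have f_meas_c: "f \<in> borel_measurable (completion \<mu>)" by (rule measurable_completion[OF meas_\<mu>[OF f_meas]])

  have "integrable (completion \<mu>) (\<lambda>p. (f p)\<^sup>2)"
  proof (rule integrable_cong_AE_imp[OF r_sq])
    show "AE p in completion \<mu>. (r p)\<^sup>2 = (f p)\<^sup>2" using fr by eventually_elim simp
  qed (use f_meas_c in measurable)
  moreover have "(\<lambda>p. (f p)\<^sup>2) \<in> borel_measurable \<mu>" by (rule meas_\<mu>) measurable
  ultimately have f_sq: "integrable \<mu> (\<lambda>p. (f p)\<^sup>2)" by (simp only: integrable_completion)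
  \<comment> \<open>The conditional mean of the residual given the design point vanishes, so its
    integral over any event determined by the first coordinate is 0. This is the centring required
    by \<open>mean\<close> when the indicator is random.\<close>
  have f_mean: "(\<integral>p. indicator A (fst p) * f p \<partial>\<mu>) = 0" if A: "A \<in> sets borel" for A
  proof -
    let ?F = "vimage_algebra UNIV fst (borel :: 'a measure) :: ('a \<times> real) measure"
    have "subalgebra (completion \<mu>) ?F"
      unfolding subalgebra_def
    proof
      show "space ?F = space (completion \<mu>)" by (simp add: space_\<mu>)
      have "fst -` B \<in> sets (completion \<mu>)" if "B \<in> sets borel" for B
        using measurable_sets[OF measurable_completion[OF fst_\<mu>] that] by (simp add: space_\<mu>)
      then show "sets ?F \<subseteq> sets (completion \<mu>)" by (subst sets_vimage_algebra2) auto
    qed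
    then have "finite_measure_subalgebra (completion \<mu>) ?F"
      using \<mu>.prob_space_completion
      by (simp add: finite_measure_subalgebra_def finite_measure_subalgebra_axioms_def prob_space.finite_measure)
    then interpret sub: sigma_finite_subalgebra "completion \<mu>" ?F
      by (rule finite_measure_subalgebra_is_sigma_finite)
    have AF: "fst -` A \<in> sets ?F" using in_vimage_algebra[OF A, of fst UNIV] by simp
    have Ac: "fst -` A \<in> sets (completion \<mu>)"
      using measurable_sets[OF measurable_completion[OF fst_\<mu>] A] by (simp add: space_\<mu>)
    have "(\<integral>p. indicator A (fst p) * f p \<partial>\<mu>) = (\<integral>p. indicator A (fst p) * f p \<partial>completion \<mu>)"
      by (rule integral_completion[symmetric], rule meas_\<mu>) (use ind_meas[OF A] in measurable)
    also have "\<dots> = (\<integral>p\<in>fst -` A. r p \<partial>completion \<mu>)"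
      unfolding set_lebesgue_integral_def
    proof (rule integral_cong_AE)
      show "(\<lambda>p. indicator A (fst p) * f p) \<in> borel_measurable (completion \<mu>)"
        by (rule measurable_completion, rule meas_\<mu>) (use ind_meas[OF A] in measurable)
      show "(\<lambda>p. indicat_real (fst -` A) p *\<^sub>R r p) \<in> borel_measurable (completion \<mu>)"
        using Ac borel_measurable_integrable[OF r_int] by measurable
      show "AE p in completion \<mu>. indicator A (fst p) * f p = indicat_real (fst -` A) p *\<^sub>R r p"
        using fr by eventually_elim (simp add: indicator_def)
    qed
    also have "\<dots> = (\<integral>p\<in>fst -` A. real_cond_exp (completion \<mu>) ?F r p \<partial>completion \<mu>)"
      by (rule sub.real_cond_exp_intA[OF r_int AF])
    also have "\<dots> = 0"
      unfolding set_lebesgue_integral_def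
    proof (rule integral_eq_zero_AE)
      show "AE p in completion \<mu>. indicat_real (fst -` A) p *\<^sub>R real_cond_exp (completion \<mu>) ?F r p = 0"
        using r_cond by eventually_elim simp
    qed
    finally show ?thesis .
  qed
  have weighted_sq: "integrable \<mu> (\<lambda>p. (indicator A (fst p) * f p)\<^sup>2)" if A: "A \<in> sets borel" for A
    by (rule Bochner_Integration.integrable_bound[OF f_sq], rule meas_\<mu>)
       (use ind_meas[OF A] in measurable, auto simp: indicator_def)
  have weighted_meas: "(\<lambda>p. indicator A (fst p) * f p) \<in> borel_measurable borel" if A: "A \<in> sets borel" for A
    using ind_meas[OF A] by measurable

  obtain \<B> :: "'a set set" where \<B>: "countable \<B>" "topological_basis \<B>" using ex_countable_basis by blast
  have mean: "AE \<omega> in M. \<forall>F\<in>{F. finite F \<and> F \<subseteq> \<B>}. \<forall>\<tau>>0. \<forall>\<^sub>F n in sequentially.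
      \<bar>\<Sum>k<n. indicator (\<Union>F) (fst (R k \<omega>)) * f (R k \<omega>)\<bar> \<le> \<tau> * real n"
  proof (subst AE_ball_countable[OF countable_Collect_finite_subset[OF \<B>(1)]], rule ballI)
    fix F assume "F \<in> {F. finite F \<and> F \<subseteq> \<B>}"
    then have "open (\<Union>F)" using topological_basis_open[OF \<B>(2)] by (intro open_Union) blast
    then have A: "\<Union>F \<in> sets borel" by (rule borel_open)
    show "AE \<omega> in M. \<forall>\<tau>>0. \<forall>\<^sub>F n in sequentially.
        \<bar>\<Sum>k<n. indicator (\<Union>F) (fst (R k \<omega>)) * f (R k \<omega>)\<bar> \<le> \<tau> * real n"
      by (rule iid_mean_zero[OF M R_indep R_distr weighted_meas[OF A] weighted_sq[OF A] f_mean[OF A]])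
  qed

  define q where "q V = (\<integral>p. indicat_real V (fst p) \<partial>\<mu>)" for V :: "'a set"
  have q: "q V = measure \<mu> (fst -` V)" if "V \<in> sets borel" for V
  proof -
    have eq: "(\<lambda>p. indicat_real V (fst p)) = indicator (fst -` V)" by (auto simp: indicator_def fun_eq_iff)
    show ?thesis unfolding q_def eq by (simp add: space_\<mu>)
  qed
  \<comment> \<open>Base sets suffice for \<open>design_dense\<close>: every nonempty open set
    contains a nonempty one, and its probability is positive.\<close>
  have visits_law: "AE \<omega> in M. \<forall>V\<in>\<B>. \<forall>\<tau>>0. \<forall>\<^sub>F n in sequentially.
      \<bar>\<Sum>k<n. indicator V (fst (R k \<omega>)) - q V\<bar> \<le> \<tau> * real n"
  proof (subst AE_ball_countable[OF \<B>(1)], rule ballI)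
    fix V assume "V \<in> \<B>"
    then have V: "V \<in> sets borel" using topological_basis_open[OF \<B>(2)] by (intro borel_open)
    have meas: "(\<lambda>p. indicator V (fst p) - q V) \<in> borel_measurable (borel :: ('a \<times> real) measure)"
      using ind_meas[OF V] by measurable
    have int: "integrable \<mu> (\<lambda>p. indicator V (fst p) :: real)"
      by (rule \<mu>.integrable_const_bound[of _ 1]) (use meas_\<mu>[OF ind_meas[OF V]] in \<open>auto simp: indicator_def\<close>)
    have sq: "integrable \<mu> (\<lambda>p. (indicator V (fst p) - q V)\<^sup>2)"
    proof (rule \<mu>.integrable_const_bound[of _ "(1 + \<bar>q V\<bar>)\<^sup>2"])
      have "\<bar>indicator V (fst p) - q V\<bar> \<le> 1 + \<bar>q V\<bar>" for p :: "'a \<times> real" by (auto simp: indicator_def)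
      then show "AE p in \<mu>. norm ((indicator V (fst p) - q V)\<^sup>2) \<le> (1 + \<bar>q V\<bar>)\<^sup>2"
        by (intro AE_I2) (simp add: power2_le_iff_abs_le)
      show "(\<lambda>p. (indicator V (fst p) - q V)\<^sup>2) \<in> borel_measurable \<mu>"
        using meas_\<mu>[OF meas] by measurable
    qed
    have "(\<integral>p. indicator V (fst p) - q V \<partial>\<mu>) = 0"
      using int by (simp add: q_def \<mu>.prob_space)
    from iid_mean_zero[OF M R_indep R_distr meas sq this]
    show "AE \<omega> in M. \<forall>\<tau>>0. \<forall>\<^sub>F n in sequentially. \<bar>\<Sum>k<n. indicator V (fst (R k \<omega>)) - q V\<bar> \<le> \<tau> * real n" .
  qed

  have bounded: "AE \<omega> in M. \<forall>e>0. \<forall>\<^sub>F n in sequentially.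
      (\<Sum>k<n. (f (R k \<omega>))\<^sup>2) \<le> (2 * (\<integral>p. (f p)\<^sup>2 \<partial>\<mu>) + e) * real n"
    by (rule iid_squares[OF M R_indep R_distr f_meas f_sq])
  \<comment> \<open>A countable exhaustion fixed before \<omega>. The second moment of
    \<open>f\<close> outside \<open>C m\<close> tends to 0 by dominated convergence, which becomes
    \<open>tight\<close>.\<close>
  obtain C :: "nat \<Rightarrow> 'a set" where C: "\<And>n. compact (C n)" "\<And>n. C n \<subseteq> interior S" "\<And>n. C n \<subseteq> interior (C (Suc n))"
    "\<Union>(range C) = interior S" "\<And>K. compact K \<Longrightarrow> K \<subseteq> interior S \<Longrightarrow> \<exists>N. \<forall>n\<ge>N. K \<subseteq> C n"
    by (rule open_Union_compact_subsets[OF open_interior]) (rule that; assumption)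
  have C_borel: "- C m \<in> sets borel" for m
    using C(1)[of m] by (intro borel_open open_Compl compact_imp_closed)
  have tail: "AE \<omega> in M. \<forall>m. \<forall>e>0. \<forall>\<^sub>F n in sequentially.
      (\<Sum>k<n. (indicator (- C m) (fst (R k \<omega>)) * f (R k \<omega>))\<^sup>2)
        \<le> (2 * (\<integral>p. (indicator (- C m) (fst p) * f p)\<^sup>2 \<partial>\<mu>) + e) * real n"
    unfolding AE_all_countable
    by (intro allI iid_squares[OF M R_indep R_distr] weighted_meas weighted_sq C_borel)
  have "(\<lambda>m. \<integral>p. (indicator (- C m) (fst p) * f p)\<^sup>2 \<partial>\<mu>) \<longlonglongrightarrow> (\<integral>p. 0 \<partial>\<mu>)"
  proof (rule integral_dominated_convergence[OF _ _ f_sq])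
    show "AE p in \<mu>. (\<lambda>m. (indicator (- C m) (fst p) * f p)\<^sup>2) \<longlonglongrightarrow> 0"
      using int_\<mu>
    proof eventually_elim
      case (elim p)
      then obtain N where "\<forall>n\<ge>N. {fst p} \<subseteq> C n" using C(5)[of "{fst p}"] by auto
      then have "\<forall>\<^sub>F m in sequentially. (indicator (- C m) (fst p) * f p)\<^sup>2 = 0"
        unfolding eventually_sequentially by (intro exI[of _ N]) simp
      then show ?case by (rule tendsto_eventually)
    qed
    show "(\<lambda>p. (indicator (- C m) (fst p) * f p)\<^sup>2) \<in> borel_measurable \<mu>" for m
      by (rule borel_measurable_integrable[OF weighted_sq[OF C_borel]])
    show "AE p in \<mu>. norm ((indicator (- C m) (fst p) * f p)\<^sup>2) \<le> (f p)\<^sup>2" for m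
      by (intro AE_I2) (auto simp: indicator_def)
  qed simp
  then have tail_lim: "(\<lambda>m. \<integral>p. (indicator (- C m) (fst p) * f p)\<^sup>2 \<partial>\<mu>) \<longlonglongrightarrow> 0" by simp

  have "AE \<omega> in M. fst (R k \<omega>) \<in> interior S" for k
  proof -
    have "AE p in distr M borel (R k). fst p \<in> interior S" unfolding R_distr by (rule int_\<mu>)
    then show ?thesis
      by (subst (asm) AE_distr_iff[OF rv]) (use measurable_sets[OF fst_borel, of "interior S"] in \<open>simp add: vimage_def\<close>)
  qed
  \<comment> \<open>Almost surely all design points are interior, so \<open>f (R k \<omega>)\<close>
    really is the error of observation \<open>k\<close>.\<close>
  then have "AE \<omega> in M. \<forall>k. fst (R k \<omega>) \<in> interior S" by (simp add: AE_all_countable)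
  then have "AE \<omega> in M. convex_regression S g (\<lambda>k. X k \<omega>) (\<lambda>k. Y k \<omega>) (\<lambda>k. f (R k \<omega>)) \<B>"
    using mean visits_law bounded tail
  proof eventually_elim
    case (elim \<omega>)
    have Xi: "X k \<omega> \<in> interior S" for k using elim(1) by (simp add: R_def)
    have fstR: "fst (R k \<omega>) = X k \<omega>" for k by (simp add: R_def)
    show ?case
    proof
      show "X k \<omega> \<in> S" for k using Xi interior_subset by blast
      show "Y k \<omega> = g (X k \<omega>) + f (R k \<omega>)" for k
        using f_eq[of "R k \<omega>"] Xi by (simp add: fstR) (simp add: r_def R_def)
      show "\<forall>\<^sub>F n in sequentially. \<bar>\<Sum>k<n. indicator (\<Union>F) (X k \<omega>) * f (R k \<omega>)\<bar> \<le> \<tau> * real n"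
        if "finite F" "F \<subseteq> \<B>" "0 < \<tau>" for F \<tau>
        using elim(2)[THEN bspec, of F] that by (simp add: fstR)
      show "\<exists>C. \<forall>\<^sub>F n in sequentially. (\<Sum>k<n. (f (R k \<omega>))\<^sup>2) \<le> C * real n"
        using elim(4)[rule_format, OF zero_less_one] by (rule exI)
      show "\<exists>c>0. \<forall>\<^sub>F n in sequentially. c * real n \<le> real (card {k. k < n \<and> X k \<omega> \<in> U})"
        if U: "open U" "U \<noteq> {}" "U \<subseteq> interior S" for U
      proof -
        obtain u where "u \<in> U" using U(2) by blast
        then obtain V where V: "V \<in> \<B>" "u \<in> V" "V \<subseteq> U" by (rule topological_basisE[OF \<B>(2) U(1)])
        have "open V" by (rule topological_basis_open[OF \<B>(2) V(1)])
        then have "V \<in> sets borel" by (rule borel_open)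
        have "V \<subseteq> S" using V(3) U(3) interior_subset by blast
        then have "emeasure (distr \<mu> borel fst) V \<noteq> 0"
          using V(2) \<open>open V\<close> by (intro emeasure_open_pos[OF null]) auto
        then have "emeasure \<mu> (fst -` V) \<noteq> 0"
          using emeasure_distr[OF fst_\<mu> \<open>V \<in> sets borel\<close>] by (simp add: space_\<mu>)
        then have pos: "0 < q V" unfolding q[OF \<open>V \<in> sets borel\<close>] by (simp add: \<mu>.emeasure_eq_measure less_le)
        then have "\<forall>\<^sub>F n in sequentially. \<bar>\<Sum>k<n. indicator V (fst (R k \<omega>)) - q V\<bar> \<le> q V / 2 * real n"
          by (intro elim(3)[rule_format] V(1)) simp
        then have "\<forall>\<^sub>F n in sequentially. q V / 2 * real n \<le> visits (\<lambda>k. X k \<omega>) n U"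
        proof eventually_elim
          case (elim n)
          have "(\<Sum>k<n. indicator V (fst (R k \<omega>)) - q V) = visits (\<lambda>k. X k \<omega>) n V - q V * real n"
            unfolding visits_eq_sum sum_subtractf fstR by simp
          then have "- (visits (\<lambda>k. X k \<omega>) n V - q V * real n) \<le> q V / 2 * real n"
            using elim by (simp only: abs_le_iff)
          then have "q V / 2 * real n \<le> visits (\<lambda>k. X k \<omega>) n V" by (simp add: mult.commute)
          also have "\<dots> \<le> visits (\<lambda>k. X k \<omega>) n U" by (rule visits_mono[OF V(3)])
          finally show ?case .
        qed
        then show ?thesis using pos unfolding visits_def by (intro exI[of _ "q V / 2"] conjI) simp_all
      qed
      show "\<exists>K. compact K \<and> K \<subseteq> interior S \<and>
          (\<forall>\<^sub>F n in sequentially. (\<Sum>k<n. indicator (- K) (X k \<omega>) * (f (R k \<omega>))\<^sup>2) \<le> \<eta> * real n)"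
        if "0 < \<eta>" for \<eta>
      proof -
        have "\<forall>\<^sub>F m in sequentially. (\<integral>p. (indicator (- C m) (fst p) * f p)\<^sup>2 \<partial>\<mu>) < \<eta> / 4"
          using that by (intro order_tendstoD(2)[OF tail_lim]) simp
        then obtain m where m: "(\<integral>p. (indicator (- C m) (fst p) * f p)\<^sup>2 \<partial>\<mu>) < \<eta> / 4"
          unfolding eventually_sequentially by blast
        have "\<forall>\<^sub>F n in sequentially. (\<Sum>k<n. (indicator (- C m) (fst (R k \<omega>)) * f (R k \<omega>))\<^sup>2)
            \<le> (2 * (\<integral>p. (indicator (- C m) (fst p) * f p)\<^sup>2 \<partial>\<mu>) + \<eta> / 2) * real n"
          using that by (intro elim(5)[rule_format]) simp
        then have "\<forall>\<^sub>F n in sequentially. (\<Sum>k<n. indicator (- C m) (X k \<omega>) * (f (R k \<omega>))\<^sup>2) \<le> \<eta> * real n"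
        proof eventually_elim
          case (elim n)
          have "(\<Sum>k<n. indicator (- C m) (X k \<omega>) * (f (R k \<omega>))\<^sup>2)
              = (\<Sum>k<n. (indicator (- C m) (fst (R k \<omega>)) * f (R k \<omega>))\<^sup>2)"
            unfolding fstR by (intro sum.cong refl) (simp add: indicator_def)
          also have "\<dots> \<le> (2 * (\<integral>p. (indicator (- C m) (fst p) * f p)\<^sup>2 \<partial>\<mu>) + \<eta> / 2) * real n" by (rule elim)
          also have "\<dots> \<le> \<eta> * real n" using m by (intro mult_right_mono) auto
          finally show ?case .
        qed
        then show ?thesis using C(1,2) by (intro exI[of _ "C m"] conjI)
      qed
    qed (fact S(2) g_conv \<B>(2))+
  qed
  moreover have "g = (\<lambda>x. real_of_ereal (\<phi> x))" by (simp add: g_def fun_eq_iff)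
  ultimately show ?thesis by (intro exI[of _ "\<lambda>k \<omega>. f (R k \<omega>)"] exI[of _ \<B>]) (simp only:)
qed

section \<open>Consistency of the subgradients\<close>

text \<open>In \<open>ennreal\<close> the supremum always exists, and it is 0 when no subgradient
  occurs, as happens for empty \<open>K\<close>.\<close>

lemma (in convex_regression) SUP_subgradient_error_tendsto_0:
  assumes diff: "g differentiable_on interior S" and K: "compact K" "K \<subseteq> interior S"
  shows "(\<lambda>n. SUP (u, \<xi>) \<in> (SIGMA u:K. subdifferential (cls_estimator S x y n) u).
    ennreal (norm (\<xi> - gradient g u))) \<longlonglongrightarrow> 0" (is "?f \<longlonglongrightarrow> 0")
proof (rule order_tendstoI)
  fix a :: ennreal assume "0 < a"
  \<comment> \<open>Strict bounds weaken to non-strict ones under a supremum, so an intermediate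
    level is inserted.\<close>
  from dense[OF this] obtain b where b: "0 < b" "b < a" by (elim exE conjE)
  obtain \<epsilon> where \<epsilon>: "b = ennreal \<epsilon>" "0 < \<epsilon>" using b by (cases b) auto
  have "\<forall>\<^sub>F n in sequentially. \<forall>u\<in>K. \<forall>\<xi>\<in>subdifferential (cls_estimator S x y n) u. norm (\<xi> - gradient g u) < \<epsilon>"
    by (rule subgradients_uniformly_close[OF diff K \<epsilon>(2)])
  then show "\<forall>\<^sub>F n in sequentially. ?f n < a"
  proof eventually_elim
    case (elim n)
    have "?f n \<le> b"
    proof (rule SUP_least)
      fix p assume "p \<in> (SIGMA u:K. subdifferential (cls_estimator S x y n) u)"
      then obtain u \<xi> where p: "p = (u, \<xi>)" "u \<in> K" "\<xi> \<in> subdifferential (cls_estimator S x y n) u" by (rule SigmaE)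
      then have "norm (\<xi> - gradient g u) < \<epsilon>" using elim by simp
      then show "(case p of (u, \<xi>) \<Rightarrow> ennreal (norm (\<xi> - gradient g u))) \<le> b"
        unfolding p(1) \<epsilon>(1) by (simp add: ennreal_leI)
    qed
    then show ?case using b(2) by (rule le_less_trans)
  qed
qed simp

text \<open>The set \<open>A\<close> may fail to be measurable; the complement of a null set
  covering its exceptional points is a measurable subset of full measure.\<close>

lemma inner_prob_eq_1:
  assumes "prob_space M" and AE: "AE \<omega> in M. \<omega> \<in> A" and "A \<subseteq> space M"
  shows "inner_prob M A = 1"
proof -
  interpret prob_space M by fact
  obtain N where N: "{\<omega> \<in> space M. \<omega> \<notin> A} \<subseteq> N" "N \<in> null_sets M"
    using AE unfolding eventually_ae_filter by blast
  have sets: "space M - N \<in> events" using N(2) by auto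
  have "prob (space M - N) = 1"
    using N(2) by (subst prob_compl) (auto simp: measure_eq_0_null_sets)
  then have "1 \<in> measure M ` {B \<in> events. B \<subseteq> A}"
    using N(1) sets by (intro image_eqI[of _ _ "space M - N"]) auto
  then show ?thesis unfolding inner_prob_def by (intro cSup_eq_maximum) auto
qed

theorem theorem3p2:
  fixes M :: "'w measure"
    and S :: "'a::euclidean_space set"
    and \<phi> :: "'a \<Rightarrow> ereal"
    and X :: "nat \<Rightarrow> 'w \<Rightarrow> 'a"
    and Y :: "nat \<Rightarrow> 'w \<Rightarrow> real"
    and \<sigma> :: real
  assumes "prob_space M"
    and "closed S" and "convex S" and "interior S \<noteq> {}"
    and "proper_convex \<phi>" and "S \<subseteq> Dom \<phi>"
    and "setting_iid_errors M S \<phi> X Y \<sigma> \<or>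
         setting_heteroscedastic_errors M S \<phi> X Y \<sigma> \<or>
         setting_stochastic_design M S \<phi> X Y \<sigma>"
    and "(\<lambda>x. real_of_ereal (\<phi> x)) differentiable_on interior S"
  shows "inner_prob M
    {\<omega> \<in> space M. \<forall>K. compact K \<and> K \<subseteq> interior S \<longrightarrow>
       (\<lambda>n. SUP (x, \<xi>) \<in> (SIGMA x:K. subdifferential
                  (cls_estimator S (\<lambda>k. X k \<omega>) (\<lambda>k. Y k \<omega>) n) x).
             ennreal (norm (\<xi> - gradient (\<lambda>u. real_of_ereal (\<phi> u)) x)))
         \<longlonglongrightarrow> 0} = 1" (is "inner_prob M ?A = 1")
proof -
  have g: "convex_on S (\<lambda>x. real_of_ereal (\<phi> x))"
    by (rule convex_on_real_of_ereal[OF assms(5,3,6)])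
  have "\<exists>e \<B>. AE \<omega> in M. convex_regression S (\<lambda>x. real_of_ereal (\<phi> x)) (\<lambda>k. X k \<omega>) (\<lambda>k. Y k \<omega>) (\<lambda>k. e k \<omega>) \<B>"
    using assms(7)
    by (elim disjE) (rule AE_convex_regression_iid_errors[OF assms(1-3) g]
      AE_convex_regression_heteroscedastic_errors[OF assms(1-3) g]
      AE_convex_regression_stochastic_design[OF assms(1-3) g], assumption)+
  then obtain e \<B> where
    "AE \<omega> in M. convex_regression S (\<lambda>x. real_of_ereal (\<phi> x)) (\<lambda>k. X k \<omega>) (\<lambda>k. Y k \<omega>) (\<lambda>k. e k \<omega>) \<B>"
    by (elim exE)
  \<comment> \<open>For a sample point satisfying \<open>convex_regression\<close> the convergence
    holds for every compact set, so the uncountably many \<open>K\<close> share one null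
    set.\<close>
  then have "AE \<omega> in M. \<omega> \<in> ?A"
    using AE_space
  proof eventually_elim
    case (elim \<omega>)
    show ?case
      by (intro CollectI conjI allI impI elim(2)
          convex_regression.SUP_subgradient_error_tendsto_0[OF elim(1) assms(8)]; elim conjE)
  qed
  then show ?thesis by (rule inner_prob_eq_1[OF assms(1)]) (rule Collect_restrict)
qed

end
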